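(* Suppose $r$ is a real number such that $0 < r \leq 1$. Suppose $f: [0, \infty) \to (0, 1/2]$ is a continuous, strictly decreasing function with the following three properties: (i) $f(x) \to 0$ as $x \to \infty$; (ii) for every $u \in (0,1)$, $u^x = o(f(x))$ as $x \to \infty$; and (iii) the mapping $x \mapsto \log f(x)$, for $x \in [0,\infty)$, is convex on $[0, \infty)$. Then there exist a probability space $(\Omega, \mathcal{F}, P)$ and, defined on it, a strictly stationary, countable-state Markov chain $X := (X_k,\ k\in \mathbb{Z})$ of real-valued random variables such that $X$ is reversible and for every positive integer $n$, $$\rho_X(n) = r^n \quad \text{and} \quad \tfrac12\, r^n f(n) \leq \alpha_X(n) \leq \beta_X(n) \leq 12\, r^n f(n).$$
   Context: $\log$ denotes the natural logarithm. "Countable" means finite or countably infinite; a countable-state Markov chain is one whose random variables take values in a countable set (here, a countable subset of $\mathbb{R}$). For two $\sigma$-fields $\mathcal{A}, \mathcal{B} \subset \mathcal{F}$ on a probability space $(\Omega,\mathcal{F},P)$, define $$\alpha(\mathcal{A},\mathcal{B}) := \sup_{A\in \mathcal{A}, B\in \mathcal{B}} |P(A\cap B)-P(A) P(B)|,$$ $$\beta(\mathcal{A},\mathcal{B}):= \sup \frac{1}{2} \sum^I_{i=1}\sum^J_{j=1} |P(A_i\cap B_j) - P(A_i)P(B_j)|,$$ where the supremum is over all pairs of finite partitions $\{A_1,\dots,A_I\}$ and $\{B_1,\dots,B_J\}$ of $\Omega$ with $A_i\in \mathcal{A}$ for each $i$ and $B_j\in \mathcal{B}$ for each $j$, and $$\rho(\mathcal{A},\mathcal{B})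 := \sup | \mathrm{Corr}(Y,Z)|,$$ where the supremum is over all pairs of square-integrable (real) random variables $Y$, $Z$ such that $Y$ is $\mathcal{A}$-measurable and $Z$ is $\mathcal{B}$-measurable (with $0/0 := 0$ when a variance vanishes). For a strictly stationary sequence $X := (X_k, k \in \mathbb{Z})$ of real-valued random variables, let $\mathcal{F}^j_{-\infty} := \sigma(X_k, k\le j)$ and $\mathcal{F}^\infty_j:= \sigma(X_k, k\ge j)$ for $j \in \mathbb{Z}$, and for each positive integer $n$ define $$\alpha_X(n) := \alpha(\mathcal{F}^0_{-\infty}, \mathcal{F}^\infty_n),\quad \beta_X(n) := \beta(\mathcal{F}^0_{-\infty}, \mathcal{F}^\infty_n),\quad \rho_X(n) := \rho(\mathcal{F}^0_{-\infty}, \mathcal{F}^\infty_n).$$ A strictly stationary Markov chain $X = (X_k, k \in \mathbb{Z})$ is "reversible" if the distribution (on $\mathbb{R}^{\mathbb{Z}}$) of the time-reversed sequence $(X_{-k}, k \in \mathbb{Z})$ is identical to that of $X$. *)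

theory Defs
  imports "HOL-Probability.Probability" "HOL-Library.Landau_Symbols"
begin

section \<open>Measures of dependence between two sigma-fields\<close>

text \<open>A sub-sigma-field is represented, as for \<^const>\<open>subalgebra\<close> and \<^const>\<open>real_cond_exp\<close>,
  by a measure of which only the underlying space and the measurable sets matter.\<close>

definition alpha_coeff :: "'a measure \<Rightarrow> 'a measure \<Rightarrow> 'a measure \<Rightarrow> real" where
  "alpha_coeff M \<A> \<B> =
    (SUP (A, B) \<in> sets \<A> \<times> sets \<B>. \<bar>measure M (A \<inter> B) - measure M A * measure M B\<bar>)"

text \<open>\<^const>\<open>partition_on\<close> excludes empty blocks; they would contribute nothing to the sum.\<close>

definition finite_partitions :: "'a measure \<Rightarrow> 'a measure \<Rightarrow> 'a set set set" where
  "finite_partitions M \<A> = {P. finite P \<and> partition_on (space M) P \<and> P \<subseteq> sets \<A>}"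

definition beta_coeff :: "'a measure \<Rightarrow> 'a measure \<Rightarrow> 'a measure \<Rightarrow> real" where
  "beta_coeff M \<A> \<B> =
    (SUP (P, Q) \<in> finite_partitions M \<A> \<times> finite_partitions M \<B>.
      1 / 2 * (\<Sum>A\<in>P. \<Sum>B\<in>Q. \<bar>measure M (A \<inter> B) - measure M A * measure M B\<bar>))"

definition cov :: "'a measure \<Rightarrow> ('a \<Rightarrow> real) \<Rightarrow> ('a \<Rightarrow> real) \<Rightarrow> real" where
  "cov M Y Z = (\<integral>\<omega>. (Y \<omega> - integral\<^sup>L M Y) * (Z \<omega> - integral\<^sup>L M Z) \<partial>M)"

text \<open>The convention \<open>0 / 0 = 0\<close> is that of division in HOL.\<close>

definition corr :: "'a measure \<Rightarrow> ('a \<Rightarrow> real) \<Rightarrow> ('a \<Rightarrow> real) \<Rightarrow> real" where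
  "corr M Y Z = cov M Y Z / (sqrt (cov M Y Y) * sqrt (cov M Z Z))"

definition square_integrable_rvs :: "'a measure \<Rightarrow> 'a measure \<Rightarrow> ('a \<Rightarrow> real) set" where
  "square_integrable_rvs M \<A> = {Y. Y \<in> borel_measurable \<A> \<and> integrable M (\<lambda>\<omega>. (Y \<omega>)\<^sup>2)}"

definition rho_coeff :: "'a measure \<Rightarrow> 'a measure \<Rightarrow> 'a measure \<Rightarrow> real" where
  "rho_coeff M \<A> \<B> =
    (SUP (Y, Z) \<in> square_integrable_rvs M \<A> \<times> square_integrable_rvs M \<B>. \<bar>corr M Y Z\<bar>)"


section \<open>Two-sided real-valued random sequences\<close>

definition gen_field :: "'a measure \<Rightarrow> (int \<Rightarrow> 'a \<Rightarrow> real) \<Rightarrow> int set \<Rightarrow> 'a measure" where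
  "gen_field M X K = sigma (space M) {X k -` B \<inter> space M | k B. k \<in> K \<and> B \<in> sets borel}"

definition alpha_mix :: "'a measure \<Rightarrow> (int \<Rightarrow> 'a \<Rightarrow> real) \<Rightarrow> nat \<Rightarrow> real" where
  "alpha_mix M X n = alpha_coeff M (gen_field M X {..0}) (gen_field M X {int n..})"

definition beta_mix :: "'a measure \<Rightarrow> (int \<Rightarrow> 'a \<Rightarrow> real) \<Rightarrow> nat \<Rightarrow> real" where
  "beta_mix M X n = beta_coeff M (gen_field M X {..0}) (gen_field M X {int n..})"

definition rho_mix :: "'a measure \<Rightarrow> (int \<Rightarrow> 'a \<Rightarrow> real) \<Rightarrow> nat \<Rightarrow> real" where
  "rho_mix M X n = rho_coeff M (gen_field M X {..0}) (gen_field M X {int n..})"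

definition random_sequence :: "'a measure \<Rightarrow> (int \<Rightarrow> 'a \<Rightarrow> real) \<Rightarrow> bool" where
  "random_sequence M X \<longleftrightarrow> (\<forall>k. X k \<in> borel_measurable M)"

definition seq_law :: "'a measure \<Rightarrow> (int \<Rightarrow> 'a \<Rightarrow> real) \<Rightarrow> (int \<Rightarrow> real) measure" where
  "seq_law M X = distr M (\<Pi>\<^sub>M k\<in>UNIV. borel) (\<lambda>\<omega> k. X k \<omega>)"

definition strictly_stationary :: "'a measure \<Rightarrow> (int \<Rightarrow> 'a \<Rightarrow> real) \<Rightarrow> bool" where
  "strictly_stationary M X \<longleftrightarrow> (\<forall>h. seq_law M (\<lambda>k. X (k + h)) = seq_law M X)"

definition reversible :: "'a measure \<Rightarrow> (int \<Rightarrow> 'a \<Rightarrow> real) \<Rightarrow> bool" where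
  "reversible M X \<longleftrightarrow> seq_law M (\<lambda>k. X (- k)) = seq_law M X"

text \<open>The Markov property: conditionally on the whole past up to time \<open>k\<close>, the law of
  \<open>X (k + 1)\<close> depends only on \<open>X k\<close>.\<close>

definition markov :: "'a measure \<Rightarrow> (int \<Rightarrow> 'a \<Rightarrow> real) \<Rightarrow> bool" where
  "markov M X \<longleftrightarrow> (\<forall>k. \<forall>B\<in>sets borel. AE \<omega> in M.
     real_cond_exp M (gen_field M X {..k}) (\<lambda>\<omega>. indicator B (X (k + 1) \<omega>)) \<omega> =
     real_cond_exp M (gen_field M X {k}) (\<lambda>\<omega>. indicator B (X (k + 1) \<omega>)) \<omega>)"

definition countable_state :: "'a measure \<Rightarrow> (int \<Rightarrow> 'a \<Rightarrow> real) \<Rightarrow> bool" where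
  "countable_state M X \<longleftrightarrow> (\<exists>S. countable S \<and> (\<forall>k. \<forall>\<omega>\<in>space M. X k \<omega> \<in> S))"

end

theory Submission
  imports Defs
begin

text \<open>Chords of the convex function \<open>ln f\<close> over suitably chosen consecutive intervals give exponentials
  \<open>p k * u k ^ n\<close> whose maximum over \<open>k\<close> dominates \<open>f n\<close> while their sum is at most \<open>6 * f n\<close>, with
  \<open>u k\<close> increasing to 1 because \<open>f\<close> decays subexponentially. Let the state \<open>k + 1\<close> have stationary
  probability \<open>p k\<close> and let each step of the chain draw an independent random level, which is at most
  \<open>k + 1\<close> with probability \<open>r * u k\<close> and infinite with probability \<open>1 - r\<close>; states below the level are
  resampled from the conditional stationary law, the other states stay put. After \<open>n\<close> steps only the
  maximal level matters, and it is at most \<open>k + 1\<close> with probability \<open>(r * u k) ^ n\<close>.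

  Given the maximal level, the transition operator is a conditional expectation. It is therefore an
  \<open>L\<^sup>2\<close> contraction, and it kills centred functions if the level is infinite, so \<open>\<rho>(n) \<le> r ^ n\<close>; its total
  variation distance from independence is at most twice the mass of the states not below the level,
  which averages to \<open>\<beta>(n) \<le> 2 * (\<Sum>k. p k * (r * u k) ^ n)\<close>. The lower bounds for \<open>\<alpha>\<close> and
  \<open>\<rho>\<close> come from the events that the chain is at \<open>k + 1\<close> at the times 0 and \<open>n\<close>.\<close>

section \<open>Exponentials below and above a log-convex function\<close>

text \<open>Exponentials are the right building blocks because the distribution function of a
  maximum of n independent levels is an n-th power. For this the numbers \<open>r * u k\<close> have
  to be values of one distribution function, hence increasing in k; convexity of \<open>ln f\<close>
  supplies exactly this, because slopes of consecutive chords increase. The factor r is an atom at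
  level \<infinity>, which erases all memory and so bounds every correlation by
  \<open>r ^ n\<close>. A single state only yields the correlation \<open>(r * u k) ^ n\<close>;
  equality for \<rho> comes from the limit 1 of \<open>u k\<close>, that is, from the subexponential
  decay of f. State 0 receives the mass that the \<open>p k\<close> leave over. Every level that can
  occur exceeds 0, so this state is resampled at each step and adds nothing to the bound on \<beta>
  for positive n. The constant 12 is the factor 2 of the total variation estimate times the factor 6
  of the sum of exponentials. The constant 1 / 2 bounds \<open>1 - p k\<close> from below: the
  indicator of a state has variance \<open>p k * (1 - p k)\<close>, and no \<open>p k\<close>
  exceeds \<open>f 0\<close>.\<close>

definition chord :: "(real \<Rightarrow> real) \<Rightarrow> real \<Rightarrow> real \<Rightarrow> real \<Rightarrow> real" where
  "chord \<phi> a b x = \<phi> a + (\<phi> b - \<phi> a) / (b - a) * (x - a)"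

lemma chord_left [simp]: "chord \<phi> a b a = \<phi> a"
  by (simp add: chord_def)

lemma chord_right [simp]: "a < b \<Longrightarrow> chord \<phi> a b b = \<phi> b"
  by (simp add: chord_def)

lemma chord_add: "chord \<phi> a b y = chord \<phi> a b x + (\<phi> b - \<phi> a) / (b - a) * (y - x)"
  unfolding chord_def by (simp only: algebra_simps)

text \<open>The end of the interval nearer to x is a convex combination of x and the far end;
  convexity there, solved for \<open>\<phi> x\<close>, is the claim.\<close>

lemma convex_ge_chord_outside:
  assumes "convex_on S \<phi>" "a \<in> S" "b \<in> S" "x \<in> S" "a < b" "x \<le> a \<or> b \<le> x"
  shows "chord \<phi> a b x \<le> \<phi> x"
proof -
  consider "x = a" | "x < a" | "x = b" | "b < x" using assms(6) by linarith
  then show ?thesis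
  proof cases
    case 2
    define t where "t = (b - a) / (b - x)"
    have t: "0 < t" "t < 1" "t * (b - x) = b - a" using assms 2 by (auto simp: t_def)
    then have "(1 - t) * b + t * x = a" by (simp add: algebra_simps)
    then have "\<phi> a \<le> (1 - t) * \<phi> b + t * \<phi> x"
      using convex_onD[OF assms(1), of t b x] assms t by simp
    then have "(\<phi> b - \<phi> x) * t \<le> \<phi> b - \<phi> a" by (simp add: algebra_simps)
    then have "\<phi> b - \<phi> x \<le> (\<phi> b - \<phi> a) / t" using t by (simp only: pos_le_divide_eq)
    moreover have "(\<phi> b - \<phi> a) / (b - a) * (x - b) = - ((\<phi> b - \<phi> a) / t)"
      using assms 2 by (simp add: t_def field_split_simps)
    moreover have "chord \<phi> a b x = \<phi> b + (\<phi> b - \<phi> a) / (b - a) * (x - b)"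
      using chord_add[of \<phi> a b x b] assms(5) by simp
    ultimately show ?thesis by simp
  next
    case 4
    define t where "t = (b - a) / (x - a)"
    have t: "0 < t" "t < 1" "t * (x - a) = b - a" using assms 4 by (auto simp: t_def)
    then have "(1 - t) * a + t * x = b" by (simp add: algebra_simps)
    then have "\<phi> b \<le> (1 - t) * \<phi> a + t * \<phi> x"
      using convex_onD[OF assms(1), of t a x] assms t by simp
    then have "\<phi> b - \<phi> a \<le> (\<phi> x - \<phi> a) * t" by (simp add: algebra_simps)
    then have "(\<phi> b - \<phi> a) / t \<le> \<phi> x - \<phi> a" using t by (simp only: pos_divide_le_eq)
    moreover have "(\<phi> b - \<phi> a) / (b - a) * (x - a) = (\<phi> b - \<phi> a) / t"
      by (simp add: t_def)
    ultimately show ?thesis by (simp add: chord_def)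
  qed (use assms in auto)
qed

lemma convex_le_chord_inside:
  assumes "convex_on S \<phi>" "a \<in> S" "b \<in> S" "a < b" "a \<le> x" "x \<le> b"
  shows "\<phi> x \<le> chord \<phi> a b x"
proof -
  define t where "t = (x - a) / (b - a)"
  have t: "0 \<le> t" "t \<le> 1" "t * (b - a) = x - a" using assms by (auto simp: t_def)
  then have "(1 - t) * a + t * b = x" by (simp add: algebra_simps)
  then have "\<phi> x \<le> (1 - t) * \<phi> a + t * \<phi> b"
    using convex_onD[OF assms(1), of t a b] assms t by simp
  moreover have "(\<phi> b - \<phi> a) / (b - a) * (x - a) = t * (\<phi> b - \<phi> a)"
    by (simp add: t_def)
  ultimately show ?thesis by (simp add: chord_def algebra_simps)
qed

lemma sums_le_geometric:
  fixes g :: "nat \<Rightarrow> real"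
  assumes g0: "\<And>k. 0 \<le> g k" and g1: "\<And>k. g (Suc k) \<le> g k / 3"
  shows "summable g" "suminf g \<le> 3 / 2 * g 0"
proof -
  have le: "g k \<le> g 0 * (1 / 3) ^ k" for k
  proof (induction k)
    case (Suc k)
    then show ?case using g1[of k] by simp
  qed simp
  have s: "(\<lambda>k. g 0 * (1 / 3) ^ k) sums (g 0 * (1 / (1 - 1 / 3)))"
    by (intro sums_mult geometric_sums) auto
  show "summable g"
    by (rule summable_comparison_test'[OF sums_summable[OF s], of 0]) (use le g0 in auto)
  then have "suminf g \<le> g 0 * (1 / (1 - 1 / 3))"
    using suminf_le[OF le _ sums_summable[OF s]] sums_unique[OF s] by simp
  then show "suminf g \<le> 3 / 2 * g 0" by simp
qed

lemma sum_le_geometric_descending: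
  fixes g :: "nat \<Rightarrow> real"
  assumes g0: "\<And>k. 0 \<le> g k" and g1: "\<And>k. k < m \<Longrightarrow> g k \<le> g (Suc k) / 3"
  shows "(\<Sum>k\<le>m. g k) \<le> 3 / 2 * g m"
  using g1
proof (induction m)
  case 0
  then show ?case using g0[of 0] by simp
next
  case (Suc m)
  then have "(\<Sum>k\<le>m. g k) \<le> 3 / 2 * g m" "g m \<le> g (Suc m) / 3" by auto
  then show ?case by simp
qed

section \<open>Chords with a prescribed gap\<close>

locale subexponential_log_convex =
  fixes \<phi> :: "real \<Rightarrow> real"
  assumes cont: "continuous_on {0..} \<phi>"
    and decr: "\<And>x y. 0 \<le> x \<Longrightarrow> x < y \<Longrightarrow> \<phi> y < \<phi> x"
    and lim: "filterlim \<phi> at_bot at_top"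
    and slow: "\<And>e. 0 < e \<Longrightarrow> eventually (\<lambda>x. - e * x \<le> \<phi> x) at_top"
    and convex: "convex_on {0..} \<phi>"
    and neg: "\<phi> 0 < 0"
begin

text \<open>Let \<phi> fall by \<open>2 * ln 3\<close> from a to y. Because \<phi> decays slower
  than linearly, the far end b can be moved out until the chord is so flat that it loses at most
  \<open>ln 3\<close> between a and y; the rest of the fall is the gap.\<close>

lemma chord_gap_unbounded:
  assumes a: "0 \<le> a"
  obtains b y where "a < y" "y < b" "\<phi> y + ln 3 \<le> chord \<phi> a b y"
proof -
  have "eventually (\<lambda>x. \<phi> x \<le> \<phi> a - 2 * ln 3) at_top"
    using lim by (auto simp: filterlim_at_bot)
  moreover have "eventually (\<lambda>x. a < x) at_top" by (rule eventually_gt_at_top)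
  ultimately have "eventually (\<lambda>x. \<phi> x \<le> \<phi> a - 2 * ln 3 \<and> a < x) at_top"
    by (rule eventually_conj)
  then obtain y where y: "\<phi> y \<le> \<phi> a - 2 * ln 3" "a < y"
    by (auto simp: eventually_at_top_linorder)
  \<comment> \<open>The slope of the chord will be at least \<open>- (2 * e)\<close>, which over the
    length \<open>y - a\<close> amounts to \<open>- ln 3\<close>. The factor 2 pays for estimating b
    by \<open>2 * (b - a)\<close>.\<close>
  define e where "e = ln 3 / (2 * (y - a))"
  have e: "0 < e" using y by (auto simp: e_def)
  have "eventually (\<lambda>x. - e * x \<le> \<phi> x \<and> max y (2 * a) < x) at_top"
    using slow[OF e] eventually_gt_at_top by (rule eventually_conj)
  then obtain b where b: "- e * b \<le> \<phi> b" "y < b" "2 * a < b"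
    by (auto simp: eventually_at_top_linorder)
  have "\<phi> a \<le> 0" using decr[of 0 a] neg a by (cases "a = 0") auto
  then have "- e * b \<le> \<phi> b - \<phi> a" using b(1) by linarith
  moreover have "- e * (2 * (b - a)) \<le> - e * b" using e b by simp
  ultimately have "- (2 * e) * (b - a) \<le> \<phi> b - \<phi> a" by (simp add: algebra_simps)
  then have "- (2 * e) \<le> (\<phi> b - \<phi> a) / (b - a)"
    using b y by (simp add: pos_le_divide_eq)
  then have "- (2 * e) * (y - a) \<le> (\<phi> b - \<phi> a) / (b - a) * (y - a)"
    using y by (intro mult_right_mono) auto
  moreover have "2 * e * (y - a) = ln 3" using y by (simp add: e_def field_simps)
  ultimately have "\<phi> y + ln 3 \<le> chord \<phi> a b y" using y by (simp add: chord_def)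
  then show ?thesis using that y b by blast
qed

text \<open>The chord is pushed to the right until its largest gap above the graph equals \<open>ln 3\<close>.
  For a gap \<open>ln c\<close> the intercepts \<open>p k\<close> obtained below decrease at least by the factor \<open>c\<close> and
  the exponentials add up to at most \<open>c (c + 1) / (c - 1)\<close> times \<open>exp \<phi>\<close>; \<open>c = 3\<close> gives total
  mass at most \<open>3 / 4\<close> and the factor 6.\<close>

lemma chord_gap_exact:
  assumes a: "0 \<le> a"
  obtains b y where "a < y" "y < b" "chord \<phi> a b y = \<phi> y + ln 3"
    "\<And>x. a \<le> x \<Longrightarrow> x \<le> b \<Longrightarrow> chord \<phi> a b x \<le> \<phi> x + ln 3"
proof -
  \<comment> \<open>The gap of the chord over \<open>{a..a + z}\<close> at relative position t. With
    relative positions the domain is a fixed rectangle that includes chords of length 0, so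
    compactness applies.\<close>
  define D where "D z t = (1 - t) * \<phi> a + t * \<phi> (a + z) - \<phi> (a + t * z)" for z t
  have D_chord: "D (b - a) ((x - a) / (b - a)) = chord \<phi> a b x - \<phi> x" if "a < b" for b x
  proof -
    define t where "t = (x - a) / (b - a)"
    have "t * (b - a) = x - a" using that by (simp add: t_def)
    moreover have "(\<phi> b - \<phi> a) / (b - a) * (x - a) = t * (\<phi> b - \<phi> a)"
      by (simp add: t_def)
    ultimately show ?thesis unfolding t_def[symmetric] D_def chord_def
      by (simp add: algebra_simps)
  qed
  obtain b1 y1 where b1: "a < y1" "y1 < b1" "\<phi> y1 + ln 3 \<le> chord \<phi> a b1 y1"
    using chord_gap_unbounded[OF a] .
  define Q where "Q = {0..b1 - a} \<times> {0..1::real}"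
  have cont_Q: "continuous_on Q (\<lambda>(z, t). D z t)"
    unfolding D_def Q_def case_prod_beta
    by (intro continuous_intros continuous_on_compose2[OF cont]) (use a in auto)
  define C where "C = {p \<in> Q. (\<lambda>(z, t). D z t) p \<in> {ln 3..}}"
  have "closed C"
    unfolding C_def using continuous_closed_preimage[OF cont_Q _ closed_atLeast[of "ln 3"]]
    by (simp add: vimage_def Int_def Q_def closed_Times)
  then have "compact (Q \<inter> C)" unfolding Q_def by (intro compact_Int_closed compact_Times) auto
  moreover have "Q \<inter> C = C" by (auto simp: C_def)
  ultimately have "compact C" by simp
  moreover have "(b1 - a, (y1 - a) / (b1 - a)) \<in> C"
    using b1 D_chord[of b1 y1] by (auto simp: C_def Q_def)
  \<comment> \<open>The shortest chord whose gap reaches \<open>ln 3\<close> somewhere.\<close>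
  ultimately have "\<exists>p\<in>C. \<forall>q\<in>C. fst p \<le> fst q"
    by (intro continuous_attains_inf continuous_intros) auto
  then obtain p where p: "p \<in> C" "\<And>q. q \<in> C \<Longrightarrow> fst p \<le> fst q" by blast
  obtain z t where zt: "p = (z, t)" by force
  have z: "0 \<le> z" "z \<le> b1 - a" "0 \<le> t" "t \<le> 1" "ln 3 \<le> D z t"
    using p(1) by (auto simp: zt C_def Q_def)
  have ln3: "0 < ln (3::real)" by simp
  have le: "D z s \<le> ln 3" if s: "0 \<le> s" "s \<le> 1" for s
  proof (rule ccontr)
    \<comment> \<open>At a fixed relative position the gap is 0 for length 0, so a gap beyond
      \<open>ln 3\<close> would be preceded by the value \<open>ln 3\<close> at a strictly shorter
      chord.\<close>
    assume gt: "\<not> D z s \<le> ln 3"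
    have "D 0 s = 0" by (simp add: D_def algebra_simps)
    moreover have "continuous_on {0..z} (\<lambda>z. D z s)"
      unfolding D_def
      by (intro continuous_intros continuous_on_compose2[OF cont]) (use a s in auto)
    ultimately obtain z' where z': "0 \<le> z'" "z' \<le> z" "D z' s = ln 3"
      using IVT'[of "\<lambda>z. D z s" 0 "ln 3" z] gt z ln3 by auto
    then have "(z', s) \<in> C" using z s by (auto simp: C_def Q_def)
    then show False using p(2)[of "(z', s)"] z' gt by (cases "z' = z") (auto simp: zt)
  qed
  then have eq: "D z t = ln 3" using z by force
  have "z \<noteq> 0" using eq ln3 by (auto simp: D_def algebra_simps)
  then have z0: "0 < z" using z by simp
  have "t \<noteq> 0" "t \<noteq> 1" using eq ln3 by (auto simp: D_def)
  then have t: "0 < t" "t < 1" using z by auto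
  show ?thesis
  proof (rule that[of "a + t * z" "a + z"])
    show "a < a + t * z" "a + t * z < a + z" using t z0 by auto
    show "chord \<phi> a (a + z) (a + t * z) = \<phi> (a + t * z) + ln 3"
      using D_chord[of "a + z" "a + t * z"] eq z0 by simp
    show "chord \<phi> a (a + z) x \<le> \<phi> x + ln 3" if "a \<le> x" "x \<le> a + z" for x
      using D_chord[of "a + z" x] le[of "(x - a) / z"] that z0 by simp
  qed
qed


lemma antimono: "0 \<le> x \<Longrightarrow> x \<le> y \<Longrightarrow> \<phi> y \<le> \<phi> x"
  using decr[of x y] by (cases "x = y") auto

lemma chord_sequences:
  obtains x y :: "nat \<Rightarrow> real"
  where "x 0 = 0" "\<And>k. x k < y k" "\<And>k. y k < x (Suc k)" "\<And>k. 0 \<le> x k"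
    "\<And>k. chord \<phi> (x k) (x (Suc k)) (y k) = \<phi> (y k) + ln 3"
    "\<And>k z. x k \<le> z \<Longrightarrow> z \<le> x (Suc k) \<Longrightarrow> chord \<phi> (x k) (x (Suc k)) z \<le> \<phi> z + ln 3"
proof -
  define R where "R a y b \<longleftrightarrow> a < y \<and> y < b \<and> chord \<phi> a b y = \<phi> y + ln 3 \<and>
    (\<forall>z. a \<le> z \<and> z \<le> b \<longrightarrow> chord \<phi> a b z \<le> \<phi> z + ln 3)" for a y b
  have ex: "\<exists>b. 0 \<le> b \<and> (\<exists>y. R a y b)" if "0 \<le> a" for a
    using chord_gap_exact[OF that] unfolding R_def by (metis that le_less_trans less_imp_le)
  obtain x where x: "x 0 = 0" "\<And>k. 0 \<le> x k" "\<And>k. \<exists>y. R (x k) y (x (Suc k))"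
    using dependent_nat_choice[of "\<lambda>k a. 0 \<le> a \<and> (k = 0 \<longrightarrow> a = 0)" "\<lambda>k a b. \<exists>y. R a y b"] ex
    by auto
  obtain y where "\<And>k. R (x k) (y k) (x (Suc k))" using x(3) by metis
  with x show ?thesis by (intro that[of x y]) (auto simp: R_def)
qed

text \<open>Left of \<open>y k\<close> line k + 1 lies at least \<open>ln 3\<close> below line k,
  and right of \<open>y (k + 1)\<close> line k lies as far below line k + 1. For fixed z the
  exponentials of the lines therefore decay geometrically in both directions away from the interval
  that contains z.\<close>

lemma ex_dominating_exponentials:
  obtains p u :: "nat \<Rightarrow> real"
  where "\<And>k. 0 < p k" "p 0 = exp (\<phi> 0)" "\<And>k. p (Suc k) \<le> p k / 3"
    "\<And>k. 0 < u k" "\<And>k. u k < 1" "incseq u" "u \<longlonglongrightarrow> 1"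
    "\<And>n. \<exists>k. exp (\<phi> (real n)) \<le> p k * u k ^ n"
    "\<And>n. summable (\<lambda>k. p k * u k ^ n)"
    "\<And>n. (\<Sum>k. p k * u k ^ n) \<le> 6 * exp (\<phi> (real n))"
proof -
  obtain x y :: "nat \<Rightarrow> real" where x0: "x 0 = 0" and xy: "\<And>k. x k < y k" "\<And>k. y k < x (Suc k)"
    and x_ge: "\<And>k. 0 \<le> x k"
    and gap: "\<And>k. chord \<phi> (x k) (x (Suc k)) (y k) = \<phi> (y k) + ln 3"
    and gap_le: "\<And>k z. x k \<le> z \<Longrightarrow> z \<le> x (Suc k) \<Longrightarrow> chord \<phi> (x k) (x (Suc k)) z \<le> \<phi> z + ln 3"
    using chord_sequences by blast
  define l where "l k = chord \<phi> (x k) (x (Suc k))" for k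
  define s where "s k = (\<phi> (x (Suc k)) - \<phi> (x k)) / (x (Suc k) - x k)" for k
  have xx: "x k < x (Suc k)" for k using xy[of k] by simp
  have y_ge: "0 \<le> y k" for k using xy(1)[of k] x_ge[of k] by simp
  have ln3: "0 < ln (3::real)" by simp
  have l_eq: "l k b = l k a + s k * (b - a)" for k a b
    unfolding l_def s_def by (rule chord_add)
  have l_ends: "l k (x k) = \<phi> (x k)" "l k (x (Suc k)) = \<phi> (x (Suc k))" for k
    using xx[of k] by (auto simp: l_def)
  have l_out: "l k z \<le> \<phi> z" if "0 \<le> z" "z \<le> x k \<or> x (Suc k) \<le> z" for k z
    unfolding l_def using convex_ge_chord_outside[OF convex _ _ _ xx] that x_ge by auto
  have s_neg: "s k < 0" for k
    unfolding s_def using xx[of k] decr[OF x_ge xx] by (intro divide_neg_pos) auto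
  \<comment> \<open>The two lines meet at \<open>x (Suc k)\<close>, and to the left of it, at
    \<open>y k\<close>, the later line is the lower one.\<close>
  have s_mono: "s k \<le> s (Suc k)" for k
  proof -
    have "l (Suc k) (y k) \<le> \<phi> (y k)" "l k (y k) = \<phi> (y k) + ln 3"
      using l_out[OF y_ge, of k "Suc k"] xy[of k] gap[of k] by (auto simp: l_def)
    then have "l (Suc k) (y k) \<le> l k (y k)" using ln3 by linarith
    then have "s (Suc k) * (y k - x (Suc k)) \<le> s k * (y k - x (Suc k))"
      using l_eq[of "Suc k" "y k" "x (Suc k)"] l_eq[of k "y k" "x (Suc k)"] l_ends by simp
    then show ?thesis using xy(2)[of k] by (simp add: mult_le_cancel_right)
  qed
  have before: "l (Suc k) z \<le> l k z - ln 3" if "z \<le> y k" for k z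
  proof -
    have "l (Suc k) (y k) \<le> l k (y k) - ln 3"
      using l_out[OF y_ge, of k "Suc k"] xy[of k] gap[of k] by (simp add: l_def)
    moreover have "(s (Suc k) - s k) * (z - y k) \<le> 0"
      using that s_mono[of k] by (intro mult_nonneg_nonpos) auto
    ultimately show ?thesis
      using l_eq[of k z "y k"] l_eq[of "Suc k" z "y k"] by (simp add: algebra_simps)
  qed
  have after: "l k z \<le> l (Suc k) z - ln 3" if "y (Suc k) \<le> z" for k z
  proof -
    have "l k (y (Suc k)) \<le> l (Suc k) (y (Suc k)) - ln 3"
      using l_out[OF y_ge, of "Suc k" k] xy(1)[of "Suc k"] gap[of "Suc k"] by (simp add: l_def)
    moreover have "0 \<le> (s (Suc k) - s k) * (z - y (Suc k))"
      using that s_mono[of k] by (intro mult_nonneg_nonneg) auto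
    ultimately show ?thesis
      using l_eq[of k z "y (Suc k)"] l_eq[of "Suc k" z "y (Suc k)"] by (simp add: algebra_simps)
  qed
  \<comment> \<open>The chords descend, so \<phi> loses at least the gap \<open>ln 3\<close> on
    every interval. Hence the nodes cannot accumulate.\<close>
  have drop: "\<phi> (x k) \<le> \<phi> 0 - real k * ln 3" for k
  proof (induction k)
    case (Suc k)
    have "\<phi> (x (Suc k)) \<le> \<phi> (y k)" using antimono[OF y_ge, of k] xy(2)[of k] by simp
    moreover have "\<phi> (y k) + ln 3 \<le> \<phi> (x k)"
    proof -
      have "s k * (y k - x k) \<le> 0" using s_neg[of k] xy(1)[of k] by (intro mult_nonpos_nonneg) auto
      then show ?thesis
        using gap[of k] l_eq[of k "y k" "x k"] l_ends(1)[of k] by (simp add: l_def)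
    qed
    ultimately show ?case using Suc by (simp add: algebra_simps)
  qed (simp add: x0)
  have x_unbounded: "\<exists>k. z < x k" if "0 \<le> z" for z
  proof -
    obtain k where "(\<phi> 0 - \<phi> z) / ln 3 < real k" using reals_Archimedean2 by blast
    then have "\<phi> (x k) < \<phi> z" using drop[of k] ln3 by (simp add: pos_divide_less_eq)
    then have "z < x k" using antimono[OF x_ge, of k z] by fastforce
    then show ?thesis by blast
  qed
  \<comment> \<open>If all slopes stayed below \<open>- e\<close>, the values at the nodes would lie
    below \<open>- e * x k\<close>, against the slow decay.\<close>
  have s_near_0: "\<exists>k. - e < s k" if e: "0 < e" for e
  proof (rule ccontr)
    assume "\<not> ?thesis"
    then have s_le: "s k \<le> - e" for k by (simp add: not_less)
    have le: "\<phi> (x k) \<le> \<phi> 0 - e * x k" for k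
    proof (induction k)
      case (Suc k)
      have "\<phi> (x (Suc k)) = \<phi> (x k) + s k * (x (Suc k) - x k)"
        using l_eq[of k "x (Suc k)" "x k"] l_ends by simp
      also have "s k * (x (Suc k) - x k) \<le> - e * (x (Suc k) - x k)"
        using s_le[of k] xx[of k] by (intro mult_right_mono) auto
      finally show ?case using Suc by (simp add: algebra_simps)
    qed (simp add: x0)
    obtain c where c: "\<And>z. c \<le> z \<Longrightarrow> - e * z \<le> \<phi> z"
      using slow[OF e] by (auto simp: eventually_at_top_linorder)
    obtain k where "max 0 c < x k" using x_unbounded[of "max 0 c"] by auto
    then show False using c[of "x k"] le[of k] neg by simp
  qed
  have s_inc: "s j \<le> s k" if "j \<le> k" for j k
    using lift_Suc_mono_le[of s, OF s_mono that] .
  have s_lim: "s \<longlonglongrightarrow> 0"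
  proof (rule order_tendstoI)
    fix a :: real assume "a < 0"
    then obtain k where "a < s k" using s_near_0[of "- a"] by auto
    then show "eventually (\<lambda>k. a < s k) sequentially"
      using s_inc order.strict_trans2 unfolding eventually_sequentially by blast
  next
    fix a :: real assume "0 < a"
    then show "eventually (\<lambda>k. s k < a) sequentially"
      using s_neg order.strict_trans by (intro always_eventually) blast
  qed
  have exp_minus_ln3: "exp a \<le> exp b / 3" if "a \<le> b - ln 3" for a b :: real
  proof -
    have "exp a \<le> exp (b - ln 3)" using that by simp
    then show ?thesis by (simp add: exp_diff)
  qed
  define p u where "p k = exp (l k 0)" and "u k = exp (s k)" for k
  have pu: "p k * u k ^ n = exp (l k (real n))" for k n
    using l_eq[of k "real n" 0]
    by (simp add: p_def u_def exp_add exp_of_nat_mult[symmetric] mult.commute)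
  have locate: "\<exists>m. x m \<le> z \<and> z \<le> x (Suc m)" if "0 \<le> z" for z
  proof -
    define m where "m = (LEAST k. z < x (Suc k))"
    obtain k where "z < x k" using x_unbounded[OF \<open>0 \<le> z\<close>] by blast
    then have "z < x (Suc k)" using xx[of k] by simp
    then have "z < x (Suc m)" unfolding m_def by (rule LeastI)
    moreover have "x m \<le> z"
    proof (cases m)
      case (Suc j)
      then show ?thesis using not_less_Least[of j "\<lambda>k. z < x (Suc k)"] by (simp add: m_def)
    qed (use that x0 in simp)
    ultimately show ?thesis using less_imp_le by blast
  qed
  have y_inc: "y j \<le> y k" if "j \<le> k" for j k
  proof (rule lift_Suc_mono_le[of y, OF _ that])
    show "y i \<le> y (Suc i)" for i using xy(2)[of i] xy(1)[of "Suc i"] by simp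
  qed
  have total: "summable (\<lambda>k. exp (l k z)) \<and> (\<Sum>k. exp (l k z)) \<le> 6 * exp (\<phi> z)"
    if z: "0 \<le> z" for z
  proof -
    obtain m where m: "x m \<le> z" "z \<le> x (Suc m)" using locate[OF z] by blast
    define g where "g k = exp (l k z)" for k
    have g0: "0 \<le> g k" for k by (simp add: g_def)
    have below: "sum g {..m'} \<le> 3 / 2 * g m'" if "m' = 0 \<or> y m' \<le> z" for m'
    proof (rule sum_le_geometric_descending[OF g0])
      fix k assume "k < m'"
      then have "y (Suc k) \<le> z" using y_inc[of "Suc k" m'] that by simp
      then show "g k \<le> g (Suc k) / 3" unfolding g_def by (intro exp_minus_ln3 after)
    qed
    have above: "summable (\<lambda>k. g (k + m')) \<and> (\<Sum>k. g (k + m')) \<le> 3 / 2 * g m'"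
      if "z \<le> y m'" for m'
    proof -
      have "g (Suc k + m') \<le> g (k + m') / 3" for k
      proof -
        have "z \<le> y (k + m')" using y_inc[of m' "k + m'"] that by simp
        then show ?thesis unfolding g_def add_Suc by (intro exp_minus_ln3 before)
      qed
      then show ?thesis using sums_le_geometric[of "\<lambda>k. g (k + m')"] g0 by auto
    qed
    have split: "summable g \<and> suminf g \<le> sum g {..<m'} + 3 / 2 * g m'" if "z \<le> y m'" for m'
      using above[OF that] suminf_split_initial_segment[of g m'] by auto
    have gm: "g m \<le> 3 * exp (\<phi> z)"
    proof -
      have "exp (l m z - ln 3) \<le> exp (\<phi> z)" using gap_le[OF m] by (simp add: l_def)
      then show ?thesis by (simp add: exp_diff g_def)
    qed
    \<comment> \<open>The position of z relative to \<open>y m\<close> decides on which side of the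
      split line m is counted. That side sums to at most 3 / 2 times 3, since the gap of line m is
      at most \<open>ln 3\<close>; the other side starts with a line below the graph and sums to at
      most 3 / 2. Together this is 6.\<close>
    show ?thesis
    proof (cases "z \<le> y m")
      case True
      have "sum g {..<m} \<le> 3 / 2 * exp (\<phi> z)"
      proof (cases m)
        case (Suc j)
        have "y j \<le> z" using xy(2)[of j] m Suc by simp
        then have "sum g {..j} \<le> 3 / 2 * g j" using below by blast
        moreover have "g j \<le> exp (\<phi> z)"
          using l_out[OF z, of j] m Suc by (simp add: g_def)
        ultimately show ?thesis using Suc by (simp add: lessThan_Suc_atMost)
      qed simp
      then have "summable g \<and> suminf g \<le> 6 * exp (\<phi> z)" using split[OF True] gm by simp
      then show ?thesis by (simp add: g_def[abs_def])
    next
      case False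
      have "sum g {..m} \<le> 3 / 2 * g m" using below False by simp
      moreover have "g (Suc m) \<le> exp (\<phi> z)"
        using l_out[OF z, of "Suc m"] m by (simp add: g_def)
      moreover have "z \<le> y (Suc m)" using xy(1)[of "Suc m"] m by simp
      ultimately have "summable g \<and> suminf g \<le> 6 * exp (\<phi> z)"
        using split[of "Suc m"] gm by (simp add: lessThan_Suc_atMost)
      then show ?thesis by (simp add: g_def[abs_def])
    qed
  qed
  show ?thesis
  proof (rule that[of p u])
    show "p 0 = exp (\<phi> 0)" using l_ends(1)[of 0] by (simp add: p_def x0)
    show "p (Suc k) \<le> p k / 3" for k
      unfolding p_def by (intro exp_minus_ln3 before y_ge)
    show "incseq u" by (rule incseq_SucI) (simp add: u_def s_mono)
    show "u \<longlonglongrightarrow> 1" using tendsto_exp[OF s_lim] by (simp add: u_def[abs_def])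
    show "\<exists>k. exp (\<phi> (real n)) \<le> p k * u k ^ n" for n
    proof -
      obtain m where "x m \<le> real n" "real n \<le> x (Suc m)" using locate[of "real n"] by auto
      then have "\<phi> (real n) \<le> l m (real n)"
        unfolding l_def by (intro convex_le_chord_inside[OF convex _ _ xx]) (auto simp: x_ge)
      then show ?thesis unfolding pu by auto
    qed
  qed (use s_neg total in \<open>auto simp: pu\<close>, simp_all add: p_def u_def s_neg)
qed

end

section \<open>Two-sided Markov chains with a reversible kernel\<close>

lemma sums_integral_pmf_nat:
  fixes c :: "nat \<Rightarrow> real"
  assumes "\<And>t. \<bar>c t\<bar> \<le> C"
  shows "(\<lambda>t. pmf Q t * c t) sums (\<integral>t. c t \<partial>measure_pmf Q)"
proof -
  have "integrable (measure_pmf Q) c"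
    using assms by (intro measure_pmf.integrable_const_bound[where B = C]) auto
  then have "integrable (count_space UNIV) (\<lambda>t. pmf Q t * c t)"
    unfolding measure_pmf_eq_density by (subst (asm) integrable_density) auto
  from sums_integral_count_space_nat[OF this] show ?thesis
    unfolding measure_pmf_eq_density by (subst integral_density) auto
qed

lemma sums_pmf_nat: "pmf Q sums (1 :: real)" for Q :: "nat pmf"
  using sums_integral_pmf_nat[of "\<lambda>_. 1" 1 Q] by simp

lemma (in finite_measure) sums_measure_Int_nat:
  fixes S :: "'a \<Rightarrow> nat"
  assumes S: "S \<in> measurable M (count_space UNIV)" and A: "A \<in> sets M"
  shows "(\<lambda>t. measure M (A \<inter> {\<omega> \<in> space M. S \<omega> = t})) sums measure M A"
proof -
  have "A = (\<Union>t. A \<inter> {\<omega> \<in> space M. S \<omega> = t})"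
    using sets.sets_into_space[OF A] by auto
  moreover have "(\<lambda>t. measure M (A \<inter> {\<omega> \<in> space M. S \<omega> = t})) sums
      measure M (\<Union>t. A \<inter> {\<omega> \<in> space M. S \<omega> = t})"
  proof (rule finite_measure_UNION)
    show "range (\<lambda>t. A \<inter> {\<omega> \<in> space M. S \<omega> = t}) \<subseteq> sets M"
      using S A measurable_sets[OF S, of "{t}" for t]
      by (auto intro!: sets.Int simp: vimage_def Int_def conj_commute)
  qed (auto simp: disjoint_family_on_def)
  ultimately show ?thesis by simp
qed

section \<open>Path probabilities and growing windows\<close>

locale reversible_kernel =
  fixes \<pi> :: "nat pmf" and K :: "nat \<Rightarrow> nat pmf"
  assumes rev: "pmf \<pi> s * pmf (K s) t = pmf \<pi> t * pmf (K t) s"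
begin

definition path_prob :: "int \<Rightarrow> int \<Rightarrow> (int \<Rightarrow> nat) \<Rightarrow> real" where
  "path_prob a b \<sigma> = pmf \<pi> (\<sigma> a) * (\<Prod>i\<in>{a..<b}. pmf (K (\<sigma> i)) (\<sigma> (i + 1)))"

lemma path_prob_same [simp]: "path_prob a a \<sigma> = pmf \<pi> (\<sigma> a)"
  by (simp add: path_prob_def)

lemma path_prob_nonneg: "0 \<le> path_prob a b \<sigma>"
  by (simp add: path_prob_def prod_nonneg)

lemma path_prob_cong:
  assumes "a \<le> b" "\<And>i. a \<le> i \<Longrightarrow> i \<le> b \<Longrightarrow> \<sigma> i = \<tau> i"
  shows "path_prob a b \<sigma> = path_prob a b \<tau>"
  using assms by (auto simp: path_prob_def intro!: arg_cong2[where f = "(*)"] prod.cong)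

lemma path_prob_Suc_right:
  assumes "a \<le> b"
  shows "path_prob a (b + 1) \<sigma> = path_prob a b \<sigma> * pmf (K (\<sigma> b)) (\<sigma> (b + 1))"
proof -
  have "{a..<b + 1} = insert b {a..<b}" using assms by auto
  then show ?thesis by (simp add: path_prob_def)
qed

text \<open>Detailed balance moves the initial law along the path, so a path grows to the left by
  the same kernel as to the right.\<close>

lemma path_prob_Suc_left:
  assumes "a \<le> b"
  shows "path_prob (a - 1) b \<sigma> = path_prob a b \<sigma> * pmf (K (\<sigma> a)) (\<sigma> (a - 1))"
proof -
  have "{a - 1..<b} = insert (a - 1) {a..<b}" using assms by auto
  then show ?thesis using rev[of "\<sigma> (a - 1)" "\<sigma> a"] by (simp add: path_prob_def)
qed

text \<open>Conditional independence given the state at m, in product form so that it also holds at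
  states of probability zero.\<close>

lemma path_prob_split:
  assumes "a \<le> m" "m \<le> b"
  shows "path_prob a b \<sigma> * pmf \<pi> (\<sigma> m) = path_prob a m \<sigma> * path_prob m b \<sigma>"
proof -
  have "{a..<b} = {a..<m} \<union> {m..<b}" using assms by auto
  then have "(\<Prod>i\<in>{a..<b}. pmf (K (\<sigma> i)) (\<sigma> (i + 1))) =
      (\<Prod>i\<in>{a..<m}. pmf (K (\<sigma> i)) (\<sigma> (i + 1))) * (\<Prod>i\<in>{m..<b}. pmf (K (\<sigma> i)) (\<sigma> (i + 1)))"
    by (simp add: prod.union_disjoint ivl_disj_int)
  then show ?thesis by (simp add: path_prob_def)
qed

lemma path_prob_shift: "path_prob (a + h) (b + h) \<sigma> = path_prob a b (\<lambda>i. \<sigma> (i + h))"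
proof -
  have "(\<Prod>i\<in>{a + h..<b + h}. pmf (K (\<sigma> i)) (\<sigma> (i + 1))) =
      (\<Prod>i\<in>{a..<b}. pmf (K (\<sigma> (i + h))) (\<sigma> (i + 1 + h)))"
    by (rule prod.reindex_bij_witness[of _ "\<lambda>i. i + h" "\<lambda>i. i - h"]) (auto simp: algebra_simps)
  then show ?thesis by (simp add: path_prob_def)
qed

lemma path_prob_reflect:
  assumes "a \<le> b"
  shows "path_prob (- b) (- a) \<sigma> = path_prob a b (\<lambda>i. \<sigma> (- i))"
  using assms
proof (induction b rule: int_ge_induct)
  case (step b)
  then show ?case
    using path_prob_Suc_left[of "- b" "- a" \<sigma>] path_prob_Suc_right[of a b "\<lambda>i. \<sigma> (- i)"]
    by (simp add: minus_diff_commute)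
qed simp

text \<open>The path on the window \<open>{- N..N}\<close>, grown from time 0 in both directions and continued
  constantly outside.\<close>

primrec window_pmf :: "nat \<Rightarrow> (int \<Rightarrow> nat) pmf" where
  "window_pmf 0 = map_pmf (\<lambda>s _. s) \<pi>"
| "window_pmf (Suc N) = bind_pmf (window_pmf N) (\<lambda>\<omega>.
    map_pmf (\<lambda>(t, s) i. if int N < i then t else if i < - int N then s else \<omega> i)
      (pair_pmf (K (\<omega> (int N))) (K (\<omega> (- int N)))))"

text \<open>Each growth step changes only coordinates outside the window already drawn.\<close>

lemma window_pmf_restrict:
  assumes "J \<subseteq> {- int N..int N}" "N \<le> N'"
  shows "map_pmf (\<lambda>\<omega>. restrict (h \<circ> \<omega>) J) (window_pmf N') = map_pmf (\<lambda>\<omega>. restrict (h \<circ> \<omega>) J) (window_pmf N)"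
  using assms(2)
proof (induction N' rule: dec_induct)
  case (step n)
  have "restrict (h \<circ> (\<lambda>i. if int n < i then t else if i < - int n then s else \<omega> i)) J = restrict (h \<circ> \<omega>) J"
    for t s \<omega>
    using assms(1) step(1) by (auto simp: restrict_def fun_eq_iff)
  then have "map_pmf (\<lambda>\<omega>. restrict (h \<circ> \<omega>) J) (window_pmf (Suc n)) =
      bind_pmf (window_pmf n) (\<lambda>\<omega>. return_pmf (restrict (h \<circ> \<omega>) J))"
    by (simp add: map_bind_pmf map_pmf_comp case_prod_beta del: restrict_apply)
  also have "\<dots> = map_pmf (\<lambda>\<omega>. restrict (h \<circ> \<omega>) J) (window_pmf n)"
    by (simp add: map_pmf_def)
  finally show ?case using step.IH by (simp only:)
qed simp

text \<open>The window starts in the middle while \<open>path_prob\<close> starts at the left end;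
  reversibility reconciles them, since the two factors of a growth step are those of
  \<open>path_prob_Suc_right\<close> and \<open>path_prob_Suc_left\<close>.\<close>

lemma emeasure_window_pmf:
  "emeasure (window_pmf N) {\<omega>. \<forall>i\<in>{- int N..int N}. \<omega> i = \<sigma> i} = path_prob (- int N) (int N) \<sigma>"
proof (induction N)
  case 0
  have "{s. \<forall>i\<in>{0..0::int}. s = \<sigma> i} = {\<sigma> 0}" by auto
  then show ?case by (simp add: emeasure_pmf_single vimage_def)
next
  case (Suc N)
  let ?C = "\<lambda>N. {\<omega>. \<forall>i\<in>{- int N..int N}. \<omega> i = \<sigma> i}"
  define c where "c = pmf (K (\<sigma> (int N))) (\<sigma> (int N + 1)) * pmf (K (\<sigma> (- int N))) (\<sigma> (- int N - 1))"
  have iv: "{- int (Suc N)..int (Suc N)} = insert (- int N - 1) (insert (int N + 1) {- int N..int N})"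
    by auto
  have "emeasure (map_pmf (\<lambda>(t, s) i. if int N < i then t else if i < - int N then s else \<omega> i)
      (pair_pmf (K (\<omega> (int N))) (K (\<omega> (- int N))))) (?C (Suc N)) = ennreal c * indicator (?C N) \<omega>"
    for \<omega>
  proof -
    have "(\<lambda>(t, s) i. if int N < i then t else if i < - int N then s else \<omega> i) -` ?C (Suc N) =
        (if \<omega> \<in> ?C N then {(\<sigma> (int N + 1), \<sigma> (- int N - 1))} else {})"
      unfolding iv by (auto simp: not_less)
    then show ?thesis
      by (auto simp: emeasure_pmf_single pmf_pair c_def)
  qed
  then have "emeasure (window_pmf (Suc N)) (?C (Suc N)) =
      ennreal c * emeasure (window_pmf N) (?C N)"
    by (simp add: emeasure_bind_pmf nn_integral_cmult)
  also have "\<dots> = ennreal (c * path_prob (- int N) (int N) \<sigma>)"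
    by (simp add: Suc.IH c_def ennreal_mult path_prob_nonneg)
  also have "c * path_prob (- int N) (int N) \<sigma> = path_prob (- int (Suc N)) (int (Suc N)) \<sigma>"
    using path_prob_Suc_right[of "- int N - 1" "int N" \<sigma>] path_prob_Suc_left[of "- int N" "int N" \<sigma>]
    by (simp add: c_def minus_diff_commute ac_simps)
  finally show ?case .
qed

section \<open>The chain as a projective limit\<close>

definition radius :: "int set \<Rightarrow> nat" where
  "radius J = nat (Max (insert 0 (abs ` J)))"

lemma radius_window: "finite J \<Longrightarrow> J \<subseteq> {- int (radius J)..int (radius J)}"
proof
  fix i assume "finite J" "i \<in> J"
  then have "\<bar>i\<bar> \<le> Max (insert 0 (abs ` J))" by (intro Max_ge) auto
  then show "i \<in> {- int (radius J)..int (radius J)}" by (auto simp: radius_def)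
qed

text \<open>The states are embedded into the reals because the limit is to live on
  \<open>int \<Rightarrow> real\<close>. The radius fixes one admissible window;
  \<open>fdd_eq\<close> allows any other window that contains J.\<close>

definition fdd :: "int set \<Rightarrow> (int \<Rightarrow> real) measure" where
  "fdd J = distr (window_pmf (radius J)) (\<Pi>\<^sub>M i\<in>J. borel) (\<lambda>\<omega>. restrict (real \<circ> \<omega>) J)"

lemma fdd_eq:
  assumes "finite J" "J \<subseteq> {- int N..int N}"
  shows "fdd J = distr (window_pmf N) (\<Pi>\<^sub>M i\<in>J. borel) (\<lambda>\<omega>. restrict (real \<circ> \<omega>) J)"
proof -
  have distr_map: "distr (window_pmf N) (\<Pi>\<^sub>M i\<in>J. borel) (\<lambda>\<omega>. restrict (real \<circ> \<omega>) J) =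
      distr (map_pmf (\<lambda>\<omega>. restrict (real \<circ> \<omega>) J) (window_pmf N)) (\<Pi>\<^sub>M i\<in>J. borel) (\<lambda>x. restrict x J)" for N
    unfolding map_pmf_rep_eq by (subst distr_distr) (auto simp: space_PiM comp_def)
  have "map_pmf (\<lambda>\<omega>. restrict (real \<circ> \<omega>) J) (window_pmf N) =
      map_pmf (\<lambda>\<omega>. restrict (real \<circ> \<omega>) J) (window_pmf (radius J))"
    using window_pmf_restrict[OF assms(2), of "max N (radius J)" real]
      window_pmf_restrict[OF radius_window[OF assms(1)], of "max N (radius J)" real] by simp
  then show ?thesis unfolding fdd_def distr_map by simp
qed

lemma fdd_restrict:
  assumes JH: "J \<subseteq> H" "finite H"
  shows "fdd J = distr (fdd H) (\<Pi>\<^sub>M i\<in>J. borel) (\<lambda>f. restrict f J)"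
proof -
  have "distr (fdd H) (\<Pi>\<^sub>M i\<in>J. borel) (\<lambda>f. restrict f J) =
      distr (window_pmf (radius H)) (\<Pi>\<^sub>M i\<in>J. borel) (\<lambda>\<omega>. restrict (restrict (real \<circ> \<omega>) H) J)"
    unfolding fdd_def
    by (subst distr_distr) (auto simp: space_PiM comp_def intro!: measurable_restrict_subset JH)
  also have "(\<lambda>\<omega>. restrict (restrict (real \<circ> \<omega>) H) J) = (\<lambda>\<omega>::int \<Rightarrow> nat. restrict (real \<circ> \<omega>) J)"
    using JH by (auto simp: restrict_def fun_eq_iff)
  also have "distr (window_pmf (radius H)) (\<Pi>\<^sub>M i\<in>J. borel) \<dots> = fdd J"
    using JH radius_window[of H] finite_subset[of J H] by (subst fdd_eq[of J "radius H"]) auto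
  finally show ?thesis ..
qed

lemma prob_space_fdd: "prob_space (fdd J)"
  unfolding fdd_def by (rule measure_pmf.prob_space_distr) (auto simp: space_PiM)

end

text \<open>Symmetric windows determine all finite paths, see \<open>prob_path_event\<close>. From
  here on the chain is used only through its path law, whatever the underlying space.\<close>

locale path_process = reversible_kernel \<pi> K + prob_space M
  for \<pi> :: "nat pmf" and K :: "nat \<Rightarrow> nat pmf" and M :: "'a measure" +
  fixes S :: "int \<Rightarrow> 'a \<Rightarrow> nat"
  assumes S [measurable]: "S k \<in> measurable M (count_space UNIV)"
    and window: "prob {\<omega> \<in> space M. \<forall>i\<in>{- int N..int N}. S i \<omega> = \<sigma> i} = path_prob (- int N) (int N) \<sigma>"

text \<open>Daniell-Kolmogorov extension. Taking floors makes every coordinate a natural number at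
  every point of the path space, also off the support of the law, so the state space is countable
  everywhere and not just almost surely.\<close>

lemma (in reversible_kernel) ex_path_process:
  "\<exists>M :: (int \<Rightarrow> real) measure. path_process \<pi> K M (\<lambda>k \<omega>. nat \<lfloor>\<omega> k\<rfloor>)"
proof -
  interpret polish_projective UNIV fdd
    by (intro polish_projective.intro projective_family.intro fdd_restrict prob_space_fdd)
  have [measurable_cong]: "sets lim = sets (\<Pi>\<^sub>M k\<in>UNIV. borel)" by (rule sets_lim)
  have "path_process \<pi> K lim (\<lambda>k \<omega>. nat \<lfloor>\<omega> k\<rfloor>)"
  proof
    show "(\<lambda>\<omega>. nat \<lfloor>\<omega> k\<rfloor>) \<in> measurable lim (count_space UNIV)" for k
      by measurable
    fix N \<sigma>
    let ?J = "{- int N..int N}"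
  define X where "X = {\<omega> \<in> space (\<Pi>\<^sub>M i\<in>?J. borel :: real measure). \<forall>i\<in>?J. nat \<lfloor>\<omega> i\<rfloor> = \<sigma> i}"
  have X: "X \<in> sets (\<Pi>\<^sub>M i\<in>?J. borel)" unfolding X_def by measurable
  have "{\<omega> \<in> space lim. \<forall>i\<in>?J. nat \<lfloor>\<omega> i\<rfloor> = \<sigma> i} = prod_emb UNIV (\<lambda>_. borel) ?J X"
    by (auto simp: X_def prod_emb_def space_PiM)
  then have "emeasure lim {\<omega> \<in> space lim. \<forall>i\<in>?J. nat \<lfloor>\<omega> i\<rfloor> = \<sigma> i} = emeasure (fdd ?J) X"
    using emeasure_lim_emb[of ?J X] X by simp
  also have "\<dots> = emeasure (window_pmf N) {\<omega>. \<forall>i\<in>?J. \<omega> i = \<sigma> i}"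
    using X by (subst fdd_eq[of ?J N], simp, simp, subst emeasure_distr)
      (auto simp: space_PiM X_def intro!: arg_cong[where f = "emeasure _"])
  also have "\<dots> = path_prob (- int N) (int N) \<sigma>" by (rule emeasure_window_pmf)
  finally show "measure lim {\<omega> \<in> space lim. \<forall>i\<in>?J. nat \<lfloor>\<omega> i\<rfloor> = \<sigma> i} = path_prob (- int N) (int N) \<sigma>"
      by (simp add: measure_def path_prob_nonneg)
  qed
  then show ?thesis by blast
qed

section \<open>Probabilities of finite paths\<close>

context path_process
begin

definition path_event :: "int \<Rightarrow> int \<Rightarrow> (int \<Rightarrow> nat) \<Rightarrow> 'a set" where
  "path_event a b \<sigma> = {\<omega> \<in> space M. \<forall>i\<in>{a..b}. S i \<omega> = \<sigma> i}"

definition visit :: "int \<Rightarrow> nat \<Rightarrow> 'a set" where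
  "visit k s = {\<omega> \<in> space M. S k \<omega> = s}"

lemma sets_visit [measurable]: "visit k s \<in> sets M"
  unfolding visit_def by measurable

lemma sets_path_event [measurable]: "path_event a b \<sigma> \<in> sets M"
  unfolding path_event_def by measurable

lemma sums_prob_visit: "A \<in> sets M \<Longrightarrow> (\<lambda>t. prob (A \<inter> visit k t)) sums prob A"
  unfolding visit_def by (rule sums_measure_Int_nat[OF S])

lemma path_event_extend:
  assumes "j = b + 1 \<or> j = a - 1" "a \<le> b"
  shows "path_event a b \<sigma> \<inter> visit j t = path_event (min a j) (max b j) (\<sigma>(j := t))"
  using assms by (auto simp: path_event_def visit_def)

text \<open>Summing over the state at one end of an interval removes that end, since the kernel has
  total mass 1. From a window around \<open>{a..b}\<close> the surplus is removed on the right and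
  afterwards on the left, the latter by reversibility.\<close>

lemma prob_path_event:
  assumes "a \<le> b"
  shows "prob (path_event a b \<sigma>) = path_prob a b \<sigma>"
proof -
  define N where "N = nat (max \<bar>a\<bar> \<bar>b\<bar>)"
  have N: "- int N \<le> a" "b \<le> int N" by (auto simp: N_def)
  have right: "\<forall>\<sigma>. prob (path_event a b \<sigma>) = path_prob a b \<sigma>"
    if "\<forall>\<sigma>. prob (path_event a (b + 1) \<sigma>) = path_prob a (b + 1) \<sigma>" "a \<le> b" for a b
  proof
    fix \<sigma>
    have "(\<lambda>t. path_prob a b \<sigma> * pmf (K (\<sigma> b)) t) sums (path_prob a b \<sigma> * 1)"
      by (intro sums_mult sums_pmf_nat)
    moreover have "prob (path_event a b \<sigma> \<inter> visit (b + 1) t) = path_prob a b \<sigma> * pmf (K (\<sigma> b)) t" for t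
      using that path_prob_Suc_right[of a b "\<sigma>(b + 1 := t)"] path_prob_cong[of a b "\<sigma>(b + 1 := t)" \<sigma>]
      by (simp add: path_event_extend)
    ultimately show "prob (path_event a b \<sigma>) = path_prob a b \<sigma>"
      using sums_prob_visit[OF sets_path_event, of a b \<sigma> "b + 1"] by (simp add: sums_iff)
  qed
  have left: "\<forall>\<sigma>. prob (path_event a b \<sigma>) = path_prob a b \<sigma>"
    if "\<forall>\<sigma>. prob (path_event (a - 1) b \<sigma>) = path_prob (a - 1) b \<sigma>" "a \<le> b" for a b
  proof
    fix \<sigma>
    have "(\<lambda>t. path_prob a b \<sigma> * pmf (K (\<sigma> a)) t) sums (path_prob a b \<sigma> * 1)"
      by (intro sums_mult sums_pmf_nat)
    moreover have "prob (path_event a b \<sigma> \<inter> visit (a - 1) t) = path_prob a b \<sigma> * pmf (K (\<sigma> a)) t" for t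
      using that path_prob_Suc_left[of a b "\<sigma>(a - 1 := t)"] path_prob_cong[of a b "\<sigma>(a - 1 := t)" \<sigma>]
      by (simp add: path_event_extend)
    ultimately show "prob (path_event a b \<sigma>) = path_prob a b \<sigma>"
      using sums_prob_visit[OF sets_path_event, of a b \<sigma> "a - 1"] by (simp add: sums_iff)
  qed
  have "- int N \<le> b \<longrightarrow> (\<forall>\<sigma>. prob (path_event (- int N) b \<sigma>) = path_prob (- int N) b \<sigma>)"
    using N(2)
  proof (induction b rule: int_le_induct)
    case base
    show ?case using window by (simp add: path_event_def)
  next
    case (step i)
    then show ?case using right[of "- int N" "i - 1"] by simp
  qed
  then have base: "\<forall>\<sigma>. prob (path_event (- int N) b \<sigma>) = path_prob (- int N) b \<sigma>"
    using N assms by simp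
  have "a \<le> b \<longrightarrow> (\<forall>\<sigma>. prob (path_event a b \<sigma>) = path_prob a b \<sigma>)"
    using N(1)
  proof (induction a rule: int_ge_induct)
    case (step i)
    then show ?case using left[of "i + 1" b] by simp
  qed (use base in auto)
  then show ?thesis using assms by blast
qed

end

text \<open>A Dynkin class argument. The factors c and d make room for conditional independence
  without dividing by a probability that may vanish.\<close>

lemma (in finite_measure) measure_Int_eq_on_sigma_sets:
  assumes G: "Int_stable G" "G \<subseteq> sets M" and C: "C \<in> sets M" and D: "D \<in> sets M"
    and base: "\<And>A. A \<in> G \<Longrightarrow> measure M (A \<inter> C) * c = measure M (A \<inter> D) * d"
    and all: "measure M C * c = measure M D * d"
    and A: "A \<in> sigma_sets (space M) G"
  shows "measure M (A \<inter> C) * c = measure M (A \<inter> D) * d"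
proof (rule sigma_sets_induct_disjoint[OF G(1) _ A])
  show "G \<subseteq> Pow (space M)" using G(2) sets.sets_into_space by blast
next
  fix A assume "A \<in> G" then show "measure M (A \<inter> C) * c = measure M (A \<inter> D) * d" by (rule base)
next
  show "measure M ({} \<inter> C) * c = measure M ({} \<inter> D) * d" by simp
next
  fix A assume A: "A \<in> sigma_sets (space M) G" and eq: "measure M (A \<inter> C) * c = measure M (A \<inter> D) * d"
  have sets_A: "A \<in> sets M" using A G(2) sets.sigma_sets_subset by blast
  have "measure M ((space M - A) \<inter> E) = measure M E - measure M (A \<inter> E)" if "E \<in> sets M" for E
  proof -
    have "(space M - A) \<inter> E = E - A \<inter> E" using sets.sets_into_space[OF that] by auto
    then show ?thesis using that sets_A by (simp add: finite_measure_Diff)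
  qed
  then show "measure M ((space M - A) \<inter> C) * c = measure M ((space M - A) \<inter> D) * d"
    using C D eq all by (simp add: left_diff_distrib)
next
  fix A :: "nat \<Rightarrow> 'a set"
  assume disj: "disjoint_family A" and A: "range A \<subseteq> sigma_sets (space M) G"
    and eq: "\<And>i. measure M (A i \<inter> C) * c = measure M (A i \<inter> D) * d"
  have sets_A: "A i \<in> sets M" for i using A G(2) sets.sigma_sets_subset by blast
  have "(\<lambda>i. measure M (A i \<inter> E)) sums measure M ((\<Union>i. A i) \<inter> E)" if "E \<in> sets M" for E
  proof -
    have "(\<lambda>i. measure M (A i \<inter> E)) sums measure M (\<Union>i. A i \<inter> E)"
      using sets_A that disj by (intro finite_measure_UNION) (auto simp: disjoint_family_on_def)
    then show ?thesis by simp
  qed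
  then have "(\<lambda>i. measure M (A i \<inter> C) * c) sums (measure M ((\<Union>i. A i) \<inter> C) * c)"
    "(\<lambda>i. measure M (A i \<inter> D) * d) sums (measure M ((\<Union>i. A i) \<inter> D) * d)"
    using C D by (auto intro!: sums_mult2)
  then show "measure M ((\<Union>i. A i) \<inter> C) * c = measure M ((\<Union>i. A i) \<inter> D) * d"
    unfolding eq by (rule sums_unique2)
qed

section \<open>Past and future given the present\<close>

context path_process
begin

definition X :: "int \<Rightarrow> 'a \<Rightarrow> real" where
  "X k \<omega> = real (S k \<omega>)"

text \<open>Intervals that share the point m have an interval as their union, so compatible path
  events intersect in a path event; the empty set stands for the incompatible ones. This gives a
  generator closed under intersection.\<close>

definition paths_through :: "int \<Rightarrow> int set \<Rightarrow> 'a set set" where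
  "paths_through m T = insert {} {path_event a b \<sigma> | a b \<sigma>. a \<le> m \<and> m \<le> b \<and> {a..b} \<subseteq> T}"

lemma visit_eq_path_event: "visit k s = path_event k k (\<lambda>_. s)"
  by (auto simp: visit_def path_event_def)

lemma prob_visit: "prob (visit k s) = pmf \<pi> s"
  by (simp add: visit_eq_path_event prob_path_event)

lemma paths_through_sets: "paths_through m T \<subseteq> sets M"
  by (auto simp: paths_through_def)

lemma Int_stable_paths_through: "Int_stable (paths_through m T)"
proof (rule Int_stableI)
  fix A B assume AB: "A \<in> paths_through m T" "B \<in> paths_through m T"
  show "A \<inter> B \<in> paths_through m T"
  proof (cases "A \<inter> B = {}")
    case False
    then obtain \<omega> where \<omega>: "\<omega> \<in> A" "\<omega> \<in> B" by blast
    then obtain a b \<sigma> a' b' \<sigma>' where A: "A = path_event a b \<sigma>" "a \<le> m" "m \<le> b" "{a..b} \<subseteq> T"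
      and B: "B = path_event a' b' \<sigma>'" "a' \<le> m" "m \<le> b'" "{a'..b'} \<subseteq> T"
      using AB by (auto simp: paths_through_def)
    have un: "{min a a'..max b b'} = {a..b} \<union> {a'..b'}" using A B by auto
    have "A \<inter> B = path_event (min a a') (max b b') (\<lambda>i. S i \<omega>)"
      using \<omega> unfolding path_event_def A(1) B(1) un by auto
    moreover have "min a a' \<le> m \<and> m \<le> max b b' \<and> {min a a'..max b b'} \<subseteq> T"
      using A B un by auto
    ultimately show ?thesis unfolding paths_through_def by blast
  qed (simp add: paths_through_def)
qed

lemma sets_gen_field_eq:
  "sets (gen_field M X T) = sigma_sets (space M) {X k -` B \<inter> space M | k B. k \<in> T \<and> B \<in> sets borel}"
  unfolding gen_field_def by (rule sets_measure_of) auto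

lemma space_gen_field [simp]: "space (gen_field M X T) = space M"
  unfolding gen_field_def by (rule space_measure_of) auto

lemma gen_field_mono: "T \<subseteq> T' \<Longrightarrow> sets (gen_field M X T) \<subseteq> sets (gen_field M X T')"
  unfolding sets_gen_field_eq by (rule sigma_sets_mono') blast

lemma X_measurable [measurable]: "X k \<in> borel_measurable M"
  unfolding X_def by measurable

lemma sets_gen_field_subset: "sets (gen_field M X T) \<subseteq> sets M"
  unfolding sets_gen_field_eq by (rule sets.sigma_sets_subset) (auto intro: measurable_sets)

lemma X_gen_field: "k \<in> T \<Longrightarrow> X k \<in> borel_measurable (gen_field M X T)"
  by (rule measurableI) (auto simp: sets_gen_field_eq)

lemma S_gen_field: "k \<in> T \<Longrightarrow> S k \<in> measurable (gen_field M X T) (count_space UNIV)"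
proof -
  assume "k \<in> T"
  note [measurable] = X_gen_field[OF this]
  have "S k = (\<lambda>\<omega>. nat \<lfloor>X k \<omega>\<rfloor>)" by (simp add: X_def fun_eq_iff)
  then show ?thesis by simp
qed

lemma visit_gen_field: "k \<in> T \<Longrightarrow> visit k s \<in> sets (gen_field M X T)"
  using measurable_sets[OF S_gen_field, of k T "{s}"] by (simp add: visit_def vimage_def Int_def conj_commute)

text \<open>An event about \<open>X k\<close> is a countable union of paths over the interval
  between k and m, and such an interval stays inside T.\<close>

lemma gen_field_paths_through:
  assumes m: "m \<in> T" and T: "\<And>k. k \<in> T \<Longrightarrow> {min k m..max k m} \<subseteq> T"
  shows "sets (gen_field M X T) = sigma_sets (space M) (paths_through m T)"
proof
  have "X k -` B \<inter> space M \<in> sigma_sets (space M) (paths_through m T)" if k: "k \<in> T" for k B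
  proof -
    let ?I = "{min k m..max k m}"
    let ?P = "{\<sigma> \<in> ?I \<rightarrow>\<^sub>E (UNIV :: nat set). real (\<sigma> k) \<in> B}"
    have "countable (?I \<rightarrow>\<^sub>E (UNIV :: nat set))" by (intro countable_PiE) auto
    then have P: "countable ?P" by (rule countable_subset[rotated]) auto
    have "X k -` B \<inter> space M = (\<Union>\<sigma>\<in>?P. path_event (min k m) (max k m) \<sigma>)"
    proof (intro set_eqI iffI)
      fix \<omega> assume "\<omega> \<in> X k -` B \<inter> space M"
      then have "restrict (\<lambda>i. S i \<omega>) ?I \<in> ?P \<and>
          \<omega> \<in> path_event (min k m) (max k m) (restrict (\<lambda>i. S i \<omega>) ?I)"
        by (auto simp: X_def path_event_def)
      then show "\<omega> \<in> (\<Union>\<sigma>\<in>?P. path_event (min k m) (max k m) \<sigma>)" by blast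
    qed (auto simp: X_def path_event_def)
    also have "\<dots> \<in> sigma_sets (space M) (paths_through m T)"
    proof (rule sigma_sets_UNION)
      show "countable ((\<lambda>\<sigma>. path_event (min k m) (max k m) \<sigma>) ` ?P)"
        using P by (rule countable_image)
      fix A assume "A \<in> (\<lambda>\<sigma>. path_event (min k m) (max k m) \<sigma>) ` ?P"
      then obtain \<sigma> where "A = path_event (min k m) (max k m) \<sigma>" by blast
      moreover have "min k m \<le> m \<and> m \<le> max k m \<and> {min k m..max k m} \<subseteq> T" using T[OF k] by simp
      ultimately have "A \<in> paths_through m T" unfolding paths_through_def by blast
      then show "A \<in> sigma_sets (space M) (paths_through m T)" by (rule sigma_sets.Basic)
    qed
    finally show ?thesis .
  qed
  then show "sets (gen_field M X T) \<subseteq> sigma_sets (space M) (paths_through m T)"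
    unfolding sets_gen_field_eq by (intro sigma_sets_mono) auto
next
  have "path_event a b \<sigma> \<in> sets (gen_field M X T)" if "a \<le> m" "m \<le> b" "{a..b} \<subseteq> T" for a b \<sigma>
  proof -
    have "path_event a b \<sigma> = (\<Inter>i\<in>{a..b}. visit i (\<sigma> i))"
      using that by (auto simp: path_event_def visit_def)
    then show ?thesis using that by (auto intro!: sets.finite_INT visit_gen_field)
  qed
  then show "sigma_sets (space M) (paths_through m T) \<subseteq> sets (gen_field M X T)"
    using sets.sigma_sets_subset[of "paths_through m T" "gen_field M X T"]
    by (auto simp: paths_through_def)
qed

lemma past_eq: "sets (gen_field M X {..m}) = sigma_sets (space M) (paths_through m {..m})"
  and future_eq: "sets (gen_field M X {m..}) = sigma_sets (space M) (paths_through m {m..})"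
  by (rule gen_field_paths_through; auto)+

text \<open>For a path that ends at m and one that starts there this is
  \<open>path_prob_split\<close>. The Dynkin argument is applied once in each variable: it frees A
  for a fixed path B, and afterwards B.\<close>

lemma past_future_cond_indep:
  assumes A: "A \<in> sets (gen_field M X {..m})" and B: "B \<in> sets (gen_field M X {m..})"
  shows "prob (A \<inter> B \<inter> visit m s) * pmf \<pi> s = prob (A \<inter> visit m s) * prob (B \<inter> visit m s)"
proof -
  have paths: "prob (path_event a m \<sigma> \<inter> (path_event m b \<tau> \<inter> visit m s)) * pmf \<pi> s =
      prob (path_event a m \<sigma> \<inter> visit m s) * prob (path_event m b \<tau> \<inter> visit m s)"
    if "a \<le> m" "m \<le> b" for a b \<sigma> \<tau>
  proof (cases "\<sigma> m = s \<and> \<tau> m = s")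
    case True
    \<comment> \<open>The two paths agree at m and are glued there.\<close>
    define \<rho> where "\<rho> i = (if i \<le> m then \<sigma> i else \<tau> i)" for i
    have \<rho>: "\<And>i. i \<le> m \<Longrightarrow> \<rho> i = \<sigma> i" "\<And>i. m \<le> i \<Longrightarrow> \<rho> i = \<tau> i"
      using True by (auto simp: \<rho>_def)
    have sets_eq: "path_event a m \<sigma> \<inter> path_event m b \<tau> = path_event a b \<rho>"
      "path_event a m \<sigma> \<inter> visit m s = path_event a m \<sigma>"
      "path_event m b \<tau> \<inter> visit m s = path_event m b \<tau>"
      using that True by (fastforce simp: path_event_def visit_def \<rho>_def)+
    have "path_prob a m \<rho> = path_prob a m \<sigma>" "path_prob m b \<rho> = path_prob m b \<tau>"
      using that by (auto intro!: path_prob_cong \<rho>)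
    then show ?thesis
      using path_prob_split[OF that, of \<rho>] that True by (simp add: sets_eq prob_path_event \<rho>)
  next
    case False
    have "path_event a m \<sigma> \<inter> visit m s = {} \<or> path_event m b \<tau> \<inter> visit m s = {}"
      using that False by (auto simp: path_event_def visit_def)
    then have "path_event a m \<sigma> \<inter> (path_event m b \<tau> \<inter> visit m s) = {} \<and>
      (path_event a m \<sigma> \<inter> visit m s = {} \<or> path_event m b \<tau> \<inter> visit m s = {})" by blast
    then show ?thesis by auto
  qed
  have 1: "prob (A \<inter> (B \<inter> visit m s)) * pmf \<pi> s = prob (A \<inter> visit m s) * prob (B \<inter> visit m s)"
    if B: "B \<in> paths_through m {m..}" for B
  proof (rule measure_Int_eq_on_sigma_sets[OF Int_stable_paths_through paths_through_sets])
    show "A \<in> sigma_sets (space M) (paths_through m {..m})" using A past_eq by simp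
    show "prob (A \<inter> (B \<inter> visit m s)) * pmf \<pi> s = prob (A \<inter> visit m s) * prob (B \<inter> visit m s)"
      if A: "A \<in> paths_through m {..m}" for A
    proof (cases "A = {} \<or> B = {}")
      case False
      obtain a b \<sigma> where a: "A = path_event a b \<sigma>" "a \<le> m" "m \<le> b" "{a..b} \<subseteq> {..m}"
        using A False unfolding paths_through_def by blast
      obtain a' b' \<tau> where b: "B = path_event a' b' \<tau>" "a' \<le> m" "m \<le> b'" "{a'..b'} \<subseteq> {m..}"
        using B False unfolding paths_through_def by blast
      \<comment> \<open>An interval through m inside the past ends at m; one inside the future
        starts at m.\<close>
      have "b = m" "a' = m" using a b by auto
      then show ?thesis using paths a b by simp
    qed auto
  qed (use B paths_through_sets[of m "{m..}"] in \<open>auto simp: prob_visit intro!: sets.Int\<close>)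
  have "prob (B \<inter> (A \<inter> visit m s)) * pmf \<pi> s = prob (B \<inter> visit m s) * prob (A \<inter> visit m s)"
  proof (rule measure_Int_eq_on_sigma_sets[OF Int_stable_paths_through paths_through_sets])
    show "B \<in> sigma_sets (space M) (paths_through m {m..})" using B future_eq by simp
    show "prob (B \<inter> (A \<inter> visit m s)) * pmf \<pi> s = prob (B \<inter> visit m s) * prob (A \<inter> visit m s)"
      if "B \<in> paths_through m {m..}" for B
      using 1[OF that] by (simp add: Int_left_commute mult.commute)
  qed (use A sets_gen_field_subset[of "{..m}"] in \<open>auto simp: prob_visit intro!: sets.Int\<close>)
  then show ?thesis by (simp add: Int_ac mult.commute)
qed

end

text \<open>A cylinder over a finite index set is a countable disjoint union of path events over an
  interval that encloses the indices.\<close>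

lemma (in prob_space) seq_law_eqI:
  fixes S S' :: "int \<Rightarrow> 'a \<Rightarrow> nat"
  assumes S: "\<And>k. S k \<in> measurable M (count_space UNIV)"
    and S': "\<And>k. S' k \<in> measurable M (count_space UNIV)"
    and eq: "\<And>a b \<sigma>. a \<le> b \<Longrightarrow> prob {\<omega> \<in> space M. \<forall>i\<in>{a..b}. S i \<omega> = \<sigma> i} =
      prob {\<omega> \<in> space M. \<forall>i\<in>{a..b}. S' i \<omega> = \<sigma> i}"
  shows "seq_law M (\<lambda>k \<omega>. real (S k \<omega>)) = seq_law M (\<lambda>k \<omega>. real (S' k \<omega>))"
proof -
  note [measurable] = S S'
  define P where "P k = (borel :: real measure)" for k :: int
  have P: "(\<Pi>\<^sub>M k\<in>UNIV. borel) = PiM UNIV P" by (simp add: P_def[abs_def])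
  have meas: "(\<lambda>\<omega> k. real (T k \<omega>)) \<in> measurable M (PiM UNIV P)"
    if [measurable]: "\<And>k. T k \<in> measurable M (count_space UNIV)" for T :: "int \<Rightarrow> 'a \<Rightarrow> nat"
    unfolding P_def by (rule measurable_PiM_single') (auto simp: measurable_If)
  show ?thesis
    unfolding seq_law_def P
  proof (rule measure_eqI_PiM_infinite)
    fix A and J :: "int set"
    assume J: "finite J" "J \<subseteq> UNIV" and A: "\<And>i. i \<in> J \<Longrightarrow> A i \<in> sets (P i)"
    obtain a b where ab: "a \<le> b" "J \<subseteq> {a..b}"
    proof
      have "Min (insert 0 J) \<le> 0" "0 \<le> Max (insert 0 J)" using J(1) by auto
      then show "Min (insert 0 J) \<le> Max (insert 0 J)" by linarith
      show "J \<subseteq> {Min (insert 0 J)..Max (insert 0 J)}" using J(1) by auto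
    qed
    \<comment> \<open>Extensional functions: two different ones differ inside the interval, so their
      path events are disjoint.\<close>
    define L where "L = {\<sigma> \<in> {a..b} \<rightarrow>\<^sub>E (UNIV :: nat set). \<forall>i\<in>J. real (\<sigma> i) \<in> A i}"
    have "countable ({a..b} \<rightarrow>\<^sub>E (UNIV :: nat set))" by (intro countable_PiE) auto
    then have L: "countable L" unfolding L_def by (rule countable_subset[rotated]) auto
    have em: "prod_emb UNIV P J (Pi\<^sub>E J A) \<in> sets (PiM UNIV P)"
      using J A by (intro sets_PiM_I) auto
    have *: "emeasure (distr M (PiM UNIV P) (\<lambda>\<omega> k. real (T k \<omega>))) (prod_emb UNIV P J (Pi\<^sub>E J A)) =
        (\<integral>\<^sup>+\<sigma>. prob {\<omega> \<in> space M. \<forall>i\<in>{a..b}. T i \<omega> = \<sigma> i} \<partial>count_space L)"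
      if T [measurable]: "\<And>k. T k \<in> measurable M (count_space UNIV)" for T :: "int \<Rightarrow> 'a \<Rightarrow> nat"
    proof -
      have "(\<lambda>\<omega> k. real (T k \<omega>)) -` prod_emb UNIV P J (Pi\<^sub>E J A) \<inter> space M =
          (\<Union>\<sigma>\<in>L. {\<omega> \<in> space M. \<forall>i\<in>{a..b}. T i \<omega> = \<sigma> i})"
      proof (intro set_eqI iffI)
        fix \<omega> assume "\<omega> \<in> (\<lambda>\<omega> k. real (T k \<omega>)) -` prod_emb UNIV P J (Pi\<^sub>E J A) \<inter> space M"
        then have "restrict (\<lambda>i. T i \<omega>) {a..b} \<in> L \<and>
            \<omega> \<in> {\<omega> \<in> space M. \<forall>i\<in>{a..b}. T i \<omega> = restrict (\<lambda>i. T i \<omega>) {a..b} i}"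
          using ab by (auto simp: L_def prod_emb_def PiE_iff)
        then show "\<omega> \<in> (\<Union>\<sigma>\<in>L. {\<omega> \<in> space M. \<forall>i\<in>{a..b}. T i \<omega> = \<sigma> i})" by blast
      qed (use ab in \<open>auto simp: L_def prod_emb_def PiE_iff P_def\<close>)
      then have "emeasure (distr M (PiM UNIV P) (\<lambda>\<omega> k. real (T k \<omega>))) (prod_emb UNIV P J (Pi\<^sub>E J A)) =
          emeasure M (\<Union>\<sigma>\<in>L. {\<omega> \<in> space M. \<forall>i\<in>{a..b}. T i \<omega> = \<sigma> i})"
        by (simp add: emeasure_distr[OF meas[OF T] em])
      also have "\<dots> = (\<integral>\<^sup>+\<sigma>. emeasure M {\<omega> \<in> space M. \<forall>i\<in>{a..b}. T i \<omega> = \<sigma> i} \<partial>count_space L)"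
      proof (rule emeasure_UN_countable[OF _ L])
        show "disjoint_family_on (\<lambda>\<sigma>. {\<omega> \<in> space M. \<forall>i\<in>{a..b}. T i \<omega> = \<sigma> i}) L"
          unfolding disjoint_family_on_def
        proof (intro ballI impI)
          fix \<sigma> \<tau> assume "\<sigma> \<in> L" "\<tau> \<in> L" "\<sigma> \<noteq> \<tau>"
          then have "\<exists>i\<in>{a..b}. \<sigma> i \<noteq> \<tau> i"
            unfolding L_def by (auto simp: PiE_iff intro: extensionalityI)
          then show "{\<omega> \<in> space M. \<forall>i\<in>{a..b}. T i \<omega> = \<sigma> i} \<inter> {\<omega> \<in> space M. \<forall>i\<in>{a..b}. T i \<omega> = \<tau> i} = {}"
            by auto
        qed
      qed measurable
      finally show ?thesis by (simp add: emeasure_eq_measure)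
    qed
    show "emeasure (distr M (PiM UNIV P) (\<lambda>\<omega> k. real (S k \<omega>))) (prod_emb UNIV P J (Pi\<^sub>E J A)) =
        emeasure (distr M (PiM UNIV P) (\<lambda>\<omega> k. real (S' k \<omega>))) (prod_emb UNIV P J (Pi\<^sub>E J A))"
      using ab(1) by (simp add: *[OF S] *[OF S'] eq)
  qed (auto intro!: prob_space.finite_measure prob_space_distr meas S)
qed

section \<open>Stationarity, reversibility and the Markov property\<close>

context path_process
begin

lemma strictly_stationary_X: "strictly_stationary M X"
  unfolding strictly_stationary_def X_def[abs_def]
proof
  fix h
  show "seq_law M (\<lambda>k \<omega>. real (S (k + h) \<omega>)) = seq_law M (\<lambda>k \<omega>. real (S k \<omega>))"
  proof (rule seq_law_eqI)
    fix a b \<sigma> assume "a \<le> (b::int)"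
    have "{\<omega> \<in> space M. \<forall>i\<in>{a..b}. S (i + h) \<omega> = \<sigma> i} = path_event (a + h) (b + h) (\<lambda>i. \<sigma> (i - h))"
      unfolding path_event_def
    proof (intro Collect_cong conj_cong refl)
      fix \<omega>
      have "S j \<omega> = \<sigma> (j - h)" if "\<forall>i\<in>{a..b}. S (i + h) \<omega> = \<sigma> i" "j \<in> {a + h..b + h}" for j
        using that(1)[rule_format, of "j - h"] that(2) by simp
      moreover have "S (i + h) \<omega> = \<sigma> i" if "\<forall>i\<in>{a + h..b + h}. S i \<omega> = \<sigma> (i - h)" "i \<in> {a..b}" for i
        using that(1)[rule_format, of "i + h"] that(2) by simp
      ultimately show "(\<forall>i\<in>{a..b}. S (i + h) \<omega> = \<sigma> i) = (\<forall>i\<in>{a + h..b + h}. S i \<omega> = \<sigma> (i - h))" by blast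
    qed
    moreover have "path_prob (a + h) (b + h) (\<lambda>i. \<sigma> (i - h)) = path_prob a b \<sigma>"
      by (simp add: path_prob_shift)
    ultimately show "prob {\<omega> \<in> space M. \<forall>i\<in>{a..b}. S (i + h) \<omega> = \<sigma> i} =
        prob {\<omega> \<in> space M. \<forall>i\<in>{a..b}. S i \<omega> = \<sigma> i}"
      using \<open>a \<le> b\<close> by (simp add: prob_path_event flip: path_event_def)
  qed auto
qed

lemma reversible_X: "reversible M X"
  unfolding reversible_def X_def[abs_def]
proof (rule seq_law_eqI)
  fix a b \<sigma> assume "a \<le> (b::int)"
  have "{\<omega> \<in> space M. \<forall>i\<in>{a..b}. S (- i) \<omega> = \<sigma> i} = path_event (- b) (- a) (\<lambda>i. \<sigma> (- i))"
    unfolding path_event_def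
  proof (intro Collect_cong conj_cong refl)
    fix \<omega>
    have "S j \<omega> = \<sigma> (- j)" if "\<forall>i\<in>{a..b}. S (- i) \<omega> = \<sigma> i" "j \<in> {- b..- a}" for j
      using that(1)[rule_format, of "- j"] that(2) by simp
    moreover have "S (- i) \<omega> = \<sigma> i" if "\<forall>i\<in>{- b..- a}. S i \<omega> = \<sigma> (- i)" "i \<in> {a..b}" for i
      using that(1)[rule_format, of "- i"] that(2) by simp
    ultimately show "(\<forall>i\<in>{a..b}. S (- i) \<omega> = \<sigma> i) = (\<forall>i\<in>{- b..- a}. S i \<omega> = \<sigma> (- i))" by blast
  qed
  then show "prob {\<omega> \<in> space M. \<forall>i\<in>{a..b}. S (- i) \<omega> = \<sigma> i} =
      prob {\<omega> \<in> space M. \<forall>i\<in>{a..b}. S i \<omega> = \<sigma> i}"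
    using \<open>a \<le> b\<close> by (simp add: prob_path_event path_prob_reflect flip: path_event_def)
qed auto

lemma countable_state_X: "countable_state M X"
  unfolding countable_state_def by (rule exI[of _ "range real"]) (auto simp: X_def)

lemma random_sequence_X: "random_sequence M X"
  by (simp add: random_sequence_def)

lemma prob_Int_visit_le: "A \<in> sets M \<Longrightarrow> prob (A \<inter> visit k s) \<le> pmf \<pi> s"
  using finite_measure_mono[of "A \<inter> visit k s" "visit k s"] by (simp add: prob_visit)

primrec iter_kernel :: "nat \<Rightarrow> nat \<Rightarrow> nat pmf" where
  "iter_kernel 0 s = return_pmf s"
| "iter_kernel (Suc d) s = bind_pmf (iter_kernel d s) K"

lemma prob_visit_step: "prob (visit k s \<inter> visit (k + 1) t) = pmf \<pi> s * pmf (K s) t"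
proof -
  have "visit k s \<inter> visit (k + 1) t = path_event k (k + 1) ((\<lambda>_. s)(k + 1 := t))"
    using path_event_extend[of "k + 1" k k "\<lambda>_. s" t] by (simp add: visit_eq_path_event)
  then show ?thesis
    using path_prob_Suc_right[of k k "(\<lambda>_. s)(k + 1 := t)"] by (simp add: prob_path_event)
qed

lemma prob_visit_visit: "prob (visit k s \<inter> visit (k + int d) t) = pmf \<pi> s * pmf (iter_kernel d s) t"
proof (induction d arbitrary: t)
  case 0
  have "visit k s \<inter> visit k t = (if s = t then visit k s else {})" by (auto simp: visit_def)
  then show ?case by (simp add: prob_visit)
next
  case (Suc d)
  let ?m = "k + int d"
  have "prob (visit k s \<inter> visit (?m + 1) t \<inter> visit ?m u) = pmf \<pi> s * (pmf (iter_kernel d s) u * pmf (K u) t)" for u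
  proof (cases "pmf \<pi> u = 0")
    \<comment> \<open>At a state u of probability zero both sides vanish, the right one by the
      induction hypothesis.\<close>
    case True
    then have "prob (visit k s \<inter> visit ?m u) = 0"
      using prob_Int_visit_le[OF sets_visit, of k s ?m u] by (simp add: measure_le_0_iff)
    moreover have "prob (visit k s \<inter> visit (?m + 1) t \<inter> visit ?m u) = 0"
      using prob_Int_visit_le[of "visit k s \<inter> visit (?m + 1) t" ?m u] True by (simp add: measure_le_0_iff)
    ultimately show ?thesis using Suc[of u] by auto
  next
    case False
    have "prob (visit k s \<inter> visit (?m + 1) t \<inter> visit ?m u) * pmf \<pi> u =
        prob (visit k s \<inter> visit ?m u) * prob (visit (?m + 1) t \<inter> visit ?m u)"
      by (rule past_future_cond_indep) (auto intro: visit_gen_field)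
    also have "\<dots> = pmf \<pi> s * (pmf (iter_kernel d s) u * pmf (K u) t) * pmf \<pi> u"
      using Suc[of u] prob_visit_step[of ?m u t] by (simp add: Int_commute)
    finally show ?thesis using False by simp
  qed
  then have "(\<lambda>u. pmf \<pi> s * (pmf (iter_kernel d s) u * pmf (K u) t)) sums prob (visit k s \<inter> visit (?m + 1) t)"
    using sums_prob_visit[of "visit k s \<inter> visit (?m + 1) t" ?m] by simp
  moreover have "(\<lambda>u. pmf \<pi> s * (pmf (iter_kernel d s) u * pmf (K u) t)) sums
      (pmf \<pi> s * (\<integral>u. pmf (K u) t \<partial>iter_kernel d s))"
    by (intro sums_mult sums_integral_pmf_nat[where C = 1]) (simp add: pmf_le_1)
  ultimately have "prob (visit k s \<inter> visit (?m + 1) t) = pmf \<pi> s * (\<integral>u. pmf (K u) t \<partial>iter_kernel d s)"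
    by (rule sums_unique2)
  then show ?case by (simp add: pmf_bind add.commute add.left_commute)
qed

text \<open>The conditional probability of A given state s at time k; division by zero makes it 0 at
  states of probability zero.\<close>

definition cond :: "int \<Rightarrow> 'a set \<Rightarrow> nat \<Rightarrow> real" where
  "cond k A s = prob (A \<inter> visit k s) / pmf \<pi> s"

lemma cond_nonneg: "0 \<le> cond k A s"
  by (simp add: cond_def)

lemma cond_le_1: "A \<in> sets M \<Longrightarrow> cond k A s \<le> 1"
  using prob_Int_visit_le[of A k s] by (auto simp: cond_def divide_le_eq_1 less_le)

lemma abs_cond_le_1: "A \<in> sets M \<Longrightarrow> \<bar>cond k A s\<bar> \<le> 1"
  using cond_nonneg cond_le_1 by simp

lemma cond_mult_pmf: "A \<in> sets M \<Longrightarrow> pmf \<pi> s * cond k A s = prob (A \<inter> visit k s)"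
  using prob_Int_visit_le[of A k s] by (auto simp: cond_def measure_le_0_iff)

lemma prob_eq_integral_cond: "A \<in> sets M \<Longrightarrow> prob A = (\<integral>s. cond k A s \<partial>\<pi>)"
  using sums_integral_pmf_nat[of "cond k A" 1 \<pi>] sums_prob_visit[of A k]
  by (simp add: abs_cond_le_1 cond_mult_pmf sums_iff)

lemma cond_future:
  assumes B: "B \<in> sets (gen_field M X {m + int d..})" and s: "pmf \<pi> s \<noteq> 0"
  shows "cond m B s = (\<integral>t. cond (m + int d) B t \<partial>iter_kernel d s)"
proof -
  let ?n = "m + int d"
  have B': "B \<in> sets M" using B sets_gen_field_subset by blast
  have "prob (B \<inter> visit m s \<inter> visit ?n t) = pmf \<pi> s * (pmf (iter_kernel d s) t * cond ?n B t)" for t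
  proof (cases "pmf \<pi> t = 0")
    case True
    then show ?thesis
      using prob_Int_visit_le[of "B \<inter> visit m s" ?n t] B' by (simp add: cond_def measure_le_0_iff)
  next
    case False
    have "visit m s \<in> sets (gen_field M X {..?n})" by (rule visit_gen_field) simp
    from past_future_cond_indep[OF this B, of t]
    have "prob (B \<inter> visit m s \<inter> visit ?n t) * pmf \<pi> t = prob (visit m s \<inter> visit ?n t) * prob (B \<inter> visit ?n t)"
      by (simp add: Int_commute[of B])
    then show ?thesis using False
      by (simp add: prob_visit_visit cond_def field_simps)
  qed
  then have "(\<lambda>t. pmf \<pi> s * (pmf (iter_kernel d s) t * cond ?n B t)) sums prob (B \<inter> visit m s)"
    using sums_prob_visit[of "B \<inter> visit m s" ?n] B' by simp
  moreover have "(\<lambda>t. pmf \<pi> s * (pmf (iter_kernel d s) t * cond ?n B t)) sums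
      (pmf \<pi> s * (\<integral>t. cond ?n B t \<partial>iter_kernel d s))"
    by (intro sums_mult sums_integral_pmf_nat[where C = 1] abs_cond_le_1 B')
  ultimately have "prob (B \<inter> visit m s) = pmf \<pi> s * (\<integral>t. cond ?n B t \<partial>iter_kernel d s)"
    by (rule sums_unique2)
  then show ?thesis using s by (simp add: cond_def)
qed

text \<open>Reduction to the state space: past and future enter only through functions on the states
  with values in the unit interval, and all dependence sits in the iterated kernel.\<close>

lemma prob_past_future:
  assumes A: "A \<in> sets (gen_field M X {..m})" and B: "B \<in> sets (gen_field M X {m + int d..})"
  shows "prob (A \<inter> B) = (\<integral>s. cond m A s * (\<integral>t. cond (m + int d) B t \<partial>iter_kernel d s) \<partial>\<pi>)"
proof -
  have sets: "A \<in> sets M" "B \<in> sets M" using A B sets_gen_field_subset by blast+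
  have B': "B \<in> sets (gen_field M X {m..})" using B gen_field_mono[of "{m + int d..}" "{m..}"] by auto
  have "prob (A \<inter> B) = (\<integral>s. cond m (A \<inter> B) s \<partial>\<pi>)" using sets by (intro prob_eq_integral_cond) auto
  also have "\<dots> = (\<integral>s. cond m A s * (\<integral>t. cond (m + int d) B t \<partial>iter_kernel d s) \<partial>\<pi>)"
  proof (intro integral_cong_AE AE_pmfI)
    fix s assume "s \<in> set_pmf \<pi>"
    then have s: "pmf \<pi> s \<noteq> 0" by (simp add: set_pmf_iff)
    have "cond m (A \<inter> B) s = cond m A s * cond m B s"
      using past_future_cond_indep[OF A B', of s] s by (simp add: cond_def field_simps)
    then show "cond m (A \<inter> B) s = cond m A s * (\<integral>t. cond (m + int d) B t \<partial>iter_kernel d s)"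
      using cond_future[OF B s] by simp
  qed auto
  finally show ?thesis .
qed

lemma markov_X: "markov M X"
  unfolding markov_def
proof (intro allI ballI)
  fix k and B :: "real set" assume B: "B \<in> sets borel"
  define c where "c s = measure (K s) {t. real t \<in> B}" for s
  define E where "E = {\<omega> \<in> space M. X (k + 1) \<omega> \<in> B}"
  have E: "E \<in> sets (gen_field M X {k..})"
    using measurable_sets[OF X_gen_field[of "k + 1" "{k..}"] B] by (simp add: E_def vimage_def Int_def conj_commute)
  then have E_sets: "E \<in> sets M" using sets_gen_field_subset by blast
  have c: "\<bar>c s\<bar> \<le> 1" for s by (simp add: c_def)
  have [measurable]: "c \<in> borel_measurable (count_space UNIV)" by simp
  have cond_E: "prob (E \<inter> visit k s) = pmf \<pi> s * c s" for s
  proof -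
    have "E \<inter> visit k s \<inter> visit (k + 1) t =
        (if real t \<in> B then visit k s \<inter> visit (k + 1) t else {})" for t
      by (auto simp: E_def visit_def X_def)
    then have "prob (E \<inter> visit k s \<inter> visit (k + 1) t) = pmf \<pi> s * (pmf (K s) t * indicator {t. real t \<in> B} t)" for t
      by (simp add: prob_visit_step)
    then have "(\<lambda>t. pmf \<pi> s * (pmf (K s) t * indicator {t. real t \<in> B} t)) sums prob (E \<inter> visit k s)"
      using sums_prob_visit[of "E \<inter> visit k s" "k + 1"] E_sets by simp
    moreover have "(\<lambda>t. pmf \<pi> s * (pmf (K s) t * indicator {t. real t \<in> B} t)) sums
        (pmf \<pi> s * (\<integral>t. indicator {t. real t \<in> B} t \<partial>K s))"
      by (intro sums_mult sums_integral_pmf_nat[where C = 1]) simp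
    ultimately show ?thesis by (simp add: sums_unique2 c_def)
  qed
  \<comment> \<open>One computation covers both conditional expectations of the Markov property: T
    is \<open>{..k}\<close> or \<open>{k}\<close>, and either time the result is a function of the
    present state.\<close>
  have cond_exp: "AE \<omega> in M. real_cond_exp M (gen_field M X T) (\<lambda>\<omega>. indicator B (X (k + 1) \<omega>)) \<omega> = c (S k \<omega>)"
    if T: "k \<in> T" "T \<subseteq> {..k}" for T
  proof -
    interpret F: sigma_finite_subalgebra M "gen_field M X T"
      by (intro finite_measure_subalgebra_is_sigma_finite finite_measure_subalgebra.intro
          finite_measure_axioms finite_measure_subalgebra_axioms.intro)
        (use sets_gen_field_subset in \<open>auto simp: subalgebra_def\<close>)
    show ?thesis
    proof (rule F.real_cond_exp_charact)
      show int_ind: "integrable M (\<lambda>\<omega>. indicator B (X (k + 1) \<omega>) :: real)"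
        using B by (intro integrable_const_bound[where B = 1]) auto
      show int_c: "integrable M (\<lambda>\<omega>. c (S k \<omega>))"
        using c by (intro integrable_const_bound[where B = 1]) auto
      show "(\<lambda>\<omega>. c (S k \<omega>)) \<in> borel_measurable (gen_field M X T)"
        using measurable_compose[OF S_gen_field[OF T(1)], of c borel] by simp
      fix A assume "A \<in> sets (gen_field M X T)"
      then have A: "A \<in> sets (gen_field M X {..k})" "A \<in> sets M"
        using gen_field_mono[OF T(2)] sets_gen_field_subset by blast+
      have "(\<integral>\<omega>\<in>A. indicator B (X (k + 1) \<omega>) \<partial>M) = (\<integral>\<omega>. indicator (A \<inter> E) \<omega> \<partial>M)"
        unfolding set_lebesgue_integral_def
        by (intro Bochner_Integration.integral_cong) (auto simp: E_def indicator_def)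
      also have "\<dots> = prob (A \<inter> E)" using A E_sets by simp
      also have "prob (A \<inter> E) = (\<integral>\<omega>\<in>A. c (S k \<omega>) \<partial>M)"
      proof -
        have "prob (A \<inter> E \<inter> visit k s) = c s * prob (A \<inter> visit k s)" for s
        proof (cases "pmf \<pi> s = 0")
          case True
          then show ?thesis
            using prob_Int_visit_le[of A k s] prob_Int_visit_le[of "A \<inter> E" k s] A E_sets
            by (simp add: measure_le_0_iff)
        next
          case False
          then show ?thesis using past_future_cond_indep[OF A(1) E, of s] by (simp add: cond_E)
        qed
        then have "(\<lambda>s. c s * prob (A \<inter> visit k s)) sums prob (A \<inter> E)"
          using sums_prob_visit[of "A \<inter> E" k] A E_sets by simp
        moreover have "(\<integral>\<omega>\<in>A. c (S k \<omega>) \<partial>M) = (\<Sum>s. c s * prob (A \<inter> visit k s))"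
        proof -
          have A_eq: "A = (\<Union>s. A \<inter> visit k s)"
            using sets.sets_into_space[OF A(2)] by (auto simp: visit_def)
          have "(\<integral>\<omega>\<in>(\<Union>s. A \<inter> visit k s). c (S k \<omega>) \<partial>M) = (\<Sum>s. \<integral>\<omega>\<in>A \<inter> visit k s. c (S k \<omega>) \<partial>M)"
          proof (rule lebesgue_integral_countable_add)
            show "set_integrable M (\<Union>s. A \<inter> visit k s) (\<lambda>\<omega>. c (S k \<omega>))"
              unfolding A_eq[symmetric] set_integrable_def using A(2) int_c
              by (rule integrable_mult_indicator)
          qed (use A in \<open>auto simp: visit_def\<close>)
          also have "(\<lambda>s. \<integral>\<omega>\<in>A \<inter> visit k s. c (S k \<omega>) \<partial>M) = (\<lambda>s. c s * prob (A \<inter> visit k s))"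
          proof
            fix s
            have "(\<integral>\<omega>\<in>A \<inter> visit k s. c (S k \<omega>) \<partial>M) = (\<integral>\<omega>. c s * indicator (A \<inter> visit k s) \<omega> \<partial>M)"
              unfolding set_lebesgue_integral_def
              by (intro Bochner_Integration.integral_cong) (auto simp: visit_def indicator_def)
            then show "(\<integral>\<omega>\<in>A \<inter> visit k s. c (S k \<omega>) \<partial>M) = c s * prob (A \<inter> visit k s)"
              using A by simp
          qed
          finally show ?thesis unfolding A_eq[symmetric] .
        qed
        ultimately show ?thesis by (simp add: sums_iff)
      qed
      finally show "(\<integral>\<omega>\<in>A. indicator B (X (k + 1) \<omega>) \<partial>M) = (\<integral>\<omega>\<in>A. c (S k \<omega>) \<partial>M)" .
    qed
  qed
  show "AE \<omega> in M. real_cond_exp M (gen_field M X {..k}) (\<lambda>\<omega>. indicator B (X (k + 1) \<omega>)) \<omega> =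
      real_cond_exp M (gen_field M X {k}) (\<lambda>\<omega>. indicator B (X (k + 1) \<omega>)) \<omega>"
    using cond_exp[of "{..k}"] cond_exp[of "{k}"] by auto
qed

end

section \<open>Kernels that resample below a random level\<close>

lemma integrable_pmf_bounded:
  fixes f :: "'a \<Rightarrow> real"
  shows "(\<And>x. \<bar>f x\<bar> \<le> C) \<Longrightarrow> integrable (measure_pmf p) f"
  by (intro measure_pmf.integrable_const_bound[where B = C]) auto

lemma abs_integral_pmf_le:
  fixes f :: "'a \<Rightarrow> real"
  assumes "\<And>x. \<bar>f x\<bar> \<le> C"
  shows "\<bar>\<integral>x. f x \<partial>measure_pmf p\<bar> \<le> C"
proof -
  have "\<bar>\<integral>x. f x \<partial>measure_pmf p\<bar> \<le> (\<integral>x. \<bar>f x\<bar> \<partial>measure_pmf p)"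
    by (rule integral_abs_bound)
  also have "\<dots> \<le> (\<integral>x. C \<partial>measure_pmf p)"
    using assms order.trans[OF abs_ge_zero assms]
    by (intro integral_mono integrable_pmf_bounded[where C = C]) auto
  finally show ?thesis by simp
qed

lemma integral_bind_pmf_bounded:
  fixes f :: "'b \<Rightarrow> real"
  assumes "\<And>y. \<bar>f y\<bar> \<le> C"
  shows "(\<integral>y. f y \<partial>bind_pmf p q) = (\<integral>x. \<integral>y. f y \<partial>q x \<partial>p)"
  unfolding measure_pmf_bind
  using assms measure_pmf.emeasure_space_1
  by (intro integral_bind[where K = "count_space UNIV" and B = C and B' = 1])
    (auto simp: measurable_def space_subprob_algebra prob_space_imp_subprob_space prob_space_measure_pmf
      intro!: measure_pmf.finite_measure)

text \<open>Fubini's theorem, obtained from the fact that two independent draws commute.\<close>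

lemma integral_pmf_swap:
  fixes f :: "'a \<Rightarrow> 'b \<Rightarrow> real"
  assumes "\<And>x y. \<bar>f x y\<bar> \<le> C"
  shows "(\<integral>x. \<integral>y. f x y \<partial>measure_pmf q \<partial>measure_pmf p) = (\<integral>y. \<integral>x. f x y \<partial>measure_pmf p \<partial>measure_pmf q)"
proof -
  have "(\<integral>x. \<integral>y. f x y \<partial>q \<partial>p) = (\<integral>z. case_prod f z \<partial>bind_pmf p (\<lambda>x. bind_pmf q (\<lambda>y. return_pmf (x, y))))"
    using assms by (simp add: integral_bind_pmf_bounded[where C = C] case_prod_beta)
  also have "\<dots> = (\<integral>z. case_prod f z \<partial>bind_pmf q (\<lambda>y. bind_pmf p (\<lambda>x. return_pmf (x, y))))"
    by (subst bind_commute_pmf) simp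
  also have "\<dots> = (\<integral>y. \<integral>x. f x y \<partial>p \<partial>q)"
    using assms by (simp add: integral_bind_pmf_bounded[where C = C] case_prod_beta)
  finally show ?thesis .
qed

lemma Cauchy_Schwarz_integral_bounded:
  fixes f g :: "'a \<Rightarrow> real"
  assumes "\<And>x. \<bar>f x\<bar> \<le> C" "\<And>x. \<bar>g x\<bar> \<le> D"
  shows "\<bar>\<integral>x. f x * g x \<partial>measure_pmf p\<bar> \<le>
    sqrt (\<integral>x. (f x)\<^sup>2 \<partial>measure_pmf p) * sqrt (\<integral>x. (g x)\<^sup>2 \<partial>measure_pmf p)"
proof -
  let ?F = "\<integral>x. (f x)\<^sup>2 \<partial>p" and ?G = "\<integral>x. (g x)\<^sup>2 \<partial>p" and ?H = "\<integral>x. f x * g x \<partial>p"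
  have CD: "0 \<le> C" "0 \<le> D" using assms[of undefined] by auto
  have int: "integrable p (\<lambda>x. (f x)\<^sup>2)" "integrable p (\<lambda>x. (g x)\<^sup>2)" "integrable p (\<lambda>x. f x * g x)"
  proof -
    show "integrable p (\<lambda>x. (f x)\<^sup>2)"
      using assms(1) CD by (intro integrable_pmf_bounded[where C = "C\<^sup>2"]) (simp add: abs_le_square_iff[symmetric])
    show "integrable p (\<lambda>x. (g x)\<^sup>2)"
      using assms(2) CD by (intro integrable_pmf_bounded[where C = "D\<^sup>2"]) (simp add: abs_le_square_iff[symmetric])
    show "integrable p (\<lambda>x. f x * g x)"
      using assms CD by (intro integrable_pmf_bounded[where C = "C * D"]) (simp add: abs_mult mult_mono)
  qed
  have "0 \<le> ?G * t\<^sup>2 + 2 * ?H * t + ?F" for t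
  proof -
    have "0 \<le> (\<integral>x. (t * g x + f x)\<^sup>2 \<partial>p)" by simp
    also have "\<dots> = (\<integral>x. t\<^sup>2 * (g x)\<^sup>2 + 2 * t * (f x * g x) + (f x)\<^sup>2 \<partial>p)"
      by (simp add: power2_eq_square algebra_simps)
    also have "\<dots> = t\<^sup>2 * ?G + 2 * t * ?H + ?F" using int by simp
    finally show ?thesis by (simp add: mult.commute mult.left_commute)
  qed
  note quad = this
  have "?H\<^sup>2 \<le> ?F * ?G"
  proof (cases "?G = 0")
    case True
    have "?H = 0"
    proof (rule ccontr)
      assume "?H \<noteq> 0"
      \<comment> \<open>Without leading coefficient the quadratic is affine in t, and it takes the
        value -1 here.\<close>
      then show False using quad[of "- (?F + 1) / (2 * ?H)"] True by simp
    qed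
    then show ?thesis using True by simp
  next
    case False
    then have "0 < ?G" by (simp add: less_le)
    have "0 \<le> ?G * (?G * (- ?H / ?G)\<^sup>2 + 2 * ?H * (- ?H / ?G) + ?F)"
      using quad[of "- ?H / ?G"] \<open>0 < ?G\<close> by (intro mult_nonneg_nonneg) auto
    also have "\<dots> = ?F * ?G - ?H\<^sup>2" using \<open>0 < ?G\<close> by (simp add: field_simps power2_eq_square)
    finally show ?thesis by simp
  qed
  then have "sqrt (?H\<^sup>2) \<le> sqrt (?F * ?G)" by (rule real_sqrt_le_mono)
  then show ?thesis by (simp add: real_sqrt_mult)
qed

text \<open>Detailed balance is summed over s. The law q is arbitrary because the result serves both
  \<pi> and \<pi> conditioned to lie below a level.\<close>

lemma bind_pmf_detailed_balance:
  fixes q :: "nat pmf"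
  assumes "\<And>s t. pmf q s * pmf (R s) t = pmf q t * pmf (R t) s"
  shows "bind_pmf q R = q"
proof (rule pmf_eqI)
  fix t
  have "(\<lambda>s. pmf q s * pmf (R s) t) sums (\<integral>s. pmf (R s) t \<partial>q)"
    by (rule sums_integral_pmf_nat[where C = 1]) (simp add: pmf_le_1)
  moreover have "(\<lambda>s. pmf q t * pmf (R t) s) sums (pmf q t * 1)"
    by (intro sums_mult sums_pmf_nat)
  ultimately show "pmf (bind_pmf q R) t = pmf q t"
    unfolding assms pmf_bind by (simp add: sums_unique2)
qed

section \<open>The algebra of resampling\<close>

locale level_kernel =
  fixes \<pi> :: "nat pmf" and \<nu> :: "enat pmf"
  assumes pos_0: "0 \<in> set_pmf \<pi>"
begin

text \<open>One step of the chain draws a level \<open>l\<close> from \<open>\<nu>\<close> and replaces a state below \<open>l\<close> by a fresh one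
  with law \<open>\<pi>\<close> conditioned to lie below \<open>l\<close>. Steps with levels \<open>l\<close> and \<open>l'\<close> compose to a step with
  level \<open>max l l'\<close>, so \<open>d\<close> steps of the chain are one step with the maximum of \<open>d\<close> independent levels.\<close>

definition below :: "enat \<Rightarrow> nat set" where
  "below l = {u. enat u < l}"

definition resample :: "enat \<Rightarrow> nat \<Rightarrow> nat pmf" where
  "resample l s = (if s \<in> below l then cond_pmf \<pi> (below l) else return_pmf s)"

text \<open>The sets \<open>below l\<close> are initial segments, so a nonempty one contains the
  state 0, which has positive mass. This makes the conditioning in \<open>resample\<close>
  meaningful.\<close>

lemma below_nonempty: "s \<in> below l \<Longrightarrow> set_pmf \<pi> \<inter> below l \<noteq> {}"
  using pos_0 order.strict_trans1[of "enat 0" "enat s" l] by (auto simp: below_def)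

lemma pmf_resample: "s \<in> below l \<Longrightarrow>
    pmf (resample l s) t = (if t \<in> below l then pmf \<pi> t / measure \<pi> (below l) else 0)"
  by (simp add: resample_def pmf_cond[OF below_nonempty])

lemma resample_balance: "pmf \<pi> s * pmf (resample l s) t = pmf \<pi> t * pmf (resample l t) s"
  by (cases "s \<in> below l"; cases "t \<in> below l") (auto simp: pmf_resample, auto simp: resample_def indicator_def)

lemma bind_resample [simp]: "bind_pmf \<pi> (resample l) = \<pi>"
  by (rule bind_pmf_detailed_balance) (rule resample_balance)

lemma below_max: "below (max l l') = below l \<union> below l'"
  by (auto simp: below_def less_max_iff_disj)

lemma below_mono: "l \<le> l' \<Longrightarrow> below l \<subseteq> below l'"
  by (auto simp: below_def)

text \<open>The larger level wins. If it comes last, a state that was redrawn is still below it and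
  is redrawn again without memory. If it comes first, the conditioned law is invariant under the
  smaller resampling.\<close>

lemma bind_resample_resample: "bind_pmf (resample l s) (resample l') = resample (max l l') s"
proof (cases "s \<in> below l")
  case False
  then have "bind_pmf (resample l s) (resample l') = resample l' s"
    by (simp add: resample_def bind_return_pmf)
  also have "\<dots> = resample (max l l') s"
  proof (cases "s \<in> below l'")
    case True
    with False have "l \<le> l'" by (auto simp: below_def)
    then show ?thesis by (simp add: max_def)
  next
    case F: False
    then show ?thesis using False by (simp add: resample_def below_max)
  qed
  finally show ?thesis .
next
  case s: True
  show ?thesis
  proof (cases "l' \<le> l")
    case True
    have "bind_pmf (resample l s) (resample l') = resample l s"
    proof (rule bind_pmf_detailed_balance)
      fix u t
      show "pmf (resample l s) u * pmf (resample l' u) t = pmf (resample l s) t * pmf (resample l' t) u"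
      \<comment> \<open>Within \<open>below l\<close> the conditioned law is proportional to \<pi>
        and inherits its balance; across the boundary of \<open>below l\<close> the smaller
        resampling has no transitions.\<close>
      proof (cases "u \<in> below l \<longleftrightarrow> t \<in> below l")
        case True
        then show ?thesis
          using resample_balance[of u l' t] by (auto simp: pmf_resample[OF s] field_simps)
      next
        case False
        have "pmf (resample l' x) y = 0" if "x \<in> below l \<longleftrightarrow> y \<notin> below l" for x y
        proof (cases "x \<in> below l'")
          case True
          then have "y \<notin> below l'" using that below_mono[OF \<open>l' \<le> l\<close>] by auto
          then show ?thesis using True by (simp add: pmf_resample)
        next
          case False
          then show ?thesis using that by (auto simp: resample_def indicator_def)
        qed
        then show ?thesis using False by simp
      qed
    qed
    then show ?thesis using True by (simp add: max_def)
  next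
    case False
    then have sub: "below l \<subseteq> below l'" using below_mono by auto
    have "bind_pmf (resample l s) (resample l') = bind_pmf (resample l s) (\<lambda>_. resample l' s)"
    proof (rule bind_pmf_cong[OF refl])
      fix u assume "u \<in> set_pmf (resample l s)"
      then have "u \<in> below l" using s by (simp add: resample_def below_nonempty)
      then show "resample l' u = resample l' s"
        using s sub by (auto simp: resample_def)
    qed
    then show ?thesis using False by (simp add: max_def not_le less_imp_le)
  qed
qed

definition K :: "nat \<Rightarrow> nat pmf" where
  "K s = bind_pmf \<nu> (\<lambda>l. resample l s)"

sublocale reversible_kernel \<pi> K
proof
  fix s t
  have "pmf \<pi> s * pmf (K s) t = (\<integral>l. pmf \<pi> s * pmf (resample l s) t \<partial>\<nu>)"
    by (simp add: K_def pmf_bind)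
  also have "\<dots> = (\<integral>l. pmf \<pi> t * pmf (resample l t) s \<partial>\<nu>)"
    by (simp only: resample_balance)
  also have "\<dots> = pmf \<pi> t * pmf (K t) s"
    by (simp add: K_def pmf_bind)
  finally show "pmf \<pi> s * pmf (K s) t = pmf \<pi> t * pmf (K t) s" .
qed

primrec max_level :: "nat \<Rightarrow> enat pmf" where
  "max_level 0 = return_pmf 0"
| "max_level (Suc d) = map_pmf (\<lambda>(l, l'). max l l') (pair_pmf (max_level d) \<nu>)"

text \<open>Applies to the levels up to a bound and to the finite levels: a maximum lies in such a
  set exactly if both levels do, so independence yields a power. The membership of 0 accounts for
  the empty maximum.\<close>

lemma measure_max_level:
  assumes "0 \<in> D" "\<And>l l'. max l l' \<in> D \<longleftrightarrow> l \<in> D \<and> l' \<in> D"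
  shows "measure (max_level d) D = measure \<nu> D ^ d"
proof (induction d)
  case (Suc d)
  have "(\<lambda>(l, l'). max l l') -` D = D \<times> D" using assms(2) by auto
  then show ?case using Suc by (simp add: measure_pmf_prob_product countableI_type)
qed (use assms(1) in simp)

text \<open>A draw of the next level does not depend on the current state, so the draws can be moved
  to the front. The iterate \<kappa> is abstract because \<open>iter_kernel\<close> belongs to the
  locale of the process.\<close>

lemma iterate_kernel_eq:
  assumes "\<And>s. \<kappa> 0 s = return_pmf s" "\<And>d s. \<kappa> (Suc d) s = bind_pmf (\<kappa> d s) K"
  shows "\<kappa> d s = bind_pmf (max_level d) (\<lambda>l. resample l s)"
proof (induction d)
  case 0
  then show ?case using assms(1) by (simp add: bind_return_pmf resample_def below_def)
next
  case (Suc d)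
  have "\<kappa> (Suc d) s = bind_pmf (max_level d) (\<lambda>l. bind_pmf (resample l s) (\<lambda>u. bind_pmf \<nu> (\<lambda>l'. resample l' u)))"
    by (simp add: assms(2) Suc bind_assoc_pmf K_def[abs_def])
  also have "\<dots> = bind_pmf (max_level d) (\<lambda>l. bind_pmf \<nu> (\<lambda>l'. resample (max l l') s))"
    by (subst bind_commute_pmf) (simp add: bind_resample_resample)
  also have "\<dots> = bind_pmf (max_level (Suc d)) (\<lambda>l. resample l s)"
    by (simp add: pair_pmf_def bind_map_pmf bind_assoc_pmf bind_return_pmf)
  finally show ?case .
qed


text \<open>Conditional expectation under \<pi> for the partition into the block
  \<open>below l\<close> and the remaining singletons.\<close>

definition avg :: "enat \<Rightarrow> (nat \<Rightarrow> real) \<Rightarrow> nat \<Rightarrow> real" where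
  "avg l b s = (\<integral>t. b t \<partial>resample l s)"

lemma abs_avg_le: "(\<And>t. \<bar>b t\<bar> \<le> C) \<Longrightarrow> \<bar>avg l b s\<bar> \<le> C"
  unfolding avg_def by (rule abs_integral_pmf_le)

lemma integral_avg: "(\<And>t. \<bar>b t\<bar> \<le> C) \<Longrightarrow> (\<integral>s. avg l b s \<partial>\<pi>) = (\<integral>s. b s \<partial>\<pi>)"
  unfolding avg_def using integral_bind_pmf_bounded[of b C \<pi> "resample l"] by simp

lemma avg_not_below: "s \<notin> below l \<Longrightarrow> avg l b s = b s"
  by (simp add: avg_def resample_def)

lemma avg_below:
  assumes s: "s \<in> below l" and b: "\<And>t. \<bar>b t\<bar> \<le> C"
  shows "avg l b s = (\<integral>t. b t * indicator (below l) t \<partial>\<pi>) / measure \<pi> (below l)"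
proof -
  have C: "0 \<le> C" using order.trans[OF abs_ge_zero b] .
  have "(\<lambda>t. pmf (resample l s) t * b t) sums avg l b s"
    unfolding avg_def by (rule sums_integral_pmf_nat[OF b])
  moreover have "(\<lambda>t. pmf \<pi> t * (b t * indicator (below l) t) / measure \<pi> (below l)) sums
      ((\<integral>t. b t * indicator (below l) t \<partial>\<pi>) / measure \<pi> (below l))"
    by (intro sums_divide sums_integral_pmf_nat[where C = C]) (use b C in \<open>auto simp: indicator_def\<close>)
  moreover have "pmf (resample l s) t * b t = pmf \<pi> t * (b t * indicator (below l) t) / measure \<pi> (below l)" for t
    using s by (simp add: pmf_resample)
  ultimately show ?thesis by (simp add: sums_unique2)
qed

text \<open>Twice the total variation distance of \<open>resample l s\<close> from \<pi>, tested on
  nonnegative functions with sum at most 1. Off the block both laws are estimated by their mass. On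
  the block, of mass m, conditioning scales \<pi> up by \<open>1 / m\<close> and drops the rest, and
  each of these changes costs \<open>1 - m\<close>.\<close>

lemma avg_deviation:
  fixes b :: "'b \<Rightarrow> nat \<Rightarrow> real"
  assumes Q: "finite Q" and b0: "\<And>B s. B \<in> Q \<Longrightarrow> 0 \<le> b B s" and b1: "\<And>s. (\<Sum>B\<in>Q. b B s) \<le> 1"
  shows "(\<Sum>B\<in>Q. \<bar>avg l (b B) s - (\<integral>t. b B t \<partial>\<pi>)\<bar>) \<le>
    2 * indicator (- below l) s + 2 * measure \<pi> (- below l)"
proof -
  have b: "\<bar>b B s\<bar> \<le> 1" if "B \<in> Q" for B s
  proof -
    have "b B s \<le> (\<Sum>B\<in>Q. b B s)" using Q b0 that by (intro member_le_sum) auto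
    then show ?thesis using b0[OF that] b1[of s] by simp
  qed
  have int: "integrable \<pi> (\<lambda>t. b B t * indicator E t)" if "B \<in> Q" for B E
    using b[OF that] by (intro integrable_pmf_bounded[where C = 1]) (auto simp: indicator_def)
  have sum_le: "(\<Sum>B\<in>Q. \<integral>t. b B t * indicator E t \<partial>\<pi>) \<le> measure \<pi> E" for E
  proof -
    have "(\<Sum>B\<in>Q. \<integral>t. b B t * indicator E t \<partial>\<pi>) = (\<integral>t. (\<Sum>B\<in>Q. b B t) * indicator E t \<partial>\<pi>)"
      using int by (simp add: Bochner_Integration.integral_sum sum_distrib_right)
    also have "\<dots> \<le> (\<integral>t. indicator E t \<partial>\<pi>)"
    proof (rule integral_mono)
      show "integrable \<pi> (\<lambda>t. (\<Sum>B\<in>Q. b B t) * indicator E t)"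
        unfolding sum_distrib_right using int by (intro Bochner_Integration.integrable_sum) auto
      show "(\<Sum>B\<in>Q. b B t) * indicator E t \<le> indicator E t" for t
        using b1[of t] by (simp add: indicator_def)
    qed (auto intro!: integrable_pmf_bounded[where C = 1])
    finally show ?thesis by simp
  qed
  have nonneg: "0 \<le> (\<integral>t. b B t * indicator E t \<partial>\<pi>)" if "B \<in> Q" for B E
    using b0[OF that] by (intro integral_nonneg_AE) auto
  show ?thesis
  proof (cases "s \<in> below l")
    case False
    have "\<bar>avg l (b B) s - (\<integral>t. b B t \<partial>\<pi>)\<bar> \<le> b B s + (\<integral>t. b B t * indicator UNIV t \<partial>\<pi>)" if "B \<in> Q" for B
      using b0[OF that, of s] nonneg[OF that, of UNIV] by (simp add: avg_not_below[OF False])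
    then have "(\<Sum>B\<in>Q. \<bar>avg l (b B) s - (\<integral>t. b B t \<partial>\<pi>)\<bar>) \<le>
        (\<Sum>B\<in>Q. b B s) + (\<Sum>B\<in>Q. \<integral>t. b B t * indicator UNIV t \<partial>\<pi>)"
      unfolding sum.distrib[symmetric] by (rule sum_mono)
    also have "\<dots> \<le> 2" using b1[of s] sum_le[of UNIV] by simp
    finally show ?thesis using False by (simp add: add_increasing2)
  next
    case True
    let ?m = "measure \<pi> (below l)"
    let ?I = "\<lambda>B. \<integral>t. b B t * indicator (below l) t \<partial>\<pi>" and ?J = "\<lambda>B. \<integral>t. b B t * indicator (- below l) t \<partial>\<pi>"
    have m: "0 < ?m" using below_nonempty[OF True] by (auto simp: measure_pmf_posI)
    have m1: "?m \<le> 1" by simp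
    have compl: "measure \<pi> (- below l) = 1 - ?m"
      using measure_pmf.prob_compl[of "below l" \<pi>] by (simp add: Compl_eq_Diff_UNIV)
    have "\<bar>avg l (b B) s - (\<integral>t. b B t \<partial>\<pi>)\<bar> \<le> (1 / ?m - 1) * ?I B + ?J B" if "B \<in> Q" for B
    proof -
      have "(\<integral>t. b B t \<partial>\<pi>) = (\<integral>t. b B t * indicator (below l) t + b B t * indicator (- below l) t \<partial>\<pi>)"
        by (intro Bochner_Integration.integral_cong) (auto simp: indicator_def)
      also have "\<dots> = ?I B + ?J B" using int[OF that] by simp
      finally have "avg l (b B) s - (\<integral>t. b B t \<partial>\<pi>) = (1 / ?m - 1) * ?I B - ?J B"
        by (simp add: avg_below[OF True b[OF that]] algebra_simps)
      moreover have "0 \<le> (1 / ?m - 1) * ?I B"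
        using m m1 nonneg[OF that] by (intro mult_nonneg_nonneg) auto
      ultimately show ?thesis using nonneg[OF that, of "- below l"] by simp
    qed
    then have "(\<Sum>B\<in>Q. \<bar>avg l (b B) s - (\<integral>t. b B t \<partial>\<pi>)\<bar>) \<le> (1 / ?m - 1) * sum ?I Q + sum ?J Q"
      unfolding sum_distrib_left sum.distrib[symmetric] by (rule sum_mono)
    also have "\<dots> \<le> (1 / ?m - 1) * ?m + measure \<pi> (- below l)"
      using m m1 sum_le by (intro add_mono mult_left_mono) auto
    also have "(1 / ?m - 1) * ?m = measure \<pi> (- below l)" using m by (simp add: compl algebra_simps)
    finally show ?thesis using True by simp
  qed
qed

text \<open>The indicator in \<open>avg_deviation\<close> integrates to
  \<open>measure \<pi> (- below l)\<close>, so both terms there contribute twice this measure; hence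
  the 4.\<close>

lemma level_total_variation:
  fixes a :: "'b \<Rightarrow> nat \<Rightarrow> real" and b :: "'c \<Rightarrow> nat \<Rightarrow> real"
  assumes P: "finite P" and a0: "\<And>A s. A \<in> P \<Longrightarrow> 0 \<le> a A s" and a1: "\<And>s. (\<Sum>A\<in>P. a A s) \<le> 1"
    and Q: "finite Q" and b0: "\<And>B s. B \<in> Q \<Longrightarrow> 0 \<le> b B s" and b1: "\<And>s. (\<Sum>B\<in>Q. b B s) \<le> 1"
  shows "(\<Sum>A\<in>P. \<Sum>B\<in>Q. \<bar>\<integral>s. a A s * (avg l (b B) s - (\<integral>t. b B t \<partial>\<pi>)) \<partial>\<pi>\<bar>) \<le> 4 * measure \<pi> (- below l)"
proof -
  let ?D = "\<lambda>B s. \<bar>avg l (b B) s - (\<integral>t. b B t \<partial>\<pi>)\<bar>"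
  have bound: "\<bar>f x s\<bar> \<le> 1" if "finite R" "\<And>x s. x \<in> R \<Longrightarrow> 0 \<le> f x s" "\<And>s. (\<Sum>x\<in>R. f x s) \<le> 1" "x \<in> R"
    for f :: "'z \<Rightarrow> nat \<Rightarrow> real" and R x s
  proof -
    have "f x s \<le> (\<Sum>x\<in>R. f x s)" using that by (intro member_le_sum) auto
    then show ?thesis using that(2)[OF that(4), of s] that(3)[of s] by simp
  qed
  have a: "\<bar>a A s\<bar> \<le> 1" if "A \<in> P" for A s using bound[of P a, OF P a0 a1 that] .
  have b: "\<bar>b B s\<bar> \<le> 1" if "B \<in> Q" for B s using bound[of Q b, OF Q b0 b1 that] .
  have D: "?D B s \<le> 2" if "B \<in> Q" for B s
    using abs_avg_le[of "b B" 1 l s] abs_integral_pmf_le[of "b B" 1 \<pi>] b[OF that] by fastforce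
  have int: "integrable \<pi> (\<lambda>s. a A s * ?D B s)" if "A \<in> P" "B \<in> Q" for A B
    using a[OF that(1)] D[OF that(2)] mult_mono[of "\<bar>a A s\<bar>" 1 "?D B s" 2 for s]
    by (intro integrable_pmf_bounded[where C = 2]) (simp add: abs_mult)
  have "(\<Sum>A\<in>P. \<Sum>B\<in>Q. \<bar>\<integral>s. a A s * (avg l (b B) s - (\<integral>t. b B t \<partial>\<pi>)) \<partial>\<pi>\<bar>) \<le>
      (\<Sum>A\<in>P. \<Sum>B\<in>Q. \<integral>s. a A s * ?D B s \<partial>\<pi>)"
  proof (intro sum_mono)
    fix A B assume AB: "A \<in> P" "B \<in> Q"
    have "\<bar>\<integral>s. a A s * (avg l (b B) s - (\<integral>t. b B t \<partial>\<pi>)) \<partial>\<pi>\<bar> \<le>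
        (\<integral>s. \<bar>a A s * (avg l (b B) s - (\<integral>t. b B t \<partial>\<pi>))\<bar> \<partial>\<pi>)"
      by (rule integral_abs_bound)
    also have "\<dots> = (\<integral>s. a A s * ?D B s \<partial>\<pi>)"
      using a0[OF AB(1)] by (simp add: abs_mult)
    finally show "\<bar>\<integral>s. a A s * (avg l (b B) s - (\<integral>t. b B t \<partial>\<pi>)) \<partial>\<pi>\<bar> \<le> (\<integral>s. a A s * ?D B s \<partial>\<pi>)" .
  qed
  also have "\<dots> = (\<integral>s. (\<Sum>A\<in>P. \<Sum>B\<in>Q. a A s * ?D B s) \<partial>\<pi>)"
    using int by (simp add: Bochner_Integration.integral_sum)
  also have "\<dots> \<le> (\<integral>s. 2 * indicator (- below l) s + 2 * measure \<pi> (- below l) \<partial>\<pi>)"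
  proof (rule integral_mono)
    show "integrable \<pi> (\<lambda>s. \<Sum>A\<in>P. \<Sum>B\<in>Q. a A s * ?D B s)"
      using int by (intro Bochner_Integration.integrable_sum) auto
    show "integrable \<pi> (\<lambda>s. 2 * indicator (- below l) s + 2 * measure \<pi> (- below l))"
      using measure_pmf.prob_le_1[of \<pi> "- below l"]
      by (intro integrable_pmf_bounded[where C = 4]) (auto simp: indicator_def simp del: measure_pmf.prob_le_1)
    fix s
    have "(\<Sum>A\<in>P. \<Sum>B\<in>Q. a A s * ?D B s) = (\<Sum>A\<in>P. a A s) * (\<Sum>B\<in>Q. ?D B s)"
      by (simp add: sum_product)
    also have "\<dots> \<le> 1 * (\<Sum>B\<in>Q. ?D B s)"
      using a1[of s] by (intro mult_right_mono sum_nonneg) auto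
    also have "\<dots> \<le> 2 * indicator (- below l) s + 2 * measure \<pi> (- below l)"
      using avg_deviation[OF Q b0 b1] by simp
    finally show "(\<Sum>A\<in>P. \<Sum>B\<in>Q. a A s * ?D B s) \<le> 2 * indicator (- below l) s + 2 * measure \<pi> (- below l)" .
  qed
  also have "\<dots> = 4 * measure \<pi> (- below l)"
  proof -
    have "integrable \<pi> (\<lambda>s. 2 * indicator (- below l) s :: real)"
      by (intro integrable_pmf_bounded[where C = 2]) (auto simp: indicator_def)
    then show ?thesis by simp
  qed
  finally show ?thesis .
qed

text \<open>Draw s from \<pi> and t from \<open>resample l s\<close>. Both marginals are \<pi>, so
  Cauchy-Schwarz for this pair is the contraction property; g may be centred because
  \<open>avg l h\<close> has mean zero. At level \<infinity> the block is everything and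
  \<open>avg l h\<close> is the mean of h.\<close>

lemma level_correlation:
  assumes g: "\<And>s. \<bar>g s\<bar> \<le> C" and h: "\<And>s. \<bar>h s\<bar> \<le> D" and h0: "(\<integral>s. h s \<partial>\<pi>) = 0"
  shows "\<bar>\<integral>s. g s * avg l h s \<partial>\<pi>\<bar> \<le>
    indicator (- {\<infinity>}) l * (sqrt (\<integral>s. (g s - (\<integral>s. g s \<partial>\<pi>))\<^sup>2 \<partial>\<pi>) * sqrt (\<integral>s. (h s)\<^sup>2 \<partial>\<pi>))"
proof (cases "l = \<infinity>")
  case True
  have "below l = UNIV" using True by (auto simp: below_def)
  then have "avg l h s = 0" for s using avg_below[OF _ h, of s l] h0 by simp
  then show ?thesis by simp
next
  case False
  define m where "m = (\<integral>s. g s \<partial>\<pi>)"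
  have m: "\<bar>m\<bar> \<le> C" unfolding m_def by (rule abs_integral_pmf_le[OF g])
  have CD: "0 \<le> C" "0 \<le> D" using order.trans[OF abs_ge_zero g] order.trans[OF abs_ge_zero h] by auto
  have g': "\<bar>g s - m\<bar> \<le> 2 * C" for s using g[of s] m by simp
  define J where "J = bind_pmf \<pi> (\<lambda>s. map_pmf (Pair s) (resample l s))"
  have int: "integrable \<pi> (\<lambda>s. f s * avg l h s)" if "\<And>s. \<bar>f s\<bar> \<le> E" for f E
  proof (rule integrable_pmf_bounded)
    show "\<bar>f s * avg l h s\<bar> \<le> E * D" for s
      using that[of s] abs_avg_le[OF h] CD by (simp add: abs_mult mult_mono)
  qed
  have "(\<integral>s. g s * avg l h s \<partial>\<pi>) = (\<integral>s. (g s - m) * avg l h s + m * avg l h s \<partial>\<pi>)"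
    by (simp add: algebra_simps)
  also have "\<dots> = (\<integral>s. (g s - m) * avg l h s \<partial>\<pi>) + m * (\<integral>s. avg l h s \<partial>\<pi>)"
    using int[OF g'] int[of "\<lambda>_. m" C] m by simp
  also have "\<dots> = (\<integral>s. (g s - m) * avg l h s \<partial>\<pi>)" by (simp add: integral_avg[OF h] h0)
  also have "\<dots> = (\<integral>x. (g (fst x) - m) * h (snd x) \<partial>J)"
  proof -
    have "\<bar>(g (fst x) - m) * h (snd x)\<bar> \<le> 2 * C * D" for x
      using g' h CD by (simp add: abs_mult mult_mono)
    then show ?thesis
      unfolding J_def by (subst integral_bind_pmf_bounded[where C = "2 * C * D"]) (auto simp: avg_def)
  qed
  finally have "\<bar>\<integral>s. g s * avg l h s \<partial>\<pi>\<bar> = \<bar>\<integral>x. (g (fst x) - m) * h (snd x) \<partial>J\<bar>" by simp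
  also have "\<dots> \<le> sqrt (\<integral>x. (g (fst x) - m)\<^sup>2 \<partial>J) * sqrt (\<integral>x. (h (snd x))\<^sup>2 \<partial>J)"
    by (rule Cauchy_Schwarz_integral_bounded[OF g' h])
  also have "(\<integral>x. (g (fst x) - m)\<^sup>2 \<partial>J) = (\<integral>s. (g s - m)\<^sup>2 \<partial>\<pi>)"
  proof -
    have "\<bar>(g (fst x) - m)\<^sup>2\<bar> \<le> (2 * C)\<^sup>2" for x
      using power_mono[OF g'[of "fst x"], of 2] by simp
    then show ?thesis
      unfolding J_def by (subst integral_bind_pmf_bounded[where C = "(2 * C)\<^sup>2"]) auto
  qed
  also have "(\<integral>x. (h (snd x))\<^sup>2 \<partial>J) = (\<integral>s. (h s)\<^sup>2 \<partial>\<pi>)"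
  proof -
    have h2: "\<bar>(h t)\<^sup>2\<bar> \<le> D\<^sup>2" for t
      using h[of t] CD by (simp add: abs_le_square_iff[symmetric])
    then have "(\<integral>x. (h (snd x))\<^sup>2 \<partial>J) = (\<integral>s. avg l (\<lambda>t. (h t)\<^sup>2) s \<partial>\<pi>)"
      unfolding J_def by (subst integral_bind_pmf_bounded[where C = "D\<^sup>2"]) (auto simp: avg_def[abs_def])
    then show ?thesis using integral_avg[OF h2] by simp
  qed
  finally show ?thesis using False by (simp add: m_def)
qed

end

section \<open>Dependence coefficients of the chain\<close>

locale level_process = level_kernel \<pi> \<nu> + path_process \<pi> "level_kernel.K \<pi> \<nu>" M S
  for \<pi> \<nu> and M :: "'a measure" and S
begin

lemma iter_kernel_eq: "iter_kernel d s = bind_pmf (max_level d) (\<lambda>l. resample l s)"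
  by (rule iterate_kernel_eq) simp_all

lemma integral_iter_kernel:
  assumes "\<And>s. \<bar>g s\<bar> \<le> C" "\<And>t. \<bar>h t\<bar> \<le> D"
  shows "(\<integral>s. g s * (\<integral>t. h t \<partial>iter_kernel d s) \<partial>\<pi>) = (\<integral>l. \<integral>s. g s * avg l h s \<partial>\<pi> \<partial>max_level d)"
proof -
  have C: "0 \<le> C" using order.trans[OF abs_ge_zero assms(1)] .
  have "\<bar>g s * avg l h s\<bar> \<le> C * D" for s l
    using assms(1)[of s] abs_avg_le[of h D l s, OF assms(2)] C by (simp add: abs_mult mult_mono)
  then have swap: "(\<integral>s. \<integral>l. g s * avg l h s \<partial>max_level d \<partial>\<pi>) = (\<integral>l. \<integral>s. g s * avg l h s \<partial>\<pi> \<partial>max_level d)"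
    by (rule integral_pmf_swap)
  have "(\<integral>t. h t \<partial>iter_kernel d s) = (\<integral>l. avg l h s \<partial>max_level d)" for s
    unfolding iter_kernel_eq avg_def by (rule integral_bind_pmf_bounded[OF assms(2)])
  then show ?thesis using swap by simp
qed

abbreviation past :: "'a measure" where "past \<equiv> gen_field M X {..0}"
abbreviation future :: "nat \<Rightarrow> 'a measure" where "future n \<equiv> gen_field M X {int n..}"

lemma past_sets: "A \<in> sets past \<Longrightarrow> A \<in> sets M"
  and future_sets: "B \<in> sets (future n) \<Longrightarrow> B \<in> sets M"
  using sets_gen_field_subset by blast+

lemma dependence_eq:
  assumes "A \<in> sets past" "B \<in> sets (future n)"
  shows "prob (A \<inter> B) - prob A * prob B =
    (\<integral>l. \<integral>s. cond 0 A s * (avg l (cond n B) s - (\<integral>t. cond n B t \<partial>\<pi>)) \<partial>\<pi> \<partial>max_level n)"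
proof -
  have A: "\<And>s. \<bar>cond 0 A s\<bar> \<le> 1" and B: "\<And>s. \<bar>cond n B s\<bar> \<le> 1"
    using assms past_sets future_sets by (auto intro: abs_cond_le_1)
  have "prob (A \<inter> B) = (\<integral>l. \<integral>s. cond 0 A s * avg l (cond n B) s \<partial>\<pi> \<partial>max_level n)"
    using prob_past_future[of A 0 B n] assms integral_iter_kernel[OF A B] by simp
  moreover have "prob A * prob B = (\<integral>l. \<integral>s. cond 0 A s * (\<integral>t. cond n B t \<partial>\<pi>) \<partial>\<pi> \<partial>max_level n)"
    using prob_eq_integral_cond[of A 0] prob_eq_integral_cond[of B n] assms past_sets future_sets by simp
  moreover have int: "integrable \<pi> (\<lambda>s. cond 0 A s * avg l (cond n B) s)" for l
    using A abs_avg_le[OF B]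
    by (intro integrable_pmf_bounded[where C = 1]) (simp add: abs_mult mult_le_one)
  moreover have "integrable \<pi> (\<lambda>s. cond 0 A s * (\<integral>t. cond n B t \<partial>\<pi>))"
    using A by (intro integrable_mult_left integrable_pmf_bounded)
  moreover have "integrable (max_level n) (\<lambda>l. \<integral>s. cond 0 A s * avg l (cond n B) s \<partial>\<pi>)"
    using A abs_avg_le[OF B]
    by (intro integrable_pmf_bounded[where C = 1] abs_integral_pmf_le) (simp add: abs_mult mult_le_one)
  ultimately show ?thesis by (simp add: right_diff_distrib)
qed

text \<open>Even for a partition this is only an inequality, since \<open>cond\<close> is 0 at
  states of probability zero.\<close>

lemma sum_cond_le_1:
  assumes "finite P" "disjoint P" "P \<subseteq> sets M"
  shows "(\<Sum>A\<in>P. cond k A s) \<le> 1"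
proof -
  have "(\<Sum>A\<in>P. prob (A \<inter> visit k s)) = prob (\<Union>A\<in>P. A \<inter> visit k s)"
    using assms by (intro finite_measure_finite_Union[symmetric]) (auto simp: disjoint_family_on_def disjoint_def)
  also have "(\<Union>A\<in>P. A \<inter> visit k s) = (\<Union>P) \<inter> visit k s" by blast
  also have "prob \<dots> \<le> pmf \<pi> s" using assms by (intro prob_Int_visit_le) auto
  finally show ?thesis
    by (cases "pmf \<pi> s = 0") (auto simp: cond_def sum_divide_distrib[symmetric] divide_le_eq_1 less_le)
qed

text \<open>The probability that one step leaves the state u alone instead of resampling it.\<close>

definition level_cdf :: "nat \<Rightarrow> real" where
  "level_cdf u = measure \<nu> {l. l \<le> enat u}"

lemma measure_max_level_le: "measure (max_level d) {l. l \<le> enat u} = level_cdf u ^ d"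
  unfolding level_cdf_def by (rule measure_max_level) (auto simp: zero_enat_def[symmetric])

text \<open>Fubini's theorem: u is not below the maximal level exactly if that level is at most
  u.\<close>

lemma integral_measure_not_below:
  "(\<integral>l. measure \<pi> (- below l) \<partial>max_level d) = (\<integral>u. level_cdf u ^ d \<partial>\<pi>)"
proof -
  have "(\<integral>l. measure \<pi> (- below l) \<partial>max_level d) = (\<integral>l. \<integral>u. indicator (- below l) u \<partial>\<pi> \<partial>max_level d)"
    by simp
  also have "\<dots> = (\<integral>u. \<integral>l. indicator (- below l) u \<partial>max_level d \<partial>\<pi>)"
    by (rule integral_pmf_swap[where C = 1]) simp
  also have "(\<lambda>u. \<integral>l. indicator (- below l) u \<partial>max_level d) = (\<lambda>u. \<integral>l. indicator {l. l \<le> enat u} l \<partial>max_level d :: real)"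
    by (intro ext Bochner_Integration.integral_cong) (auto simp: below_def indicator_def)
  also have "\<dots> = (\<lambda>u. level_cdf u ^ d)" by (simp add: measure_max_level_le)
  finally show ?thesis .
qed

lemma partitions_dependence_le:
  assumes P: "P \<in> finite_partitions M past" and Q: "Q \<in> finite_partitions M (future n)"
  shows "1 / 2 * (\<Sum>A\<in>P. \<Sum>B\<in>Q. \<bar>prob (A \<inter> B) - prob A * prob B\<bar>) \<le> 2 * (\<integral>u. level_cdf u ^ n \<partial>\<pi>)"
proof -
  have P': "finite P" "disjoint P" "P \<subseteq> sets past" and Q': "finite Q" "disjoint Q" "Q \<subseteq> sets (future n)"
    using P Q by (auto simp: finite_partitions_def partition_on_def)
  have P_sets: "P \<subseteq> sets M" and Q_sets: "Q \<subseteq> sets M"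
    using P' Q' past_sets future_sets by blast+
  define I where "I l A B = (\<integral>s. cond 0 A s * (avg l (cond n B) s - (\<integral>t. cond n B t \<partial>\<pi>)) \<partial>\<pi>)" for l A B
  have I_bound: "\<bar>I l A B\<bar> \<le> 2" if "A \<in> P" "B \<in> Q" for l A B
  proof -
    have A: "\<bar>cond 0 A s\<bar> \<le> 1" and B: "\<bar>cond n B s\<bar> \<le> 1" for s
      using that P_sets Q_sets by (auto intro!: abs_cond_le_1)
    have "\<bar>avg l (cond n B) s - (\<integral>t. cond n B t \<partial>\<pi>)\<bar> \<le> 2" for s
      using abs_avg_le[of "cond n B" 1 l s, OF B] abs_integral_pmf_le[of "cond n B" 1 \<pi>, OF B] by linarith
    then have "\<bar>cond 0 A s * (avg l (cond n B) s - (\<integral>t. cond n B t \<partial>\<pi>))\<bar> \<le> 1 * 2" for s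
      unfolding abs_mult using A[of s] by (intro mult_mono) auto
    then show ?thesis unfolding I_def by (intro abs_integral_pmf_le) simp
  qed
  have int: "integrable (max_level n) (\<lambda>l. \<bar>I l A B\<bar>)" if "A \<in> P" "B \<in> Q" for A B
    using I_bound[OF that] by (intro integrable_pmf_bounded[where C = 2]) simp
  have "(\<Sum>A\<in>P. \<Sum>B\<in>Q. \<bar>prob (A \<inter> B) - prob A * prob B\<bar>) \<le> (\<Sum>A\<in>P. \<Sum>B\<in>Q. \<integral>l. \<bar>I l A B\<bar> \<partial>max_level n)"
  proof (intro sum_mono)
    fix A B assume "A \<in> P" "B \<in> Q"
    then have "A \<in> sets past" "B \<in> sets (future n)" using P' Q' by auto
    then show "\<bar>prob (A \<inter> B) - prob A * prob B\<bar> \<le> (\<integral>l. \<bar>I l A B\<bar> \<partial>max_level n)"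
      by (simp only: dependence_eq I_def integral_abs_bound)
  qed
  also have "\<dots> = (\<integral>l. (\<Sum>A\<in>P. \<Sum>B\<in>Q. \<bar>I l A B\<bar>) \<partial>max_level n)"
    using int by (simp add: Bochner_Integration.integral_sum)
  also have "\<dots> \<le> (\<integral>l. 4 * measure \<pi> (- below l) \<partial>max_level n)"
  proof (rule integral_mono)
    show "integrable (max_level n) (\<lambda>l. \<Sum>A\<in>P. \<Sum>B\<in>Q. \<bar>I l A B\<bar>)"
      using int by (intro Bochner_Integration.integrable_sum) auto
    show "integrable (max_level n) (\<lambda>l. 4 * measure \<pi> (- below l))"
      by (intro integrable_pmf_bounded[where C = 4]) simp
    show "(\<Sum>A\<in>P. \<Sum>B\<in>Q. \<bar>I l A B\<bar>) \<le> 4 * measure \<pi> (- below l)" for l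
      unfolding I_def using P' Q' P_sets Q_sets
      by (intro level_total_variation cond_nonneg sum_cond_le_1)
  qed
  also have "\<dots> = 4 * (\<integral>u. level_cdf u ^ n \<partial>\<pi>)" by (simp add: integral_measure_not_below)
  finally show ?thesis by simp
qed

lemma finite_partitions_space: "{space M} \<in> finite_partitions M (gen_field M X T)"
  using sets.top[of "gen_field M X T"] not_empty
  by (auto simp: finite_partitions_def partition_on_def)

lemma beta_mix_le: "beta_mix M X n \<le> 2 * (\<integral>u. level_cdf u ^ n \<partial>\<pi>)"
  unfolding beta_mix_def beta_coeff_def
  by (rule cSUP_least) (use finite_partitions_space partitions_dependence_le in blast, use partitions_dependence_le in force)

text \<open>For the partitions of A and B with their complements, all four terms of the sum are
  equal. The two that involve A already make up for the factor 1 / 2.\<close>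

lemma dependence_le_beta_mix:
  assumes A: "A \<in> sets past" and B: "B \<in> sets (future n)"
  shows "\<bar>prob (A \<inter> B) - prob A * prob B\<bar> \<le> beta_mix M X n"
proof -
  let ?f = "\<lambda>A B. \<bar>prob (A \<inter> B) - prob A * prob B\<bar>"
  have le: "1 / 2 * (\<Sum>A\<in>P. \<Sum>B\<in>Q. ?f A B) \<le> beta_mix M X n"
    if "P \<in> finite_partitions M past" "Q \<in> finite_partitions M (future n)" for P Q
  proof -
    have "bdd_above ((\<lambda>(P, Q). 1 / 2 * (\<Sum>A\<in>P. \<Sum>B\<in>Q. ?f A B)) `
        (finite_partitions M past \<times> finite_partitions M (future n)))"
      using partitions_dependence_le by (intro bdd_aboveI2[where M = "2 * (\<integral>u. level_cdf u ^ n \<partial>\<pi>)"]) auto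
    then show ?thesis unfolding beta_mix_def beta_coeff_def using that
      by (intro cSUP_upper2[where x = "(P, Q)"]) auto
  qed
  have sets: "A \<in> sets M" "B \<in> sets M" using A B past_sets future_sets by auto
  let ?A = "space M - A" and ?B = "space M - B"
  show ?thesis
  \<comment> \<open>Partitions have no empty blocks, so trivial events are treated apart; their
    dependence is 0.\<close>
  proof (cases "A = {} \<or> ?A = {} \<or> B = {} \<or> ?B = {}")
    case True
    have "A \<subseteq> space M" "B \<subseteq> space M" using sets sets.sets_into_space by auto
    then have "A = {} \<or> A = space M \<or> B = {} \<or> B = space M" using True by auto
    then have "?f A B = 0" using sets
      by (auto simp: prob_space Int_absorb1 Int_absorb2 sets.sets_into_space)
    also have "0 \<le> beta_mix M X n"
      using le[OF finite_partitions_space finite_partitions_space] by (rule order.trans[rotated]) (simp add: sum_nonneg)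
    finally show ?thesis .
  next
    case False
    have "A \<noteq> ?A" "B \<noteq> ?B" using False by auto
    have part: "{E, space M - E} \<in> finite_partitions M (gen_field M X T)"
      if "E \<in> sets (gen_field M X T)" "E \<noteq> {}" "space M - E \<noteq> {}" for E T
      using that sets.sets_into_space[OF that(1)] sets.compl_sets[OF that(1)]
      by (auto simp: finite_partitions_def partition_on_def disjoint_def)
    have "?f A B = 1 / 2 * (?f A B + ?f A B)" by simp
    also have "\<dots> \<le> 1 / 2 * (\<Sum>A'\<in>{A, ?A}. \<Sum>B'\<in>{B, ?B}. ?f A' B')"
    proof -
      have "prob ?B = 1 - prob B" using sets by (simp add: prob_compl)
      moreover have "prob (A \<inter> ?B) = prob A - prob (A \<inter> B)"
      proof -
        have "A \<inter> ?B = A - A \<inter> B" using sets.sets_into_space[OF sets(1)] by auto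
        then show ?thesis using sets by (simp add: finite_measure_Diff)
      qed
      ultimately have "?f A ?B = ?f A B" by (simp add: right_diff_distrib abs_minus_commute)
      then show ?thesis using \<open>A \<noteq> ?A\<close> \<open>B \<noteq> ?B\<close> by simp
    qed
    also have "\<dots> \<le> beta_mix M X n" using False A B by (intro le part) auto
    finally show ?thesis .
  qed
qed

lemma alpha_mix_le_beta_mix: "alpha_mix M X n \<le> beta_mix M X n"
  unfolding alpha_mix_def alpha_coeff_def
  by (rule cSUP_least) (auto intro: dependence_le_beta_mix)

text \<open>If the maximal level is at most s, the chain has not left s. Otherwise it is found at s
  with probability \<open>pmf \<pi> s / measure \<pi> (below l)\<close>, which is at least
  \<open>pmf \<pi> s\<close>.\<close>

lemma dependence_visit: "level_cdf s ^ n * (pmf \<pi> s * (1 - pmf \<pi> s)) \<le>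
  prob (visit 0 s \<inter> visit n s) - prob (visit 0 s) * prob (visit n s)"
proof -
  let ?c = "level_cdf s ^ n"
  have "?c + pmf \<pi> s * (1 - ?c) = (\<integral>l. indicator {l. l \<le> enat s} l + pmf \<pi> s * (1 - indicator {l. l \<le> enat s} l) \<partial>max_level n)"
  proof -
    have "integrable (max_level n) (\<lambda>l. indicator {l. l \<le> enat s} l :: real)"
      by (intro integrable_pmf_bounded[where C = 1]) (auto simp: indicator_def)
    then show ?thesis by (simp add: measure_max_level_le)
  qed
  also have "\<dots> \<le> (\<integral>l. pmf (resample l s) s \<partial>max_level n)"
  proof (rule integral_mono)
    show "indicator {l. l \<le> enat s} l + pmf \<pi> s * (1 - indicator {l. l \<le> enat s} l) \<le> pmf (resample l s) s" for l
    proof (cases "s \<in> below l")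
      case True
      have "0 < measure \<pi> (below l)" using below_nonempty[OF True] by (auto simp: measure_pmf_posI)
      moreover have "measure \<pi> (below l) \<le> 1" by simp
      ultimately have "pmf \<pi> s \<le> pmf \<pi> s / measure \<pi> (below l)"
        by (simp add: le_divide_eq mult_left_le)
      then show ?thesis using True by (auto simp: pmf_resample below_def)
    next
      case False
      then show ?thesis by (auto simp: resample_def below_def)
    qed
  qed (auto intro!: integrable_pmf_bounded[where C = 1] simp: pmf_le_1 indicator_def)
  also have "\<dots> = pmf (iter_kernel n s) s" by (simp add: iter_kernel_eq pmf_bind)
  finally have "pmf \<pi> s * (?c + pmf \<pi> s * (1 - ?c)) \<le> pmf \<pi> s * pmf (iter_kernel n s) s"
    by (intro mult_left_mono) auto
  then show ?thesis using prob_visit_visit[of 0 s n s] by (simp add: prob_visit algebra_simps)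
qed

lemma alpha_mix_ge: "level_cdf s ^ n * (pmf \<pi> s * (1 - pmf \<pi> s)) \<le> alpha_mix M X n"
proof -
  have "bdd_above ((\<lambda>(A, B). \<bar>prob (A \<inter> B) - prob A * prob B\<bar>) ` (sets past \<times> sets (future n)))"
    by (intro bdd_aboveI2[where M = "beta_mix M X n"]) (auto intro: dependence_le_beta_mix)
  moreover have "visit 0 s \<in> sets past" "visit n s \<in> sets (future n)" by (auto intro: visit_gen_field)
  ultimately have "\<bar>prob (visit 0 s \<inter> visit n s) - prob (visit 0 s) * prob (visit n s)\<bar> \<le> alpha_mix M X n"
    unfolding alpha_mix_def alpha_coeff_def
    by (intro cSUP_upper2[where x = "(visit 0 s, visit n s)"]) auto
  then show ?thesis using dependence_visit[of s n] by linarith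
qed

end

section \<open>Maximal correlation\<close>

lemma (in prob_space) cov_eq:
  assumes "integrable M Y" "integrable M Z" "integrable M (\<lambda>\<omega>. Y \<omega> * Z \<omega>)"
  shows "cov M Y Z = expectation (\<lambda>\<omega>. Y \<omega> * Z \<omega>) - expectation Y * expectation Z"
proof -
  have "cov M Y Z = expectation (\<lambda>\<omega>. Y \<omega> * Z \<omega> - expectation Z * Y \<omega> - expectation Y * Z \<omega> + expectation Y * expectation Z)"
    unfolding cov_def by (intro Bochner_Integration.integral_cong) (auto simp: algebra_simps)
  then show ?thesis using assms by (simp add: prob_space)
qed

lemma (in prob_space) integrable_of_square:
  fixes Y :: "'a \<Rightarrow> real"
  assumes [measurable]: "Y \<in> borel_measurable M" and "integrable M (\<lambda>\<omega>. (Y \<omega>)\<^sup>2)"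
  shows "integrable M Y"
proof (rule Bochner_Integration.integrable_bound)
  show "integrable M (\<lambda>\<omega>. 1 + (Y \<omega>)\<^sup>2)" using assms by simp
  have "\<bar>y\<bar> \<le> 1 + y\<^sup>2" for y :: real
    using zero_le_power2[of "\<bar>y\<bar> - 1"] by (simp add: power2_diff)
  then show "AE \<omega> in M. norm (Y \<omega>) \<le> norm (1 + (Y \<omega>)\<^sup>2)" by simp
qed simp

lemma abs_mult_le_sum_squares: "\<bar>y * z\<bar> \<le> y\<^sup>2 + z\<^sup>2" for y z :: real
proof -
  have "0 \<le> (\<bar>y\<bar> - \<bar>z\<bar>)\<^sup>2" by simp
  then have "2 * \<bar>y * z\<bar> \<le> y\<^sup>2 + z\<^sup>2" by (simp add: power2_diff abs_mult)
  then show ?thesis by (smt (verit) abs_ge_zero)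
qed

context level_process
begin

text \<open>The conditional mean of a simple Y given the state at time k, written as a finite
  combination of values of \<open>cond\<close> so that the results on events apply.\<close>

definition mean_at :: "int \<Rightarrow> ('a \<Rightarrow> real) \<Rightarrow> nat \<Rightarrow> real" where
  "mean_at k Y s = (\<Sum>y\<in>Y ` space M. y * cond k (Y -` {y} \<inter> space M) s)"

lemma expectation_simple:
  fixes F :: "real \<Rightarrow> real"
  assumes "simple_function M Y"
  shows "expectation (\<lambda>\<omega>. F (Y \<omega>)) = (\<Sum>y\<in>Y ` space M. F y * prob (Y -` {y} \<inter> space M))"
proof -
  note Y = simple_functionD[OF assms]
  have "expectation (\<lambda>\<omega>. F (Y \<omega>)) = expectation (\<lambda>\<omega>. \<Sum>y\<in>Y ` space M. F y * indicator (Y -` {y} \<inter> space M) \<omega>)"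
  proof (rule Bochner_Integration.integral_cong[OF refl])
    fix \<omega> assume "\<omega> \<in> space M"
    then have "(\<Sum>y\<in>Y ` space M. F y * indicator (Y -` {y} \<inter> space M) \<omega>) = (\<Sum>y\<in>Y ` space M. if y = Y \<omega> then F y else 0)"
      by (intro sum.cong) (auto simp: indicator_def)
    then show "F (Y \<omega>) = (\<Sum>y\<in>Y ` space M. F y * indicator (Y -` {y} \<inter> space M) \<omega>)"
      using Y(1) \<open>\<omega> \<in> space M\<close> by simp
  qed
  also have "\<dots> = (\<Sum>y\<in>Y ` space M. F y * prob (Y -` {y} \<inter> space M))"
    using Y by (subst Bochner_Integration.integral_sum) (auto simp: less_top[symmetric] intro!: integrable_mult_right)
  finally show ?thesis .
qed

lemma expectation_simple_mult:
  assumes "simple_function M Y" "simple_function M Z"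
  shows "expectation (\<lambda>\<omega>. Y \<omega> * Z \<omega>) = (\<Sum>y\<in>Y ` space M. \<Sum>z\<in>Z ` space M.
    y * z * prob ((Y -` {y} \<inter> space M) \<inter> (Z -` {z} \<inter> space M)))"
proof -
  note Y = simple_functionD[OF assms(1)] and Z = simple_functionD[OF assms(2)]
  let ?A = "\<lambda>y. Y -` {y} \<inter> space M" and ?B = "\<lambda>z. Z -` {z} \<inter> space M"
  have "expectation (\<lambda>\<omega>. Y \<omega> * Z \<omega>) =
      expectation (\<lambda>\<omega>. \<Sum>y\<in>Y ` space M. \<Sum>z\<in>Z ` space M. y * z * indicator (?A y \<inter> ?B z) \<omega>)"
  proof (rule Bochner_Integration.integral_cong[OF refl])
    fix \<omega> assume \<omega>: "\<omega> \<in> space M"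
    then have "(\<Sum>y\<in>Y ` space M. \<Sum>z\<in>Z ` space M. y * z * indicator (?A y \<inter> ?B z) \<omega>) =
        (\<Sum>y\<in>Y ` space M. \<Sum>z\<in>Z ` space M. if z = Z \<omega> then (if y = Y \<omega> then y * z else 0) else 0)"
      by (intro sum.cong) (auto simp: indicator_def)
    then show "Y \<omega> * Z \<omega> = (\<Sum>y\<in>Y ` space M. \<Sum>z\<in>Z ` space M. y * z * indicator (?A y \<inter> ?B z) \<omega>)"
      using Y(1) Z(1) \<omega> by simp
  qed
  also have "\<dots> = (\<Sum>y\<in>Y ` space M. \<Sum>z\<in>Z ` space M. y * z * prob (?A y \<inter> ?B z))"
  proof -
    have int: "integrable M (\<lambda>\<omega>. y * z * indicator (?A y \<inter> ?B z) \<omega>)" for y z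
      using Y Z by (intro integrable_mult_right) (auto simp: less_top[symmetric])
    have "expectation (\<lambda>\<omega>. y * z * indicator (?A y \<inter> ?B z) \<omega>) = y * z * prob (?A y \<inter> ?B z)" for y z
      using Y Z by simp
    then show ?thesis
      by (subst Bochner_Integration.integral_sum, intro Bochner_Integration.integrable_sum int)
        (subst Bochner_Integration.integral_sum, intro int, simp only:)
  qed
  finally show ?thesis .
qed

lemma abs_mean_at_le:
  assumes "simple_function M Y"
  shows "\<bar>mean_at k Y s\<bar> \<le> (\<Sum>y\<in>Y ` space M. \<bar>y\<bar>)"
proof -
  have "\<bar>mean_at k Y s\<bar> \<le> (\<Sum>y\<in>Y ` space M. \<bar>y * cond k (Y -` {y} \<inter> space M) s\<bar>)"
    unfolding mean_at_def by (rule sum_abs)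
  also have "\<dots> \<le> (\<Sum>y\<in>Y ` space M. \<bar>y\<bar>)"
  proof (rule sum_mono)
    fix y
    have "\<bar>cond k (Y -` {y} \<inter> space M) s\<bar> \<le> 1"
      using simple_functionD(2)[OF assms] by (rule abs_cond_le_1)
    then show "\<bar>y * cond k (Y -` {y} \<inter> space M) s\<bar> \<le> \<bar>y\<bar>" by (simp add: abs_mult mult_left_le)
  qed
  finally show ?thesis .
qed

lemma integrable_cond: "A \<in> sets M \<Longrightarrow> integrable (measure_pmf p) (cond k A)"
  using abs_cond_le_1 by (intro integrable_pmf_bounded[where C = 1]) auto

lemma integral_mean_at:
  assumes "simple_function M Y"
  shows "(\<integral>s. mean_at k Y s \<partial>\<pi>) = expectation Y"
  using expectation_simple[OF assms, of "\<lambda>y. y"] simple_functionD(2)[OF assms]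
  unfolding mean_at_def
  by (simp add: Bochner_Integration.integral_sum integrable_cond prob_eq_integral_cond[of _ k])

lemma integral_mean_at_square_le:
  assumes "simple_function M Y"
  shows "(\<integral>s. (mean_at k Y s)\<^sup>2 \<partial>\<pi>) \<le> expectation (\<lambda>\<omega>. (Y \<omega>)\<^sup>2)"
proof -
  note Y = simple_functionD[OF assms]
  let ?A = "\<lambda>y. Y -` {y} \<inter> space M"
  have "(\<integral>s. (mean_at k Y s)\<^sup>2 \<partial>\<pi>) \<le> (\<integral>s. (\<Sum>y\<in>Y ` space M. y\<^sup>2 * cond k (?A y) s) \<partial>\<pi>)"
  proof (rule integral_mono)
    show "integrable \<pi> (\<lambda>s. (mean_at k Y s)\<^sup>2)"
      using power_mono[OF abs_mean_at_le[OF assms] abs_ge_zero, of k _ 2]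
      by (intro integrable_pmf_bounded[where C = "(\<Sum>y\<in>Y ` space M. \<bar>y\<bar>)\<^sup>2"]) simp
    show "integrable \<pi> (\<lambda>s. \<Sum>y\<in>Y ` space M. y\<^sup>2 * cond k (?A y) s)"
      using Y by (intro Bochner_Integration.integrable_sum integrable_mult_right integrable_cond)
    fix s
    have "(\<Sum>A\<in>?A ` (Y ` space M). cond k A s) \<le> 1"
      using Y by (intro sum_cond_le_1) (auto simp: disjoint_def)
    also have "(\<Sum>A\<in>?A ` (Y ` space M). cond k A s) = (\<Sum>y\<in>Y ` space M. cond k (?A y) s)"
      by (subst sum.reindex) (auto simp: inj_on_def)
    finally have c1: "(\<Sum>y\<in>Y ` space M. cond k (?A y) s) \<le> 1" .
    have "(mean_at k Y s)\<^sup>2 = (\<Sum>y\<in>Y ` space M. (y * sqrt (cond k (?A y) s)) * sqrt (cond k (?A y) s))\<^sup>2"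
      by (simp add: mean_at_def mult.assoc cond_nonneg)
    also have "\<dots> \<le> (\<Sum>y\<in>Y ` space M. (y * sqrt (cond k (?A y) s))\<^sup>2) * (\<Sum>y\<in>Y ` space M. (sqrt (cond k (?A y) s))\<^sup>2)"
      by (rule Cauchy_Schwarz_ineq_sum)
    also have "\<dots> = (\<Sum>y\<in>Y ` space M. y\<^sup>2 * cond k (?A y) s) * (\<Sum>y\<in>Y ` space M. cond k (?A y) s)"
      by (simp add: power_mult_distrib cond_nonneg)
    also have "\<dots> \<le> (\<Sum>y\<in>Y ` space M. y\<^sup>2 * cond k (?A y) s)"
      using c1 by (intro mult_left_le sum_nonneg) (auto simp: cond_nonneg)
    finally show "(mean_at k Y s)\<^sup>2 \<le> (\<Sum>y\<in>Y ` space M. y\<^sup>2 * cond k (?A y) s)" .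
  qed
  also have "\<dots> = (\<Sum>y\<in>Y ` space M. y\<^sup>2 * prob (?A y))"
    using Y by (simp add: Bochner_Integration.integral_sum integrable_cond prob_eq_integral_cond[of _ k])
  also have "\<dots> = expectation (\<lambda>\<omega>. (Y \<omega>)\<^sup>2)" using expectation_simple[OF assms, of "\<lambda>y. y\<^sup>2"] by simp
  finally show ?thesis .
qed

lemma simple_function_gen_field:
  "simple_function (gen_field M X T) Y \<Longrightarrow> simple_function M Y"
  using sets_gen_field_subset[of T] unfolding simple_function_def by auto

text \<open>The covariance is an integral over the states of the conditional means g and h.
  Averaging \<open>level_correlation\<close> over the maximal level leaves the probability that it
  is finite, and conditional means have no larger variance than Y and Z.\<close>

lemma simple_past_future_covariance_le:
  assumes "simple_function past Y" "simple_function (future n) Z"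
  shows "\<bar>expectation (\<lambda>\<omega>. Y \<omega> * Z \<omega>) - expectation Y * expectation Z\<bar> \<le> measure \<nu> (- {\<infinity>}) ^ n *
    (sqrt (expectation (\<lambda>\<omega>. (Y \<omega>)\<^sup>2) - (expectation Y)\<^sup>2) * sqrt (expectation (\<lambda>\<omega>. (Z \<omega>)\<^sup>2) - (expectation Z)\<^sup>2))"
proof -
  have Y: "simple_function M Y" and Z: "simple_function M Z"
    using assms by (auto intro: simple_function_gen_field)
  let ?A = "\<lambda>y. Y -` {y} \<inter> space M" and ?B = "\<lambda>z. Z -` {z} \<inter> space M"
  let ?g = "mean_at 0 Y" and ?h = "mean_at n Z"
  define C D where "C = (\<Sum>y\<in>Y ` space M. \<bar>y\<bar>)" and "D = (\<Sum>z\<in>Z ` space M. \<bar>z\<bar>)"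
  have g: "\<bar>?g s\<bar> \<le> C" and h: "\<bar>?h s\<bar> \<le> D" for s
    using abs_mean_at_le[OF Y] abs_mean_at_le[OF Z] by (auto simp: C_def D_def)
  have A_sets: "?A y \<in> sets past" "?A y \<in> sets M" and B_sets: "?B z \<in> sets (future n)" "?B z \<in> sets M" for y z
    using simple_functionD(2)[OF assms(1)] simple_functionD(2)[OF assms(2)]
      simple_functionD(2)[OF Y] simple_functionD(2)[OF Z] by auto
  define m where "m = expectation Z"
  have mean_g: "(\<integral>s. ?g s \<partial>\<pi>) = expectation Y" and mean_h: "(\<integral>s. ?h s \<partial>\<pi>) = m"
    by (simp_all add: integral_mean_at Y Z m_def)
  have m: "\<bar>m\<bar> \<le> D" unfolding mean_h[symmetric] by (rule abs_integral_pmf_le[OF h])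
  have h': "\<bar>?h s - m\<bar> \<le> 2 * D" for s using h[of s] m by simp
  have "expectation (\<lambda>\<omega>. Y \<omega> * Z \<omega>) = (\<Sum>y\<in>Y ` space M. \<Sum>z\<in>Z ` space M. y * z *
      (\<integral>s. cond 0 (?A y) s * (\<integral>t. cond n (?B z) t \<partial>iter_kernel n s) \<partial>\<pi>))"
    using prob_past_future[of _ 0 _ n] A_sets B_sets by (simp add: expectation_simple_mult[OF Y Z])
  also have "\<dots> = (\<integral>s. (\<Sum>y\<in>Y ` space M. \<Sum>z\<in>Z ` space M. y * z *
      (cond 0 (?A y) s * (\<integral>t. cond n (?B z) t \<partial>iter_kernel n s))) \<partial>\<pi>)"
  proof -
    have "integrable \<pi> (\<lambda>s. cond 0 (?A y) s * (\<integral>t. cond n (?B z) t \<partial>iter_kernel n s))" for y z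
    proof (rule integrable_pmf_bounded)
      show "\<bar>cond 0 (?A y) s * (\<integral>t. cond n (?B z) t \<partial>iter_kernel n s)\<bar> \<le> 1" for s
        using abs_cond_le_1[OF A_sets(2)] abs_integral_pmf_le[of "cond n (?B z)" 1, OF abs_cond_le_1[OF B_sets(2)]]
        by (simp add: abs_mult mult_le_one)
    qed
    then show ?thesis by (simp add: Bochner_Integration.integral_sum Bochner_Integration.integrable_sum)
  qed
  also have "\<dots> = (\<integral>s. ?g s * (\<integral>t. ?h t \<partial>iter_kernel n s) \<partial>\<pi>)"
  proof (intro Bochner_Integration.integral_cong refl)
    fix s
    have "(\<integral>t. ?h t \<partial>iter_kernel n s) = (\<Sum>z\<in>Z ` space M. z * (\<integral>t. cond n (?B z) t \<partial>iter_kernel n s))"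
      unfolding mean_at_def using B_sets by (simp add: Bochner_Integration.integral_sum integrable_cond)
    then show "(\<Sum>y\<in>Y ` space M. \<Sum>z\<in>Z ` space M. y * z *
      (cond 0 (?A y) s * (\<integral>t. cond n (?B z) t \<partial>iter_kernel n s))) = ?g s * (\<integral>t. ?h t \<partial>iter_kernel n s)"
      by (simp add: mean_at_def sum_product mult_ac)
  qed
  finally have YZ: "expectation (\<lambda>\<omega>. Y \<omega> * Z \<omega>) = (\<integral>s. ?g s * (\<integral>t. ?h t \<partial>iter_kernel n s) \<partial>\<pi>)" .
  have int_gh: "integrable \<pi> (\<lambda>s. ?g s * (\<integral>t. ?h t \<partial>iter_kernel n s))"
  proof (rule integrable_pmf_bounded)
    show "\<bar>?g s * (\<integral>t. ?h t \<partial>iter_kernel n s)\<bar> \<le> C * D" for s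
      using g[of s] abs_integral_pmf_le[of ?h D "iter_kernel n s", OF h] by (simp add: abs_mult mult_mono')
  qed
  have int_g: "integrable (measure_pmf p) ?g" and int_h: "integrable (measure_pmf p) ?h" for p
    by (rule integrable_pmf_bounded[of _ C], rule g) (rule integrable_pmf_bounded[of _ D], rule h)
  have "expectation (\<lambda>\<omega>. Y \<omega> * Z \<omega>) - expectation Y * expectation Z =
      (\<integral>s. ?g s * (\<integral>t. ?h t \<partial>iter_kernel n s) \<partial>\<pi>) - (\<integral>s. ?g s * m \<partial>\<pi>)"
    by (simp add: YZ mean_g m_def)
  also have "\<dots> = (\<integral>s. ?g s * (\<integral>t. ?h t \<partial>iter_kernel n s) - ?g s * m \<partial>\<pi>)"
    using int_gh int_g by (intro Bochner_Integration.integral_diff[symmetric]) auto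
  \<comment> \<open>The iterated kernel has mass 1, so the mean of h can be subtracted inside it;
    \<open>level_correlation\<close> asks for a function of mean zero.\<close>
  also have "\<dots> = (\<integral>s. ?g s * (\<integral>t. (?h t - m) \<partial>iter_kernel n s) \<partial>\<pi>)"
    using int_h by (simp add: right_diff_distrib)
  also have "\<dots> = (\<integral>l. \<integral>s. ?g s * avg l (\<lambda>t. ?h t - m) s \<partial>\<pi> \<partial>max_level n)"
    by (rule integral_iter_kernel[OF g h'])
  finally have cov: "expectation (\<lambda>\<omega>. Y \<omega> * Z \<omega>) - expectation Y * expectation Z =
      (\<integral>l. \<integral>s. ?g s * avg l (\<lambda>t. ?h t - m) s \<partial>\<pi> \<partial>max_level n)" .
  define V where "V = sqrt (\<integral>s. (?g s - expectation Y)\<^sup>2 \<partial>\<pi>) * sqrt (\<integral>s. (?h s - m)\<^sup>2 \<partial>\<pi>)"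
  have h0: "(\<integral>t. (?h t - m) \<partial>\<pi>) = 0" using int_h mean_h by simp
  have level: "\<bar>\<integral>s. ?g s * avg l (\<lambda>t. ?h t - m) s \<partial>\<pi>\<bar> \<le> indicator (- {\<infinity>}) l * V" for l
    using level_correlation[of ?g C "\<lambda>t. ?h t - m" "2 * D" l, OF g h' h0] by (simp add: V_def mean_g)
  have V0: "0 \<le> V" by (simp add: V_def)
  have "\<bar>expectation (\<lambda>\<omega>. Y \<omega> * Z \<omega>) - expectation Y * expectation Z\<bar> \<le>
      (\<integral>l. \<bar>\<integral>s. ?g s * avg l (\<lambda>t. ?h t - m) s \<partial>\<pi>\<bar> \<partial>max_level n)"
    unfolding cov by (rule integral_abs_bound)
  also have "\<dots> \<le> (\<integral>l. indicator (- {\<infinity>}) l * V \<partial>max_level n)"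
  proof (rule integral_mono)
    show "integrable (max_level n) (\<lambda>l. \<bar>\<integral>s. ?g s * avg l (\<lambda>t. ?h t - m) s \<partial>\<pi>\<bar>)"
    proof (rule integrable_pmf_bounded)
      show "\<bar>\<bar>\<integral>s. ?g s * avg l (\<lambda>t. ?h t - m) s \<partial>\<pi>\<bar>\<bar> \<le> V" for l
        using level[of l] V0 by (cases "l = \<infinity>") auto
    qed
    show "integrable (max_level n) (\<lambda>l. indicator (- {\<infinity>}) l * V)"
      using V0 by (intro integrable_pmf_bounded[where C = V]) (auto simp: indicator_def)
  qed (rule level)
  also have "\<dots> = measure (max_level n) (- {\<infinity>}) * V" by simp
  also have "measure (max_level n) (- {\<infinity>}) = measure \<nu> (- {\<infinity>}) ^ n"
  proof (rule measure_max_level)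
    show "max l l' \<in> - {\<infinity>} \<longleftrightarrow> l \<in> - {\<infinity>} \<and> l' \<in> - {\<infinity>}" for l l' :: enat
      by (cases l; cases l'; simp)
  qed simp
  also have "measure \<nu> (- {\<infinity>}) ^ n * V \<le> measure \<nu> (- {\<infinity>}) ^ n *
    (sqrt (expectation (\<lambda>\<omega>. (Y \<omega>)\<^sup>2) - (expectation Y)\<^sup>2) * sqrt (expectation (\<lambda>\<omega>. (Z \<omega>)\<^sup>2) - (expectation Z)\<^sup>2))"
  proof (intro mult_left_mono zero_le_power measure_nonneg)
    have var: "(\<integral>s. (mean_at k W s - expectation W)\<^sup>2 \<partial>\<pi>) \<le> expectation (\<lambda>\<omega>. (W \<omega>)\<^sup>2) - (expectation W)\<^sup>2"
      if W: "simple_function M W" for W k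
    proof -
      have 1: "integrable \<pi> (mean_at k W)" by (rule integrable_pmf_bounded[OF abs_mean_at_le[OF W]])
      have 2: "integrable \<pi> (\<lambda>s. (mean_at k W s)\<^sup>2)"
        using power_mono[OF abs_mean_at_le[OF W] abs_ge_zero, of k _ 2]
        by (intro integrable_pmf_bounded[where C = "(\<Sum>y\<in>W ` space M. \<bar>y\<bar>)\<^sup>2"]) simp
      have "(\<integral>s. (mean_at k W s - expectation W)\<^sup>2 \<partial>\<pi>) =
          (\<integral>s. (mean_at k W s)\<^sup>2 - 2 * expectation W * mean_at k W s + (expectation W)\<^sup>2 \<partial>\<pi>)"
        by (simp add: power2_diff algebra_simps)
      also have "\<dots> = (\<integral>s. (mean_at k W s)\<^sup>2 \<partial>\<pi>) - (expectation W)\<^sup>2"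
        using 1 2 by (simp add: integral_mean_at[OF W] power2_eq_square)
      finally show ?thesis using integral_mean_at_square_le[OF W, of k] by simp
    qed
    show "V \<le> sqrt (expectation (\<lambda>\<omega>. (Y \<omega>)\<^sup>2) - (expectation Y)\<^sup>2) * sqrt (expectation (\<lambda>\<omega>. (Z \<omega>)\<^sup>2) - (expectation Z)\<^sup>2)"
      unfolding V_def m_def using var[OF Y, of 0] var[OF Z, of n]
      by (intro mult_mono' real_sqrt_le_mono) auto
  qed
  finally show ?thesis .
qed

lemma ex_simple_approximation:
  assumes "Y \<in> borel_measurable (gen_field M X T)"
  shows "\<exists>F. (\<forall>i. simple_function (gen_field M X T) (F i)) \<and> (\<forall>\<omega>\<in>space M. (\<lambda>i. F i \<omega>) \<longlonglongrightarrow> Y \<omega>) \<and>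
    (\<forall>i. \<forall>\<omega>\<in>space M. \<bar>F i \<omega>\<bar> \<le> 2 * \<bar>Y \<omega> :: real\<bar>)"
  using borel_measurable_implies_sequence_metric[OF assms, of 0] by simp

text \<open>Y and Z are approximated by simple functions dominated by twice their modulus. Products
  are then dominated by four times the modulus of the limiting product, and every moment in the
  simple case converges.\<close>

lemma past_future_covariance_le:
  assumes "Y \<in> square_integrable_rvs M past" "Z \<in> square_integrable_rvs M (future n)"
  shows "\<bar>cov M Y Z\<bar> \<le> measure \<nu> (- {\<infinity>}) ^ n * (sqrt (cov M Y Y) * sqrt (cov M Z Z))"
proof -
  have Y: "Y \<in> borel_measurable past" "integrable M (\<lambda>\<omega>. (Y \<omega>)\<^sup>2)"
    and Z: "Z \<in> borel_measurable (future n)" "integrable M (\<lambda>\<omega>. (Z \<omega>)\<^sup>2)"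
    using assms by (auto simp: square_integrable_rvs_def)
  have sub: "subalgebra M (gen_field M X T)" for T
    using sets_gen_field_subset by (auto simp: subalgebra_def)
  have Ym [measurable]: "Y \<in> borel_measurable M" and Zm [measurable]: "Z \<in> borel_measurable M"
    using measurable_from_subalg[OF sub] Y(1) Z(1) by auto
  have Yi: "integrable M Y" and Zi: "integrable M Z" 
    using integrable_of_square[OF Ym Y(2)] integrable_of_square[OF Zm Z(2)] by simp_all
  have YZi: "integrable M (\<lambda>\<omega>. Y \<omega> * Z \<omega>)"
    by (rule Bochner_Integration.integrable_bound[OF Bochner_Integration.integrable_add[OF Y(2) Z(2)]])
      (auto intro: order.trans[OF abs_mult_le_sum_squares])
  obtain F where F: "\<And>i. simple_function past (F i)" "\<And>\<omega>. \<omega> \<in> space M \<Longrightarrow> (\<lambda>i. F i \<omega>) \<longlonglongrightarrow> Y \<omega>"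
    "\<And>i \<omega>. \<omega> \<in> space M \<Longrightarrow> \<bar>F i \<omega>\<bar> \<le> 2 * \<bar>Y \<omega>\<bar>"
    using ex_simple_approximation[OF Y(1)] by blast
  obtain G where G: "\<And>i. simple_function (future n) (G i)" "\<And>\<omega>. \<omega> \<in> space M \<Longrightarrow> (\<lambda>i. G i \<omega>) \<longlonglongrightarrow> Z \<omega>"
    "\<And>i \<omega>. \<omega> \<in> space M \<Longrightarrow> \<bar>G i \<omega>\<bar> \<le> 2 * \<bar>Z \<omega>\<bar>"
    using ex_simple_approximation[OF Z(1)] by blast
  have [measurable]: "F i \<in> borel_measurable M" "G i \<in> borel_measurable M" for i
    using F(1) G(1) simple_function_gen_field borel_measurable_simple_function by blast+
  have lim1: "(\<lambda>i. expectation (H i)) \<longlonglongrightarrow> expectation W"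
    if "\<And>i. H i \<in> borel_measurable M" "integrable M W" "\<And>\<omega>. \<omega> \<in> space M \<Longrightarrow> (\<lambda>i. H i \<omega>) \<longlonglongrightarrow> W \<omega>"
      "\<And>i \<omega>. \<omega> \<in> space M \<Longrightarrow> \<bar>H i \<omega>\<bar> \<le> 2 * \<bar>W \<omega>\<bar>" for H :: "nat \<Rightarrow> 'a \<Rightarrow> real" and W
    using that by (intro integral_dominated_convergence[where w = "\<lambda>\<omega>. 2 * \<bar>W \<omega>\<bar>"]) auto
  have lim2: "(\<lambda>i. expectation (\<lambda>\<omega>. H i \<omega> * H' i \<omega>)) \<longlonglongrightarrow> expectation (\<lambda>\<omega>. W \<omega> * W' \<omega>)"
    if H: "\<And>i. H i \<in> borel_measurable M" "\<And>\<omega>. \<omega> \<in> space M \<Longrightarrow> (\<lambda>i. H i \<omega>) \<longlonglongrightarrow> W \<omega>"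
      "\<And>i \<omega>. \<omega> \<in> space M \<Longrightarrow> \<bar>H i \<omega>\<bar> \<le> 2 * \<bar>W \<omega>\<bar>"
      "\<And>i. H' i \<in> borel_measurable M" "\<And>\<omega>. \<omega> \<in> space M \<Longrightarrow> (\<lambda>i. H' i \<omega>) \<longlonglongrightarrow> W' \<omega>"
      "\<And>i \<omega>. \<omega> \<in> space M \<Longrightarrow> \<bar>H' i \<omega>\<bar> \<le> 2 * \<bar>W' \<omega>\<bar>"
      and int: "integrable M (\<lambda>\<omega>. W \<omega> * W' \<omega>)" for H H' :: "nat \<Rightarrow> 'a \<Rightarrow> real" and W W'
  proof (rule integral_dominated_convergence[where w = "\<lambda>\<omega>. 4 * \<bar>W \<omega> * W' \<omega>\<bar>"])
    show "AE \<omega> in M. norm (H i \<omega> * H' i \<omega>) \<le> 4 * \<bar>W \<omega> * W' \<omega>\<bar>" for i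
    proof (rule AE_I2)
      fix \<omega> assume "\<omega> \<in> space M"
      then have "\<bar>H i \<omega>\<bar> * \<bar>H' i \<omega>\<bar> \<le> (2 * \<bar>W \<omega>\<bar>) * (2 * \<bar>W' \<omega>\<bar>)"
        using H(3,6) by (intro mult_mono') auto
      then show "norm (H i \<omega> * H' i \<omega>) \<le> 4 * \<bar>W \<omega> * W' \<omega>\<bar>" by (simp add: abs_mult)
    qed
  qed (use H int in \<open>auto intro!: AE_I2 tendsto_mult intro: borel_measurable_integrable\<close>)
  have EY: "(\<lambda>i. expectation (F i)) \<longlonglongrightarrow> expectation Y" and EZ: "(\<lambda>i. expectation (G i)) \<longlonglongrightarrow> expectation Z"
    using lim1[of F Y] lim1[of G Z] F G Yi Zi by auto
  have EYZ: "(\<lambda>i. expectation (\<lambda>\<omega>. F i \<omega> * G i \<omega>)) \<longlonglongrightarrow> expectation (\<lambda>\<omega>. Y \<omega> * Z \<omega>)"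
    using F G YZi by (intro lim2) auto
  have EYY: "(\<lambda>i. expectation (\<lambda>\<omega>. (F i \<omega>)\<^sup>2)) \<longlonglongrightarrow> expectation (\<lambda>\<omega>. (Y \<omega>)\<^sup>2)"
    unfolding power2_eq_square using F Y(2) by (intro lim2) (auto simp: power2_eq_square)
  have EZZ: "(\<lambda>i. expectation (\<lambda>\<omega>. (G i \<omega>)\<^sup>2)) \<longlonglongrightarrow> expectation (\<lambda>\<omega>. (Z \<omega>)\<^sup>2)"
    unfolding power2_eq_square using G Z(2) by (intro lim2) (auto simp: power2_eq_square)
  let ?c = "measure \<nu> (- {\<infinity>}) ^ n"
  have "\<bar>expectation (\<lambda>\<omega>. Y \<omega> * Z \<omega>) - expectation Y * expectation Z\<bar> \<le> ?c *
    (sqrt (expectation (\<lambda>\<omega>. (Y \<omega>)\<^sup>2) - (expectation Y)\<^sup>2) * sqrt (expectation (\<lambda>\<omega>. (Z \<omega>)\<^sup>2) - (expectation Z)\<^sup>2))"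
  proof (rule LIMSEQ_le)
    show "(\<lambda>i. \<bar>expectation (\<lambda>\<omega>. F i \<omega> * G i \<omega>) - expectation (F i) * expectation (G i)\<bar>)
      \<longlonglongrightarrow> \<bar>expectation (\<lambda>\<omega>. Y \<omega> * Z \<omega>) - expectation Y * expectation Z\<bar>"
      by (intro tendsto_intros EY EZ EYZ)
    show "(\<lambda>i. ?c * (sqrt (expectation (\<lambda>\<omega>. (F i \<omega>)\<^sup>2) - (expectation (F i))\<^sup>2) *
        sqrt (expectation (\<lambda>\<omega>. (G i \<omega>)\<^sup>2) - (expectation (G i))\<^sup>2)))
      \<longlonglongrightarrow> ?c * (sqrt (expectation (\<lambda>\<omega>. (Y \<omega>)\<^sup>2) - (expectation Y)\<^sup>2) *
        sqrt (expectation (\<lambda>\<omega>. (Z \<omega>)\<^sup>2) - (expectation Z)\<^sup>2))"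
      by (intro tendsto_intros EY EZ EYY EZZ)
  qed (use simple_past_future_covariance_le[OF F(1) G(1)] in blast)
  moreover have "cov M Y Z = expectation (\<lambda>\<omega>. Y \<omega> * Z \<omega>) - expectation Y * expectation Z"
    by (rule cov_eq[OF Yi Zi YZi])
  moreover have "cov M Y Y = expectation (\<lambda>\<omega>. (Y \<omega>)\<^sup>2) - (expectation Y)\<^sup>2"
    using cov_eq[OF Yi Yi] Y(2) by (simp add: power2_eq_square)
  moreover have "cov M Z Z = expectation (\<lambda>\<omega>. (Z \<omega>)\<^sup>2) - (expectation Z)\<^sup>2"
    using cov_eq[OF Zi Zi] Z(2) by (simp add: power2_eq_square)
  ultimately show ?thesis by simp
qed

lemma abs_corr_le:
  assumes "Y \<in> square_integrable_rvs M past" "Z \<in> square_integrable_rvs M (future n)"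
  shows "\<bar>corr M Y Z\<bar> \<le> measure \<nu> (- {\<infinity>}) ^ n"
proof -
  let ?v = "sqrt (cov M Y Y) * sqrt (cov M Z Z)"
  have v: "0 \<le> ?v" by (simp add: cov_def)
  show ?thesis
  proof (cases "?v = 0")
    case False
    then have "0 < ?v" using v by linarith
    then show ?thesis
      using past_future_covariance_le[OF assms] by (simp add: corr_def abs_divide divide_le_eq)
  next
    case True
    then have "corr M Y Z = 0" unfolding corr_def by (simp only: div_by_0)
    then show ?thesis by simp
  qed
qed

lemma rho_mix_le: "rho_mix M X n \<le> measure \<nu> (- {\<infinity>}) ^ n"
  unfolding rho_mix_def rho_coeff_def
proof (rule cSUP_least)
  have "(\<lambda>_. 0) \<in> square_integrable_rvs M N" for N by (simp add: square_integrable_rvs_def)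
  then show "square_integrable_rvs M past \<times> square_integrable_rvs M (future n) \<noteq> {}" by blast
qed (auto intro: abs_corr_le)

text \<open>The indicators of s at the times 0 and n have the same variance, and it cancels against
  the second factor in \<open>dependence_visit\<close>.\<close>

lemma rho_mix_ge:
  assumes s: "0 < pmf \<pi> s" "pmf \<pi> s < 1"
  shows "level_cdf s ^ n \<le> rho_mix M X n"
proof -
  let ?Y = "indicator (visit 0 s) :: 'a \<Rightarrow> real" and ?Z = "indicator (visit n s) :: 'a \<Rightarrow> real"
  have sq: "(indicator A \<omega> :: real)\<^sup>2 = indicator A \<omega>" for A and \<omega> :: 'a by (simp add: indicator_def)
  have "indicator (visit k s) \<in> square_integrable_rvs M (gen_field M X T)" if "k \<in> T" for k T
    using visit_gen_field[OF that] by (simp add: square_integrable_rvs_def sq less_top[symmetric])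
  then have YZ: "?Y \<in> square_integrable_rvs M past" "?Z \<in> square_integrable_rvs M (future n)" by auto
  have cov_ind: "cov M (indicator A) (indicator B) = prob (A \<inter> B) - prob A * prob B"
    if "A \<in> sets M" "B \<in> sets M" for A B
    using that by (subst cov_eq) (auto simp: indicator_inter_arith[symmetric] less_top[symmetric])
  let ?w = "pmf \<pi> s * (1 - pmf \<pi> s)"
  have w: "0 < ?w" using s by simp
  have "cov M ?Y ?Y = ?w" "cov M ?Z ?Z = ?w"
    by (simp_all add: cov_ind prob_visit algebra_simps)
  then have "sqrt (cov M ?Y ?Y) * sqrt (cov M ?Z ?Z) = ?w" using w by simp
  then have "corr M ?Y ?Z = (prob (visit 0 s \<inter> visit n s) - prob (visit 0 s) * prob (visit n s)) / ?w"
    by (simp add: corr_def cov_ind)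
  then have "level_cdf s ^ n \<le> corr M ?Y ?Z"
    using dependence_visit[of s n] w by (simp add: pos_le_divide_eq)
  also have "\<dots> \<le> \<bar>corr M ?Y ?Z\<bar>" by simp
  also have "\<dots> \<le> rho_mix M X n"
    unfolding rho_mix_def rho_coeff_def
  proof (rule cSUP_upper2[where x = "(?Y, ?Z)"])
    show "bdd_above ((\<lambda>(Y, Z). \<bar>corr M Y Z\<bar>) ` (square_integrable_rvs M past \<times> square_integrable_rvs M (future n)))"
      by (intro bdd_aboveI2[where M = "measure \<nu> (- {\<infinity>}) ^ n"]) (auto intro: abs_corr_le)
  qed (use YZ in auto)
  finally show ?thesis .
qed

end

section \<open>The chain with prescribed rates\<close>

lemma ex_pmf_nat:
  fixes c :: "nat \<Rightarrow> real"
  assumes "\<And>k. 0 \<le> c k" "c sums 1"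
  shows "\<exists>Q. pmf Q = c"
proof -
  have "(\<integral>\<^sup>+k. ennreal (c k) \<partial>count_space UNIV) = (\<Sum>k. ennreal (c k))"
    by (rule nn_integral_count_space_nat)
  also have "\<dots> = 1"
    using assms by (simp add: suminf_ennreal2 sums_iff)
  finally have "pmf (embed_pmf c) = c" using assms(1) by (intro ext pmf_embed_pmf) auto
  then show ?thesis by blast
qed

text \<open>Index 0 takes the mass that p leaves over. It becomes state 0 in the stationary law and
  stands for the level \<infinity> in the law of the levels.\<close>

lemma ex_pmf_with_tail:
  fixes p :: "nat \<Rightarrow> real"
  assumes "\<And>k. 0 \<le> p k" "summable p" "suminf p \<le> 1"
  obtains Q where "pmf Q 0 = 1 - suminf p" "\<And>k. pmf Q (Suc k) = p k"
proof -
  let ?c = "\<lambda>n. case n of 0 \<Rightarrow> 1 - suminf p | Suc k \<Rightarrow> p k"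
  have "?c sums (suminf p + ?c 0)"
    by (rule sums_Suc) (use assms(2) in \<open>simp add: summable_sums\<close>)
  then have "\<exists>Q. pmf Q = ?c" using assms by (intro ex_pmf_nat) (auto split: nat.splits)
  then show ?thesis using that by (metis nat.simps(4,5))
qed

lemma ex_pmf_with_cdf:
  fixes u :: "nat \<Rightarrow> real"
  assumes r: "0 \<le> r" "r \<le> 1" and u: "\<And>k. 0 \<le> u k" "incseq u" "u \<longlonglongrightarrow> 1"
  obtains \<nu> :: "enat pmf" where "\<And>k. measure \<nu> {l. l \<le> enat (Suc k)} = r * u k"
    "measure \<nu> {l. l \<le> enat 0} = 0" "measure \<nu> (- {\<infinity>}) = r"
proof -
  \<comment> \<open>The sequence u with a 0 put in front, so that the level k + 1 receives the
    increment that ends at \<open>u k\<close> and level 0 receives nothing.\<close>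
  define v where "v k = (case k of 0 \<Rightarrow> 0 | Suc j \<Rightarrow> u j)" for k
  have v: "v \<longlonglongrightarrow> 1" by (rule LIMSEQ_imp_Suc) (use u in \<open>simp add: v_def\<close>)
  have q_sums: "(\<lambda>k. r * (v (Suc k) - v k)) sums r"
    using sums_mult[OF telescope_sums[OF v], of r] by (simp add: v_def)
  have "0 \<le> v (Suc k) - v k" for k
    using u incseq_SucD[OF u(2)] by (auto simp: v_def split: nat.splits)
  then have "0 \<le> r * (v (Suc k) - v k)" for k using r by simp
  then obtain Q where Q: "pmf Q 0 = 1 - r" "\<And>k. pmf Q (Suc k) = r * (v (Suc k) - v k)"
    using ex_pmf_with_tail[of "\<lambda>k. r * (v (Suc k) - v k)"] q_sums r by (auto simp: sums_iff)
  \<comment> \<open>index 0 of \<open>Q\<close> carries the mass \<open>1 - r\<close> of the level \<open>\<infinity>\<close>\<close>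
  define level where "level j = (if j = 0 then \<infinity> else enat j)" for j
  define \<nu> where "\<nu> = map_pmf level Q"
  show ?thesis
  proof (rule that[of \<nu>])
    fix k
    have "level -` {l. l \<le> enat (Suc k)} = Suc ` {..k}"
      by (force simp: level_def image_iff Suc_le_eq gr0_conv_Suc)
    then have "measure \<nu> {l. l \<le> enat (Suc k)} = (\<Sum>j\<le>k. r * (v (Suc j) - v j))"
      by (simp add: \<nu>_def measure_measure_pmf_finite sum.reindex Q)
    also have "\<dots> = r * u k"
      unfolding sum_distrib_left[symmetric] lessThan_Suc_atMost[symmetric] sum_lessThan_telescope
      by (simp add: v_def)
    finally show "measure \<nu> {l. l \<le> enat (Suc k)} = r * u k" .
  next
    have "level -` {l. l \<le> enat 0} = {}" by (auto simp: level_def)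
    then show "measure \<nu> {l. l \<le> enat 0} = 0" by (simp add: \<nu>_def)
  next
    have "level -` (- {\<infinity>}) = UNIV - {0}" by (auto simp: level_def)
    moreover have "measure Q (UNIV - {0}) = r"
      using measure_pmf.prob_compl[of "{0}" Q] by (simp add: Q measure_pmf_single)
    ultimately show "measure \<nu> (- {\<infinity>}) = r" by (simp add: \<nu>_def)
  qed
qed

theorem theorem1p3:
  fixes r :: real and f :: "real \<Rightarrow> real"
  assumes r: "0 < r" "r \<le> 1"
    and f_range: "\<And>x. 0 \<le> x \<Longrightarrow> 0 < f x \<and> f x \<le> 1 / 2"
    and f_cont: "continuous_on {0..} f"
    and f_decr: "strict_antimono_on {0..} f"
    and f_lim: "(f \<longlongrightarrow> 0) at_top"
    and f_slow: "\<And>u. 0 < u \<Longrightarrow> u < 1 \<Longrightarrow> (\<lambda>x. u powr x) \<in> o[at_top](f)"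
    and f_convex: "convex_on {0..} (\<lambda>x. ln (f x))"
  shows "\<exists>(M :: (int \<Rightarrow> real) measure) (X :: int \<Rightarrow> (int \<Rightarrow> real) \<Rightarrow> real).
    prob_space M \<and> random_sequence M X \<and> strictly_stationary M X \<and>
    countable_state M X \<and> markov M X \<and> reversible M X \<and>
    (\<forall>n::nat. n \<ge> 1 \<longrightarrow>
      rho_mix M X n = r ^ n \<and>
      1 / 2 * r ^ n * f (real n) \<le> alpha_mix M X n \<and>
      alpha_mix M X n \<le> beta_mix M X n \<and>
      beta_mix M X n \<le> 12 * r ^ n * f (real n))"
proof -
  interpret subexponential_log_convex "\<lambda>x. ln (f x)"
  proof
    show "continuous_on {0..} (\<lambda>x. ln (f x))"
      using f_range by (intro continuous_on_ln f_cont) force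
    show "ln (f y) < ln (f x)" if "0 \<le> x" "x < y" for x y
    proof -
      have "f y < f x" using that by (intro monotone_onD[OF f_decr]) auto
      then show ?thesis using f_range[of x] f_range[of y] that by simp
    qed
    have "eventually (\<lambda>x. 0 < f x) at_top"
      using eventually_ge_at_top[of 0] by eventually_elim (use f_range in blast)
    then have "filterlim f (at_right 0) at_top"
      using f_lim unfolding filterlim_at by (auto elim: eventually_mono)
    then show "filterlim (\<lambda>x. ln (f x)) at_bot at_top"
      by (rule filterlim_compose[OF ln_at_0])
    show "eventually (\<lambda>x. - e * x \<le> ln (f x)) at_top" if "0 < e" for e
    proof -
      \<comment> \<open>The base \<open>exp (- e)\<close> turns the hypothesis into a linear lower
        bound for \<open>ln f\<close>.\<close>
      have "(\<lambda>x. exp (- e) powr x) \<in> o[at_top](f)" using that by (intro f_slow) auto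
      then have "eventually (\<lambda>x. norm (exp (- e) powr x) \<le> 1 * norm (f x)) at_top"
        by (rule landau_o.smallD) simp
      then show ?thesis using eventually_ge_at_top[of 0]
      proof eventually_elim
        case (elim x)
        then have "exp (- e * x) \<le> f x" using f_range[of x] by (simp add: powr_def mult.commute)
        then have "ln (exp (- e * x)) \<le> ln (f x)" using f_range[of x] elim by (subst ln_le_cancel_iff) auto
        then show ?case by simp
      qed
    qed
    show "convex_on {0..} (\<lambda>x. ln (f x))" by (rule f_convex)
    show "ln (f 0) < 0" using f_range[of 0] by (intro ln_less_zero) auto
  qed
  have exp_ln_f: "exp (ln (f (real n))) = f (real n)" for n using f_range[of "real n"] by simp
  obtain p u where p: "\<And>k. 0 < p k" "p 0 = exp (ln (f 0))" "\<And>k. p (Suc k) \<le> p k / 3"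
    and u: "\<And>k. 0 < u k" "\<And>k. u k < 1" "incseq u" "u \<longlonglongrightarrow> 1"
    and dominating: "\<And>n. \<exists>k. exp (ln (f (real n))) \<le> p k * u k ^ n"
    and summable: "\<And>n. summable (\<lambda>k. p k * u k ^ n)"
    and sum_le: "\<And>n. (\<Sum>k. p k * u k ^ n) \<le> 6 * exp (ln (f (real n)))"
    using ex_dominating_exponentials by blast
  have p0: "p 0 \<le> 1 / 2" using f_range[of 0] p(2) by simp
  have p_half: "p k \<le> 1 / 2" for k
  proof (induction k)
    case (Suc k)
    then show ?case using p(1)[of k] p(3)[of k] by simp
  qed (rule p0)
  have p_sum: "summable p" "suminf p \<le> 3 / 2 * p 0"
    by (rule sums_le_geometric; use p less_imp_le in blast)+
  obtain \<pi> where \<pi>: "pmf \<pi> 0 = 1 - suminf p" "\<And>k. pmf \<pi> (Suc k) = p k"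
    using ex_pmf_with_tail[of p] p_sum p0 p(1) less_imp_le by (auto simp: less_imp_le)
  obtain \<nu> where \<nu>: "\<And>k. measure_pmf.prob \<nu> {l. l \<le> enat (Suc k)} = r * u k"
    "measure_pmf.prob \<nu> {l. l \<le> enat 0} = 0" "measure_pmf.prob \<nu> (- {\<infinity>}) = r"
    using ex_pmf_with_cdf[of r u] r u less_imp_le by (auto simp: less_imp_le)
  \<comment> \<open>The sum of p is at most \<open>3 / 2 * p 0\<close>, hence at most 3 / 4, so
    state 0 has positive mass.\<close>
  interpret level_kernel \<pi> \<nu>
    by unfold_locales (use \<pi>(1) p_sum p0 in \<open>auto simp: set_pmf_iff\<close>)
  obtain M :: "(int \<Rightarrow> real) measure" and S where "path_process \<pi> K M S"
    using ex_path_process by blast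
  then interpret level_process \<pi> \<nu> M S
    by (intro level_process.intro level_kernel_axioms)
  have cdf: "level_cdf (Suc k) = r * u k" "level_cdf 0 = 0" for k
    using \<nu> by (auto simp: level_cdf_def)
  have "rho_mix M X n = r ^ n \<and> 1 / 2 * r ^ n * f (real n) \<le> alpha_mix M X n \<and>
      alpha_mix M X n \<le> beta_mix M X n \<and> beta_mix M X n \<le> 12 * r ^ n * f (real n)"
    if n: "1 \<le> n" for n
  proof (intro conjI antisym)
    show "rho_mix M X n \<le> r ^ n" using rho_mix_le[of n] by (simp add: \<nu>(3))
    show "r ^ n \<le> rho_mix M X n"
    proof (rule LIMSEQ_le_const2)
      show "(\<lambda>k. (r * u k) ^ n) \<longlonglongrightarrow> r ^ n"
        using tendsto_power[OF tendsto_mult_left[OF u(4), of r], of n] by simp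
      have "(r * u k) ^ n \<le> rho_mix M X n" for k
        using rho_mix_ge[of "Suc k" n] p(1)[of k] p_half[of k] by (simp add: cdf \<pi>)
      then show "\<exists>N. \<forall>k\<ge>N. (r * u k) ^ n \<le> rho_mix M X n" by blast
    qed
    obtain k where k: "f (real n) \<le> p k * u k ^ n" using dominating[of n] unfolding exp_ln_f by blast
    have "1 / 2 * r ^ n * f (real n) \<le> (r ^ n * f (real n)) * (1 - p k)"
      using p_half[of k] r f_range[of "real n"]
        mult_left_mono[of "1 / 2" "1 - p k" "r ^ n * f (real n)"] by simp
    also have "\<dots> \<le> (r ^ n * (p k * u k ^ n)) * (1 - p k)"
      using k r p_half[of k] by (intro mult_right_mono mult_left_mono) auto
    also have "\<dots> = level_cdf (Suc k) ^ n * (pmf \<pi> (Suc k) * (1 - pmf \<pi> (Suc k)))"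
      by (simp add: cdf \<pi> power_mult_distrib mult_ac)
    also have "\<dots> \<le> alpha_mix M X n" by (rule alpha_mix_ge)
    finally show "1 / 2 * r ^ n * f (real n) \<le> alpha_mix M X n" .
    show "alpha_mix M X n \<le> beta_mix M X n" by (rule alpha_mix_le_beta_mix)
    have "(\<lambda>s. pmf \<pi> s * level_cdf s ^ n) sums (\<integral>s. level_cdf s ^ n \<partial>\<pi>)"
      by (rule sums_integral_pmf_nat[where C = 1]) (simp add: level_cdf_def power_le_one)
    moreover
    have tail: "(\<lambda>k. pmf \<pi> (Suc k) * level_cdf (Suc k) ^ n) sums (r ^ n * (\<Sum>k. p k * u k ^ n))"
      using sums_mult[OF summable_sums[OF summable[of n]], of "r ^ n"]
      by (simp add: cdf \<pi> power_mult_distrib mult_ac)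
    \<comment> \<open>State 0 never survives a step; for n = 0 the power would be 1.\<close>
    have "level_cdf 0 ^ n = 0" using n by (simp add: cdf power_0_left)
    with sums_Suc[OF tail] have "(\<lambda>s. pmf \<pi> s * level_cdf s ^ n) sums (r ^ n * (\<Sum>k. p k * u k ^ n))"
      by simp
    ultimately have "(\<integral>s. level_cdf s ^ n \<partial>\<pi>) = r ^ n * (\<Sum>k. p k * u k ^ n)" by (rule sums_unique2)
    also have "\<dots> \<le> r ^ n * (6 * f (real n))"
      using sum_le[of n] r unfolding exp_ln_f by (intro mult_left_mono) auto
    finally show "beta_mix M X n \<le> 12 * r ^ n * f (real n)" using beta_mix_le[of n] by simp
  qed
  then show ?thesis
    using prob_space_axioms random_sequence_X strictly_stationary_X countable_state_X markov_X reversible_X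
    by blast
qed

end
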